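(* Let $t\geq s\geq 1$ be integers, $r,r'\in\mathbb{Z}_2$ and $\eta\in\mathbb{P}^1(k)$. Then, as $D_4$-modules, $$M_s(r,\eta)\otimes M_t(r',\eta)\cong s(t-1)P(r+r')\oplus M_s(0,\eta)\oplus M_s(1,\eta).$$
   Context: Let $k$ be an algebraically closed field with $\mathrm{char}(k)\neq 2$. All modules are finite-dimensional left modules; $\otimes=\otimes_k$; $\mathbb{Z}_2=\mathbb{Z}/2\mathbb{Z}$; $nM$ denotes the direct sum of $n$ copies of $M$ (so $0M=0$); $\mathbb{P}^1(k)$ is identified with $k\cup\{\infty\}$; $l(M)$ is the length of $M$. $D_4$ is the $k$-algebra generated by $a,b,c,d$ subject to $ba=-ab$, $db=-bd$, $ca=-ac$, $dc=-cd$, $bc=cb$, $a^2=0$, $b^2=1$, $c^2=1$, $d^2=0$, $da+ad=1-bc$. It is a $16$-dimensional Hopf algebra (isomorphic to the Drinfeld double of Sweedler's 4-dimensional Hopf algebra) with comultiplication $\Delta(a)=a\otimes b+1\otimes a$, $\Delta(b)=b\otimes b$, $\Delta(c)=c\otimes c$, $\Delta(d)=d\otimes c+1\otimes d$, counit $\varepsilon(a)=\varepsilon(d)=0$, $\varepsilon(b)=\varepsilon(c)=1$, antipode $S(a)=-ab$, $S(b)=b$, $S(c)=c$, $S(d)=-dc$. Tensor products of $D_4$-modules are $D_4$-modules via $\Delta$. For $r\in\mathbb{Z}_2$, $V(r)$ is the one-dimensional simple module on which $a,d$ act as $0$ and $b,c$ act as $(-1)^r$, and $P(r)$ is the projective cover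 of $V(r)$. For $r\in\mathbb{Z}_2$, $\eta\in\mathbb{P}^1(k)$, $M_1(r,\eta)$ is the module with basis $v_1,v_2$ where $b,c$ act on $v_1$ as $(-1)^{r+1}$ and on $v_2$ as $(-1)^r$, $av_2=dv_2=0$, and $av_1=v_2$, $dv_1=-\eta v_2$ if $\eta\in k$, while $av_1=0$, $dv_1=v_2$ if $\eta=\infty$. An indecomposable module $M$ of Loewy length $2$ is of $(s,t)$-type if $l(M/\mathrm{soc}(M))=s$ and $l(\mathrm{soc}(M))=t$. For $s\geq1$, $M_s(r,\eta)$ denotes the (known to be unique up to isomorphism) indecomposable module of $(s,s)$-type containing a submodule isomorphic to $M_1(r,\eta)$. *)

theory Defs
  imports
    "HOL-Algebra.AbelCoset"
    "Jordan_Normal_Form.VS_Connect"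
    "HOL-Library.Poly_Mapping"
    "HOL-Library.Z2"
begin

section \<open>Modules over the algebra D_4\<close>

text \<open>
  \<open>D\<^sub>4\<close> is given by generators and relations, so a left \<open>D\<^sub>4\<close>-module is a vector space with four
  endomorphisms satisfying the defining relations.  The ground field is a type \<open>'k\<close>, seen as a ring
  record through \<open>class_ring\<close>; the fields \<open>mult\<close> and \<open>one\<close> that the record type \<open>module\<close>
  inherits from \<open>ring\<close> carry no meaning for modules.
\<close>

datatype gen = gen_a | gen_b | gen_c | gen_d

record ('k, 'v) D4_mod = "('k, 'v) module" +
  act :: "gen \<Rightarrow> 'v \<Rightarrow> 'v"

locale D4_module = vectorspace "class_ring :: 'k::field ring" M
  for M :: "('k::field, 'v) D4_mod" (structure) +
  assumes finite_dimensional: "fin_dim"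
    and act_linear: "act M g \<in> LinearCombinations.module_hom class_ring M M"
    and rel_ba: "x \<in> carrier M \<Longrightarrow> act M gen_b (act M gen_a x) = \<ominus> act M gen_a (act M gen_b x)"
    and rel_db: "x \<in> carrier M \<Longrightarrow> act M gen_d (act M gen_b x) = \<ominus> act M gen_b (act M gen_d x)"
    and rel_ca: "x \<in> carrier M \<Longrightarrow> act M gen_c (act M gen_a x) = \<ominus> act M gen_a (act M gen_c x)"
    and rel_dc: "x \<in> carrier M \<Longrightarrow> act M gen_d (act M gen_c x) = \<ominus> act M gen_c (act M gen_d x)"
    and rel_bc: "x \<in> carrier M \<Longrightarrow> act M gen_b (act M gen_c x) = act M gen_c (act M gen_b x)"
    and rel_aa: "x \<in> carrier M \<Longrightarrow> act M gen_a (act M gen_a x) = \<zero>"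
    and rel_bb: "x \<in> carrier M \<Longrightarrow> act M gen_b (act M gen_b x) = x"
    and rel_cc: "x \<in> carrier M \<Longrightarrow> act M gen_c (act M gen_c x) = x"
    and rel_dd: "x \<in> carrier M \<Longrightarrow> act M gen_d (act M gen_d x) = \<zero>"
    and rel_da: "x \<in> carrier M \<Longrightarrow>
      act M gen_d (act M gen_a x) \<oplus> act M gen_a (act M gen_d x) = x \<ominus> act M gen_b (act M gen_c x)"

definition D4_hom :: "('k::field, 'v) D4_mod \<Rightarrow> ('k, 'w) D4_mod \<Rightarrow> ('v \<Rightarrow> 'w) set" where
  "D4_hom M N = {f \<in> LinearCombinations.module_hom class_ring M N.
     \<forall>g. \<forall>x\<in>carrier M. f (act M g x) = act N g (f x)}"

definition D4_iso :: "('k::field, 'v) D4_mod \<Rightarrow> ('k, 'w) D4_mod \<Rightarrow> bool"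
    (infix \<open>\<cong>\<^sub>D\<close> 50) where
  "M \<cong>\<^sub>D N \<longleftrightarrow> (\<exists>f \<in> D4_hom M N. bij_betw f (carrier M) (carrier N))"

definition D4_submodule :: "'v set \<Rightarrow> ('k::field, 'v) D4_mod \<Rightarrow> bool" where
  "D4_submodule N M \<longleftrightarrow>
     VectorSpace.subspace class_ring N M \<and> (\<forall>g. \<forall>x\<in>N. act M g x \<in> N)"

definition D4_restrict :: "('k, 'v) D4_mod \<Rightarrow> 'v set \<Rightarrow> ('k, 'v) D4_mod" where
  "D4_restrict M N = M\<lparr>carrier := N\<rparr>"

text \<open>
  The elements of \<open>M/N\<close> are the cosets of \<open>N\<close>.  A linear map \<open>T\<close> preserving \<open>N\<close> sends the coset
  \<open>X = N + x\<close> to \<open>N + T ` X = N + T x\<close>; adding \<open>N\<close> is needed when \<open>T\<close> does not map \<open>N\<close> onto \<open>N\<close>.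
\<close>

definition D4_quotient :: "('k::field, 'v) D4_mod \<Rightarrow> 'v set \<Rightarrow> ('k, 'v set) D4_mod" where
  "D4_quotient M N =
     \<lparr>carrier = A_RCOSETS M N, mult = undefined, one = undefined, zero = N,
      add = (\<lambda>X Y. set_add M X Y),
      smult = (\<lambda>k X. set_add M N ((\<lambda>x. k \<odot>\<^bsub>M\<^esub> x) ` X)),
      act = (\<lambda>g X. set_add M N (act M g ` X))\<rparr>"


section \<open>Direct sums and tensor products\<close>

definition D4_sum :: "('k, 'v) D4_mod \<Rightarrow> ('k, 'w) D4_mod \<Rightarrow> ('k, 'v \<times> 'w) D4_mod"
    (infixr \<open>\<oplus>\<^sub>D\<close> 65) where
  "M \<oplus>\<^sub>D N = module.extend (direct_sum M N)
     (D4_mod.fields (\<lambda>g v. (act M g (fst v), act N g (snd v))))"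

definition D4_copies :: "nat \<Rightarrow> ('k, 'v) D4_mod \<Rightarrow> ('k, nat \<Rightarrow> 'v) D4_mod" where
  "D4_copies n M =
     \<lparr>carrier = {..<n} \<rightarrow>\<^sub>E carrier M, mult = undefined, one = undefined,
      zero = (\<lambda>i\<in>{..<n}. \<zero>\<^bsub>M\<^esub>),
      add = (\<lambda>u v. \<lambda>i\<in>{..<n}. u i \<oplus>\<^bsub>M\<^esub> v i),
      smult = (\<lambda>k v. \<lambda>i\<in>{..<n}. k \<odot>\<^bsub>M\<^esub> v i),
      act = (\<lambda>g v. \<lambda>i\<in>{..<n}. act M g (v i))\<rparr>"

text \<open>
  The tensor product over \<open>k\<close> is the free vector space on \<open>M \<times> N\<close> modulo the bilinearity relations.
  A finitely supported function \<open>f\<close> stands for the formal sum of the \<open>f p\<close>-multiples of the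
  symbols \<open>p\<close>.
\<close>

definition fs_scale :: "'k::field \<Rightarrow> ('x \<Rightarrow>\<^sub>0 'k) \<Rightarrow> ('x \<Rightarrow>\<^sub>0 'k)" where
  "fs_scale k f = Poly_Mapping.map (\<lambda>c. k * c) f"

definition fs_extend :: "('x \<Rightarrow> ('y \<Rightarrow>\<^sub>0 'k::field)) \<Rightarrow> ('x \<Rightarrow>\<^sub>0 'k) \<Rightarrow> ('y \<Rightarrow>\<^sub>0 'k)" where
  "fs_extend h f = (\<Sum>p\<in>Poly_Mapping.keys f. fs_scale (Poly_Mapping.lookup f p) (h p))"

definition pair_sym :: "'v \<Rightarrow> 'w \<Rightarrow> ('v \<times> 'w \<Rightarrow>\<^sub>0 'k::field)" where
  "pair_sym x y = Poly_Mapping.single (x, y) 1"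

text \<open>
  The action of a generator \<open>g\<close> on \<open>x \<otimes> y\<close> is that of the comultiplication:
  \<open>\<Delta>(a) = a \<otimes> b + 1 \<otimes> a\<close>, \<open>\<Delta>(b) = b \<otimes> b\<close>, \<open>\<Delta>(c) = c \<otimes> c\<close>, \<open>\<Delta>(d) = d \<otimes> c + 1 \<otimes> d\<close>.
\<close>

fun comult_act :: "('k::field, 'v) D4_mod \<Rightarrow> ('k, 'w) D4_mod \<Rightarrow> gen \<Rightarrow> 'v \<times> 'w \<Rightarrow> ('v \<times> 'w \<Rightarrow>\<^sub>0 'k)"
where
  "comult_act M N gen_a (x, y) = pair_sym (act M gen_a x) (act N gen_b y) + pair_sym x (act N gen_a y)"
| "comult_act M N gen_b (x, y) = pair_sym (act M gen_b x) (act N gen_b y)"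
| "comult_act M N gen_c (x, y) = pair_sym (act M gen_c x) (act N gen_c y)"
| "comult_act M N gen_d (x, y) = pair_sym (act M gen_d x) (act N gen_c y) + pair_sym x (act N gen_d y)"

text \<open>This carries the four operators but, before passing to the quotient, not their relations.\<close>

definition free_on_pairs ::
    "('k::field, 'v) D4_mod \<Rightarrow> ('k, 'w) D4_mod \<Rightarrow> ('k, 'v \<times> 'w \<Rightarrow>\<^sub>0 'k) D4_mod" where
  "free_on_pairs M N =
     \<lparr>carrier = {f. Poly_Mapping.keys f \<subseteq> carrier M \<times> carrier N},
      mult = undefined, one = undefined, zero = 0, add = (+), smult = fs_scale,
      act = (\<lambda>g. fs_extend (comult_act M N g))\<rparr>"

definition bilinearity_relations ::
    "('k::field, 'v) D4_mod \<Rightarrow> ('k, 'w) D4_mod \<Rightarrow> ('v \<times> 'w \<Rightarrow>\<^sub>0 'k) set" where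
  "bilinearity_relations M N =
     {pair_sym (x \<oplus>\<^bsub>M\<^esub> x') y - pair_sym x y - pair_sym x' y | x x' y.
        x \<in> carrier M \<and> x' \<in> carrier M \<and> y \<in> carrier N} \<union>
     {pair_sym x (y \<oplus>\<^bsub>N\<^esub> y') - pair_sym x y - pair_sym x y' | x y y'.
        x \<in> carrier M \<and> y \<in> carrier N \<and> y' \<in> carrier N} \<union>
     {pair_sym (k \<odot>\<^bsub>M\<^esub> x) y - fs_scale k (pair_sym x y) | k x y. x \<in> carrier M \<and> y \<in> carrier N} \<union>
     {pair_sym x (k \<odot>\<^bsub>N\<^esub> y) - fs_scale k (pair_sym x y) | k x y. x \<in> carrier M \<and> y \<in> carrier N}"

definition D4_tensor ::
    "('k::field, 'v) D4_mod \<Rightarrow> ('k, 'w) D4_mod \<Rightarrow> ('k, ('v \<times> 'w \<Rightarrow>\<^sub>0 'k) set) D4_mod"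
    (infixr \<open>\<otimes>\<^sub>D\<close> 70) where
  "M \<otimes>\<^sub>D N = D4_quotient (free_on_pairs M N)
     (LinearCombinations.module.span class_ring (free_on_pairs M N) (bilinearity_relations M N))"


section \<open>Socle, length, Loewy length, projective covers\<close>

definition D4_simple :: "('k::field, 'v) D4_mod \<Rightarrow> bool" where
  "D4_simple M \<longleftrightarrow> carrier M \<noteq> {\<zero>\<^bsub>M\<^esub>} \<and>
     (\<forall>N. D4_submodule N M \<longrightarrow> N = {\<zero>\<^bsub>M\<^esub>} \<or> N = carrier M)"

text \<open>The sum of all simple submodules, as the smallest submodule containing each of them.\<close>

definition D4_socle :: "('k::field, 'v) D4_mod \<Rightarrow> 'v set" where
  "D4_socle M = \<Inter>{N. D4_submodule N M \<and>
     (\<forall>S. D4_submodule S M \<and> D4_simple (D4_restrict M S) \<longrightarrow> S \<subseteq> N)}"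

definition D4_indecomposable :: "('k::field, 'v) D4_mod \<Rightarrow> bool" where
  "D4_indecomposable M \<longleftrightarrow> carrier M \<noteq> {\<zero>\<^bsub>M\<^esub>} \<and>
     (\<forall>N N'. D4_submodule N M \<and> D4_submodule N' M \<and>
        N \<inter> N' = {\<zero>\<^bsub>M\<^esub>} \<and> set_add M N N' = carrier M \<longrightarrow> N = {\<zero>\<^bsub>M\<^esub>} \<or> N' = {\<zero>\<^bsub>M\<^esub>})"

definition composition_series :: "('k::field, 'v) D4_mod \<Rightarrow> nat \<Rightarrow> (nat \<Rightarrow> 'v set) \<Rightarrow> bool" where
  "composition_series M n F \<longleftrightarrow> F 0 = {\<zero>\<^bsub>M\<^esub>} \<and> F n = carrier M \<and>
     (\<forall>i\<le>n. D4_submodule (F i) M) \<and>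
     (\<forall>i<n. F i \<subseteq> F (Suc i) \<and> D4_simple (D4_quotient (D4_restrict M (F (Suc i))) (F i)))"

text \<open>All composition series have the same length, so \<open>LEAST\<close> only selects that common value.\<close>

definition D4_length :: "('k::field, 'v) D4_mod \<Rightarrow> nat" where
  "D4_length M = (LEAST n. \<exists>F. composition_series M n F)"

fun socle_series :: "('k::field, 'v) D4_mod \<Rightarrow> nat \<Rightarrow> 'v set" where
  "socle_series M 0 = {\<zero>\<^bsub>M\<^esub>}"
| "socle_series M (Suc i) = {x \<in> carrier M.
     a_r_coset M (socle_series M i) x \<in> D4_socle (D4_quotient M (socle_series M i))}"

definition Loewy_length :: "('k::field, 'v) D4_mod \<Rightarrow> nat" where
  "Loewy_length M = (LEAST n. socle_series M n = carrier M)"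

definition has_type :: "nat \<Rightarrow> nat \<Rightarrow> ('k::field, 'v) D4_mod \<Rightarrow> bool" where
  "has_type s t M \<longleftrightarrow> D4_module M \<and> D4_indecomposable M \<and> Loewy_length M = 2 \<and>
     D4_length (D4_quotient M (D4_socle M)) = s \<and> D4_length (D4_restrict M (D4_socle M)) = t"

text \<open>
  The lifting property is tested against finite-dimensional modules whose elements have type
  \<open>nat \<Rightarrow> 'k\<close>.  This is no restriction: every \<open>n\<close>-dimensional module is isomorphic to one with
  carrier \<open>{f. \<forall>i\<ge>n. f i = 0}\<close>.
\<close>

definition D4_projective :: "('k::field, 'v) D4_mod \<Rightarrow> bool" where
  "D4_projective P \<longleftrightarrow> D4_module P \<and>
     (\<forall>(X :: ('k, nat \<Rightarrow> 'k) D4_mod) (Y :: ('k, nat \<Rightarrow> 'k) D4_mod) p f.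
        D4_module X \<and> D4_module Y \<and> p \<in> D4_hom X Y \<and> p ` carrier X = carrier Y \<and> f \<in> D4_hom P Y
        \<longrightarrow> (\<exists>h \<in> D4_hom P X. \<forall>x\<in>carrier P. p (h x) = f x))"

definition projective_cover_of :: "('k::field, 'v) D4_mod \<Rightarrow> ('k, 'w) D4_mod \<Rightarrow> bool" where
  "projective_cover_of V P \<longleftrightarrow> D4_projective P \<and>
     (\<exists>p \<in> D4_hom P V. p ` carrier P = carrier V \<and>
        (\<forall>N. D4_submodule N P \<and> set_add P N {x \<in> carrier P. p x = \<zero>\<^bsub>V\<^esub>} = carrier P
           \<longrightarrow> N = carrier P))"


section \<open>The modules V(r), P(r) and M_s(r,eta)\<close>

text \<open>\<open>\<int>\<^sub>2\<close> is the type \<open>bit\<close> and \<open>sgn2 r\<close> is \<open>(-1)\<^sup>r\<close>.\<close>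

definition sgn2 :: "bit \<Rightarrow> 'k::field" where
  "sgn2 r = (if r = 0 then 1 else - 1)"

datatype 'k proj_line = Finite 'k | Infinity

definition V_mod :: "bit \<Rightarrow> ('k::field, 'k) D4_mod" where
  "V_mod r =
     \<lparr>carrier = UNIV, mult = undefined, one = undefined, zero = 0, add = (+), smult = (*),
      act = (\<lambda>g x. case g of gen_a \<Rightarrow> 0 | gen_b \<Rightarrow> sgn2 r * x | gen_c \<Rightarrow> sgn2 r * x | gen_d \<Rightarrow> 0)\<rparr>"

definition is_P :: "bit \<Rightarrow> ('k::field, 'v) D4_mod \<Rightarrow> bool" where
  "is_P r P \<longleftrightarrow> projective_cover_of (V_mod r) P"

text \<open>The pair \<open>(x, y)\<close> stands for \<open>x v\<^sub>1 + y v\<^sub>2\<close>.\<close>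

fun M1_act :: "bit \<Rightarrow> 'k::field proj_line \<Rightarrow> gen \<Rightarrow> 'k \<times> 'k \<Rightarrow> 'k \<times> 'k" where
  "M1_act r (Finite e) gen_a (x, y) = (0, x)"
| "M1_act r (Finite e) gen_d (x, y) = (0, - e * x)"
| "M1_act r Infinity gen_a (x, y) = (0, 0)"
| "M1_act r Infinity gen_d (x, y) = (0, x)"
| "M1_act r \<eta> gen_b (x, y) = (sgn2 (r + 1) * x, sgn2 r * y)"
| "M1_act r \<eta> gen_c (x, y) = (sgn2 (r + 1) * x, sgn2 r * y)"

definition M1_mod :: "bit \<Rightarrow> 'k::field proj_line \<Rightarrow> ('k, 'k \<times> 'k) D4_mod" where
  "M1_mod r \<eta> =
     \<lparr>carrier = UNIV, mult = undefined, one = undefined, zero = (0, 0),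
      add = (\<lambda>(x, y) (x', y'). (x + x', y + y')),
      smult = (\<lambda>k (x, y). (k * x, k * y)),
      act = M1_act r \<eta>\<rparr>"

text \<open>\<open>P(r)\<close> and \<open>M\<^sub>s(r,\<eta>)\<close> are determined up to isomorphism, so they are predicates on modules.\<close>

definition is_M :: "nat \<Rightarrow> bit \<Rightarrow> 'k::field proj_line \<Rightarrow> ('k, 'v) D4_mod \<Rightarrow> bool" where
  "is_M s r \<eta> M \<longleftrightarrow> has_type s s M \<and>
     (\<exists>N. D4_submodule N M \<and> M1_mod r \<eta> \<cong>\<^sub>D D4_restrict M N)"

end

theory Submission
  imports Defs
begin

text \<open>
  On \<open>M\<^sub>s(r,\<eta>)\<close> the central element \<open>bc\<close> acts as the identity, so \<open>a\<close> and \<open>d\<close> anticommute and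
  map the top to the socle.  They form an indecomposable pencil of square matrices; over an infinite
  field such a pencil has an injective member, and the submodule \<open>M\<^sub>1(r,\<eta>)\<close> forces it to be a single
  Jordan block: there is a basis \<open>X i, Y i\<close> with \<open>A (X i) = Y i\<close> and \<open>D (X i) = Y (i - 1)\<close>, where \<open>A, D\<close>
  are \<open>a, d + \<eta> a\<close>, or \<open>d, a\<close> if \<open>\<eta> = \<infinity>\<close>.  Projectivity tested on an explicit
  four-dimensional module shows that \<open>P(r)\<close> is free of rank one over the exterior algebra on \<open>a, d\<close>.

  In \<open>M\<^sub>s(r,\<eta>) \<otimes> M\<^sub>t(r',\<eta>)\<close> each \<open>X i \<otimes> X j\<close> with \<open>j \<ge> 1\<close> spans the top of a
  candidate copy of \<open>P(r + r')\<close>, while the vectors \<open>\<Sum>i\<le>n. X i \<otimes> X (n - i)\<close> and \<open>X n \<otimes> Y (t - 1)\<close>, for \<open>n < s\<close>,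
  satisfy the relations of the tops of \<open>M\<^sub>s(r + r' + 1,\<eta>)\<close> and \<open>M\<^sub>s(r + r',\<eta>)\<close>.  Together they generate
  the tensor product, so counting dimensions, \<open>4 s t = 4 s (t - 1) + 2 s + 2 s\<close>, the sum is direct.
\<close>

section \<open>Finite-dimensional subspaces\<close>

text \<open>The definitions speak of submodules, \<open>LEAST\<close> lengths and cosets over
  unrelated element types. Every module is therefore carried into finitely supported functions on a
  fixed index set, with explicit operators (\<open>model\<close>). Modules with the same model are
  isomorphic, so the uniqueness of M_s(r,\<eta>) and P(r) comes out of the computation instead of
  being assumed.

  Lengths become usable because, once b = c, simple modules are lines and length is dimension; this
  is what makes the pencil square.

  The sign in d v_1 = -\<eta> v_2 makes d + \<eta> a kill v_1. This is the origin of D = d + \<eta>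
  a, and a kernel vector of D is what puts the eigenvalue 0 on the Jordan block.

  An injective member A + \<mu> D is found by splitting off the kernel vectors of all but finitely
  many members, after which a parameter must still be left over; algebraic closedness enters through
  this infinitude.

  The bound s \<le> t keeps the antidiagonal sums with n < s inside the index range of both
  factors.\<close>

locale lin_space = vector_space
begin

abbreviation endo :: "('b \<Rightarrow> 'b) \<Rightarrow> bool" where
  "endo \<equiv> Vector_Spaces.linear scale scale"

text \<open>Spaces of finitely supported functions on the elements of a module are usually
  infinite-dimensional, so finiteness is a property of subsets and not of the whole space.\<close>

definition fdim :: "'b set \<Rightarrow> bool" where
  "fdim U \<longleftrightarrow> (\<exists>B. finite B \<and> U \<subseteq> span B)"

lemma fdim_subset: "fdim U \<Longrightarrow> U' \<subseteq> U \<Longrightarrow> fdim U'"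
  unfolding fdim_def by blast

lemma fdim_basis:
  assumes "fdim U" "subspace U"
  obtains B where "finite B" "independent B" "span B = U" "card B = dim U"
proof -
  obtain B where B: "B \<subseteq> U" "independent B" "U \<subseteq> span B" "card B = dim U"
    using basis_exists .
  obtain T where "finite T" "U \<subseteq> span T" using assms(1) unfolding fdim_def by blast
  then have "finite B" using independent_span_bound[of T B] B by blast
  moreover have "span B = U" using B assms(2) by (simp add: span_subspace)
  ultimately show ?thesis using that B by blast
qed

lemma independent_card_le_dim':
  assumes "fdim U" "B \<subseteq> U" "independent B"
  shows "finite B" "card B \<le> dim U"
proof -
  obtain C where C: "C \<subseteq> U" "independent C" "U \<subseteq> span C" "card C = dim U"
    using basis_exists .
  obtain T where "finite T" "U \<subseteq> span T" using assms(1) unfolding fdim_def by blast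
  then have "finite C" using independent_span_bound[of T C] C by blast
  then show "finite B" "card B \<le> dim U"
    using independent_span_bound[of C B] C assms by auto
qed

lemma dim_mono':
  assumes "fdim U" "U' \<subseteq> U"
  shows "dim U' \<le> dim U"
proof -
  obtain C where "C \<subseteq> U'" "independent C" "U' \<subseteq> span C" "card C = dim U'"
    using basis_exists .
  then show ?thesis using independent_card_le_dim'[of U C] assms by auto
qed

lemma independent_dim_spans:
  assumes "fdim U" "B \<subseteq> U" "independent B" "dim U \<le> card B"
  shows "U \<subseteq> span B"
proof
  fix x assume x: "x \<in> U"
  show "x \<in> span B"
  proof (rule ccontr)
    assume nx: "x \<notin> span B"
    have fB: "finite B" using independent_card_le_dim' assms by blast
    have "independent (insert x B)" using independent_insertI nx assms(3) by blast
    then have "card (insert x B) \<le> dim U" using independent_card_le_dim'[of U "insert x B"] assms x by auto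
    moreover have "x \<notin> B" using nx span_base by blast
    ultimately show False using assms(4) fB by simp
  qed
qed

lemma subspace_eq_of_dim:
  assumes "fdim U" "subspace U'" "U' \<subseteq> U" "dim U \<le> dim U'"
  shows "U' = U"
proof -
  obtain B where B: "B \<subseteq> U'" "independent B" "U' \<subseteq> span B" "card B = dim U'"
    using basis_exists .
  have "U \<subseteq> span B" using independent_dim_spans[of U B] assms B by auto
  also have "\<dots> \<subseteq> U'" using B assms(2) by (simp add: span_minimal)
  finally show ?thesis using assms by blast
qed

lemma dim_insert':
  assumes "fdim U" "subspace U" "x \<notin> U"
  shows "dim (span (insert x U)) = Suc (dim U)"
proof -
  obtain B where B: "finite B" "independent B" "span B = U" "card B = dim U"
    using fdim_basis assms by metis
  have 1: "independent (insert x B)" using independent_insertI B assms(3) by blast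
  have "x \<notin> B" using B(3) assms(3) span_base by blast
  then have 2: "card (insert x B) = Suc (dim U)" using B by simp
  have "span (insert x B) = span (insert x U)"
    using span_insert[of x B] span_insert[of x U] B(3) by (metis span_span)
  then show ?thesis
    using dim_eq_card[of "insert x B" "span (insert x U)"] 1 2 by (simp add: span_span)
qed

lemma dim_zero': "dim {0} = 0"
  using dim_eq_card[of "{}" "{0}"] independent_empty by simp

lemma pair_self: "vector_space_pair scale scale"
  by unfold_locales

lemma linear_subspace_image:
  assumes "endo f" "subspace U"
  shows "subspace (f ` U)"
proof -
  interpret p: vector_space_pair scale scale by (rule pair_self)
  show ?thesis using p.linear_subspace_image assms by blast
qed

lemma dim_linear_image_inj:
  assumes f: "endo f" and U: "subspace U" and inj: "inj_on f U"
  shows "dim (f ` U) = dim U"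
proof -
  interpret p: vector_space_pair scale scale by (rule pair_self)
  obtain B where B: "B \<subseteq> U" "independent B" "U \<subseteq> span B" "card B = dim U"
    using basis_exists .
  have sp: "span B = U" using B U by (simp add: span_subspace)
  have "independent (f ` B)"
    using p.linear_independent_injective_image[OF f B(2)] inj sp by simp
  moreover have "span (f ` B) = span (f ` U)"
    using p.linear_span_image[OF f, of B] sp span_span by metis
  moreover have "card (f ` B) = card B"
    using card_image inj_on_subset[OF inj B(1)] by blast
  ultimately show ?thesis using dim_eq_card[of "f ` B" "f ` U"] B by simp
qed

lemma inj_imp_surj_of_dim:
  assumes f: "endo f" and V: "subspace V" and W: "fdim W" and im: "f ` V \<subseteq> W"
    and d: "dim W \<le> dim V" and inj: "inj_on f V"
  shows "f ` V = W"
  using subspace_eq_of_dim[OF W linear_subspace_image[OF f V] im] dim_linear_image_inj[OF f V inj] d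
  by simp

text \<open>A linear right inverse \<open>g\<close> of \<open>f\<close> is injective on W, hence
  maps W onto V by the dimension count; so every v in V is some \<open>g w\<close>, and
  \<open>g (f v) = v\<close>.\<close>

lemma surj_imp_inj_of_dim:
  assumes f: "endo f" and V: "subspace V" "fdim V" and W: "subspace W"
    and im: "f ` V = W" and d: "dim V \<le> dim W"
  shows "inj_on f V"
proof -
  interpret p: vector_space_pair scale scale by (rule pair_self)
  obtain g where g: "range g \<subseteq> V" "endo g" "\<forall>v\<in>f ` V. f (g v) = v"
    using p.linear_exists_right_inverse_on[OF f V(1)] by (elim exE conjE)
  have gi: "f (g v) = v" if "v \<in> W" for v using g(3) im that by blast
  have "inj_on g W" by (rule inj_on_inverseI[of _ f]) (rule gi)
  then have gW: "g ` W = V" using inj_imp_surj_of_dim[OF g(2) W V(2) _ d] g(1) by auto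
  show ?thesis
  proof (rule inj_on_inverseI[of _ g])
    fix v assume "v \<in> V"
    then show "g (f v) = v" using gW gi by fastforce
  qed
qed

text \<open>Since U and Z may fail to span the space, the projection is built from two retractions:
  \<open>q\<close> onto Z, and \<open>g\<close>, a left inverse on U of the map sending x to x - q
  x. That map kills Z and is injective on U, because u = q u puts u in the intersection.\<close>

lemma projection_exists:
  assumes "subspace U" "subspace Z" "U \<inter> Z \<subseteq> {0}"
  obtains p where "endo p" "\<And>u. u \<in> U \<Longrightarrow> p u = u" "\<And>z. z \<in> Z \<Longrightarrow> p z = 0"
    "\<And>x. p x \<in> U"
proof -
  interpret p: vector_space_pair scale scale by (rule pair_self)
  obtain q where q: "range q \<subseteq> Z" "endo q" "\<And>v. v \<in> Z \<Longrightarrow> q v = v"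
    using p.linear_exists_left_inverse_on[OF linear_ident assms(2)] by auto
  have l: "endo (\<lambda>x. x - q x)"
    using p.linear_compose_sub[OF linear_ident q(2)] by simp
  interpret l: Vector_Spaces.linear scale scale "\<lambda>x. x - q x" by (rule l)
  have "u = 0" if "u \<in> U" "u - q u = 0" for u
  proof -
    have "u = q u" using that(2) by simp
    then have "u \<in> Z" using q(1) by (metis rangeI subsetD)
    then show ?thesis using that(1) assms(3) by blast
  qed
  then have "inj_on (\<lambda>x. x - q x) U"
    using l.inj_on_iff_eq_0[OF assms(1)] by simp
  then obtain g where g: "range g \<subseteq> U" "endo g" "\<And>v. v \<in> U \<Longrightarrow> g (v - q v) = v"
    using p.linear_exists_left_inverse_on[OF l assms(1)] by auto
  show ?thesis
  proof (rule that[of "\<lambda>x. g (x - q x)"])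
    show "endo (\<lambda>x. g (x - q x))"
      using Vector_Spaces.linear_compose[OF l g(2)] by (simp add: o_def)
    show "g (z - q z) = 0" if "z \<in> Z" for z
      using q(3)[OF that] p.linear_0[OF g(2)] by simp
  qed (use g in auto)
qed

lemma pair_scalar: "vector_space_pair scale ((*) :: 'a \<Rightarrow> 'a \<Rightarrow> 'a)"
  by unfold_locales (auto simp: algebra_simps)

text \<open>Supplies functionals dual to a basis that also vanish on a prescribed subspace: extend
  the values on \<open>B\<close> linearly and precompose with the projection that kills Z.\<close>

lemma functional_exists:
  assumes "independent B" "subspace Z" "span B \<inter> Z \<subseteq> {0}"
  obtains \<phi> where "Vector_Spaces.linear scale (*) \<phi>" "\<And>b. b \<in> B \<Longrightarrow> \<phi> b = (h b :: 'a)" "\<And>z. z \<in> Z \<Longrightarrow> \<phi> z = 0"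
proof -
  interpret k: vector_space_pair scale "(*) :: 'a \<Rightarrow> 'a \<Rightarrow> 'a" by (rule pair_scalar)
  obtain p where p: "endo p" "\<And>u. u \<in> span B \<Longrightarrow> p u = u" "\<And>z. z \<in> Z \<Longrightarrow> p z = 0"
    using projection_exists[OF subspace_span assms(2,3)] by metis
  obtain g where g: "Vector_Spaces.linear scale (*) g" "\<And>b. b \<in> B \<Longrightarrow> g b = h b"
    using k.linear_independent_extend[OF assms(1)] by metis
  show ?thesis
  proof (rule that[of "\<lambda>x. g (p x)"])
    show "Vector_Spaces.linear scale (*) (\<lambda>x. g (p x))"
      using Vector_Spaces.linear_compose[OF p(1) g(1)] by (simp add: o_def)
    show "g (p b) = h b" if "b \<in> B" for b using g p that span_base by metis
    show "g (p z) = 0" if "z \<in> Z" for z using p(3)[OF that] k.linear_0[OF g(1)] by simp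
  qed
qed

text \<open>Repetitions are excluded as well: if e i = e j with i \<noteq> j, the coefficients 1 at
  i and -1 at j give a vanishing combination.\<close>

lemma independent_family:
  assumes "finite I" "\<And>c i. (\<Sum>i\<in>I. c i *s e i) = 0 \<Longrightarrow> i \<in> I \<Longrightarrow> c i = 0"
  shows "inj_on e I" "independent (e ` I)"
proof -
  show inj: "inj_on e I"
  proof (rule inj_onI)
    fix i j assume ij: "i \<in> I" "j \<in> I" "e i = e j"
    show "i = j"
    proof (rule ccontr)
      assume ne: "i \<noteq> j"
      let ?c = "\<lambda>k. if k = i then 1 else if k = j then - 1 else 0 :: 'a"
      have "(\<Sum>k\<in>I. ?c k *s e k) = (\<Sum>k\<in>{i,j}. ?c k *s e k)"
        using ij assms(1) by (intro sum.mono_neutral_right) auto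
      also have "\<dots> = 0" using ne ij(3) by simp
      finally show False using assms(2)[of ?c i] ij(1) by simp
    qed
  qed
  show "independent (e ` I)"
  proof (rule independent_if_scalars_zero)
    fix f x assume f: "(\<Sum>x\<in>e ` I. f x *s x) = 0" and x: "x \<in> e ` I"
    then show "f x = 0" using assms(2)[of "\<lambda>i. f (e i)"] sum.reindex[OF inj, of "\<lambda>x. f x *s x"] by auto
  qed (use assms in auto)
qed

text \<open>A basis of V and one of W together form a basis of the span of S; they are disjoint
  because a basis does not contain 0.\<close>

lemma dim_direct_sum:
  assumes V: "subspace V" "fdim V" and W: "subspace W" "fdim W" and d: "V \<inter> W \<subseteq> {0}"
    and S: "\<And>v w. v \<in> V \<Longrightarrow> w \<in> W \<Longrightarrow> v + w \<in> S" "\<And>x. x \<in> S \<Longrightarrow> \<exists>v\<in>V. x - v \<in> W"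
  shows "dim S = dim V + dim W"
proof -
  obtain X where X: "finite X" "independent X" "span X = V" "card X = dim V" using fdim_basis[OF V(2,1)] .
  obtain Y where Y: "finite Y" "independent Y" "span Y = W" "card Y = dim W" using fdim_basis[OF W(2,1)] .
  have disj: "X \<inter> Y = {}"
  proof -
    have "X \<inter> Y \<subseteq> {0}" using d span_superset[of X] span_superset[of Y] X(3) Y(3) by blast
    moreover have "0 \<notin> X" using X(2) dependent_zero by blast
    ultimately show ?thesis by blast
  qed
  have ind: "independent (X \<union> Y)"
  proof (rule independent_if_scalars_zero)
    fix f x assume f: "(\<Sum>x\<in>X \<union> Y. f x *s x) = 0" and x: "x \<in> X \<union> Y"
    have sum: "(\<Sum>x\<in>X. f x *s x) + (\<Sum>x\<in>Y. f x *s x) = 0"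
      using f sum.union_disjoint[OF X(1) Y(1) disj, of "\<lambda>x. f x *s x"] by simp
    have a: "(\<Sum>x\<in>X. f x *s x) \<in> V" unfolding X(3)[symmetric] by (intro span_sum span_scale span_base)
    have b: "(\<Sum>x\<in>Y. f x *s x) \<in> W" unfolding Y(3)[symmetric] by (intro span_sum span_scale span_base)
    have "(\<Sum>x\<in>X. f x *s x) = - (\<Sum>x\<in>Y. f x *s x)" using sum by (rule eq_neg_iff_add_eq_0[THEN iffD2])
    then have "(\<Sum>x\<in>X. f x *s x) \<in> W" using subspace_neg[OF W(1) b] by simp
    then have 0: "(\<Sum>x\<in>X. f x *s x) = 0" using a d by blast
    then have "(\<Sum>x\<in>Y. f x *s x) = 0" using sum by simp
    then show "f x = 0" using 0 x independentD[OF X(2,1) order_refl] independentD[OF Y(2,1) order_refl] by blast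
  qed (use X Y in auto)
  have "span (X \<union> Y) = span S"
  proof
    have "X \<union> Y \<subseteq> S"
    proof
      fix z assume "z \<in> X \<union> Y"
      then have "z \<in> V \<or> z \<in> W" using X(3) Y(3) span_base by blast
      then show "z \<in> S" using S(1)[of z 0] S(1)[of 0 z] subspace_0[OF V(1)] subspace_0[OF W(1)] by auto
    qed
    then show "span (X \<union> Y) \<subseteq> span S" by (rule span_mono)
    have "S \<subseteq> span (X \<union> Y)"
    proof
      fix z assume "z \<in> S"
      then obtain v where v: "v \<in> V" "z - v \<in> W" using S(2) by blast
      then have "v \<in> span (X \<union> Y)" "z - v \<in> span (X \<union> Y)"
        using X(3) Y(3) span_mono[of X "X \<union> Y"] span_mono[of Y "X \<union> Y"] by blast+
      then have "v + (z - v) \<in> span (X \<union> Y)" by (rule span_add)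
      then show "z \<in> span (X \<union> Y)" by simp
    qed
    then show "span S \<subseteq> span (X \<union> Y)" by (simp add: span_minimal subspace_span)
  qed
  then show ?thesis using dim_eq_card[OF _ ind, of S] card_Un_disjoint[OF X(1) Y(1) disj] X(4) Y(4) by simp
qed

text \<open>Exchange argument: a finite set whose span contains the independent family
  \<open>F\<close> has at least card L elements, so a repeated or redundant vector in
  \<open>G\<close> would leave too few. It later turns generation of the tensor product plus a count
  of generators into directness of the sum.\<close>

lemma independent_of_card_spanning:
  assumes K: "finite K" and F: "independent (F ` L)" "inj_on F L" and L: "finite L"
    and sp: "F ` L \<subseteq> span (G ` K)" and c: "card K \<le> card L"
  shows "inj_on G K" "independent (G ` K)"
proof -
  have *: "card L \<le> card T" if "finite T" "F ` L \<subseteq> span T" for T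
    using independent_span_bound[OF that(1) F(1) that(2)] card_image[OF F(2)] by simp
  have "card K \<le> card (G ` K)" using *[of "G ` K"] K sp c by simp
  then show "inj_on G K" using K by (simp add: card_image_le eq_card_imp_inj_on le_antisym)
  show "independent (G ` K)"
  proof (rule ccontr)
    assume "\<not> independent (G ` K)"
    then obtain a where a: "a \<in> G ` K" "a \<in> span (G ` K - {a})" unfolding dependent_def by blast
    then have "span (G ` K - {a}) = span (G ` K)" by (metis insert_Diff span_redundant)
    then have "card L \<le> card (G ` K - {a})" using * sp K by simp
    also have "\<dots> < card (G ` K)" using a(1) K by (intro psubset_card_mono) auto
    also have "\<dots> \<le> card K" using K by (rule card_image_le)
    finally show False using c by simp
  qed
qed

end

section \<open>Indecomposable pencils of square format\<close>

text \<open>A representation of the Kronecker quiver with both spaces of the same dimension.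
  Indecomposability is phrased through pairs of subspaces and elementwise decompositions, the form
  in which splittings are produced below.\<close>

locale pencil = lin_space scale
  for scale :: "'a::field \<Rightarrow> 'b::ab_group_add \<Rightarrow> 'b" (infixr \<open>*s\<close> 75) +
  fixes V W :: "'b set" and A D :: "'b \<Rightarrow> 'b"
  assumes infinite_field: "infinite (UNIV :: 'a set)"
    and linear_A: "endo A"
    and linear_D: "endo D"
    and subspace_V: "subspace V" and subspace_W: "subspace W"
    and fdim_V: "fdim V" and fdim_W: "fdim W"
    and dim_eq: "dim V = dim W"
    and A_closed: "v \<in> V \<Longrightarrow> A v \<in> W" and D_closed: "v \<in> V \<Longrightarrow> D v \<in> W"
    and joint_kernel: "v \<in> V \<Longrightarrow> A v = 0 \<Longrightarrow> D v = 0 \<Longrightarrow> v = 0"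
    and indecomposable: "\<lbrakk>subspace V1; subspace V2; subspace W1; subspace W2;
      V1 \<subseteq> V; V2 \<subseteq> V; W1 \<subseteq> W; W2 \<subseteq> W;
      \<And>v. v \<in> V1 \<Longrightarrow> A v \<in> W1 \<and> D v \<in> W1; \<And>v. v \<in> V2 \<Longrightarrow> A v \<in> W2 \<and> D v \<in> W2;
      V1 \<inter> V2 \<subseteq> {0}; W1 \<inter> W2 \<subseteq> {0};
      \<And>v. v \<in> V \<Longrightarrow> \<exists>u\<in>V1. v - u \<in> V2; \<And>w. w \<in> W \<Longrightarrow> \<exists>u\<in>W1. w - u \<in> W2\<rbrakk>
      \<Longrightarrow> (V1 \<subseteq> {0} \<and> W1 \<subseteq> {0}) \<or> (V2 \<subseteq> {0} \<and> W2 \<subseteq> {0})"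
begin

sublocale p: vector_space_pair scale scale by (rule pair_self)

sublocale A: Vector_Spaces.linear scale scale A by (rule linear_A)
sublocale D: Vector_Spaces.linear scale scale D by (rule linear_D)

definition member :: "'a \<Rightarrow> 'b \<Rightarrow> 'b" where
  "member \<mu> v = A v + \<mu> *s D v"

lemma linear_member: "endo (member \<mu>)"
  unfolding member_def
  by (intro p.linear_compose_add linear_A p.linear_compose_scale_right linear_D)

lemma member_closed: "v \<in> V \<Longrightarrow> member \<mu> v \<in> W"
  unfolding member_def by (intro subspace_add subspace_scale subspace_W A_closed D_closed)

text \<open>
  Suppose infinitely many members of the pencil are singular.  The kernel vectors of all but
  finitely many of them generate a subpencil \<open>(UV, UW)\<close>, whose complement is cut out by
  functionals \<open>\<phi> y\<close> dual to a basis of \<open>UW\<close> made of vectors \<open>y = D x\<close> with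
  \<open>x\<close> in the kernel of the member at \<open>\<mu>\<close>; choosing \<open>\<phi> y\<close> to vanish on the image of a complement
  of \<open>UV\<close> under that member makes the complement a subpencil.  As the members map \<open>UV\<close> onto
  \<open>UW\<close> without being injective, \<open>UV\<close> is not all of \<open>V\<close>, contradicting indecomposability.
\<close>

lemma member_inj_ex: "\<exists>\<mu>. inj_on (member \<mu>) V"
proof -
  define K where "K \<mu> = {x \<in> V. member \<mu> x = 0}" for \<mu>
  define UV where "UV F = span (\<Union>\<mu>\<in>-F. K \<mu>)" for F
  define UW where "UW F = span (\<Union>\<mu>\<in>-F. D ` K \<mu>)" for F
  have KV: "K \<mu> \<subseteq> V" for \<mu> by (auto simp: K_def)
  have UV_V: "UV F \<subseteq> V" for F
    unfolding UV_def by (intro span_minimal subspace_V) (use KV in auto)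
  have UW_W: "UW F \<subseteq> W" for F
    unfolding UW_def by (intro span_minimal subspace_W) (use KV D_closed in auto)
  \<comment> \<open>\<open>UW F\<close> shrinks as F grows; at a finite F of minimal dimension it no
    longer changes when one more parameter is removed.\<close>
  obtain F where F: "finite F" "\<And>F'. finite F' \<Longrightarrow> dim (UW F) \<le> dim (UW F')"
    using ex_has_least_nat[of finite "{}" "\<lambda>F. dim (UW F)"] by auto
  have sUV: "subspace (UV F)" and sUW: "subspace (UW F)" unfolding UV_def UW_def by (rule subspace_span)+
  have UW_insert: "UW (insert \<mu> F) = UW F" for \<mu>
  proof (rule subspace_eq_of_dim)
    show "fdim (UW F)" using fdim_subset[OF fdim_W UW_W] .
    show "subspace (UW (insert \<mu> F))" unfolding UW_def by (rule subspace_span)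
    show "UW (insert \<mu> F) \<subseteq> UW F" unfolding UW_def by (intro span_mono) auto
    show "dim (UW F) \<le> dim (UW (insert \<mu> F))" using F by simp
  qed
  have A_K: "A x = - (\<nu> *s D x)" if "x \<in> K \<nu>" for x \<nu>
    using that by (simp add: K_def member_def eq_neg_iff_add_eq_0)
  have K_UV: "K \<nu> \<subseteq> UV F" if "\<nu> \<notin> F" for \<nu>
    unfolding UV_def using that by (auto intro: span_base)
  have DK_UW: "D ` K \<nu> \<subseteq> UW F" if "\<nu> \<notin> F" for \<nu>
    unfolding UW_def using that by (auto intro: span_base)
  \<comment> \<open>For x in \<open>K \<nu>\<close> the member at \<mu> sends x to (\<mu> - \<nu>) D
    x, so D x is reached after rescaling when \<nu> \<noteq> \<mu>; stability of \<open>UW F\<close>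
    allows \<mu> itself to be left out.\<close>
  have onto: "UW F \<subseteq> member \<mu> ` UV F" for \<mu>
  proof -
    have "UW (insert \<mu> F) \<subseteq> member \<mu> ` UV F" unfolding UW_def
    proof (intro span_minimal UN_least subsetI)
      show "subspace (member \<mu> ` UV F)" by (rule linear_subspace_image[OF linear_member sUV])
      fix \<nu> y assume \<nu>: "\<nu> \<in> - insert \<mu> F" and "y \<in> D ` K \<nu>"
      then obtain x where x: "x \<in> K \<nu>" "y = D x" by auto
      have "member \<mu> (inverse (\<mu> - \<nu>) *s x) = inverse (\<mu> - \<nu>) *s ((\<mu> - \<nu>) *s D x)"
        using A_K[OF x(1)] unfolding member_def
        by (simp add: A.scale D.scale algebra_simps)
      also have "\<dots> = y" using \<nu> x by auto
      finally show "y \<in> member \<mu> ` UV F"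
        using subspace_scale[OF sUV] K_UV[of \<nu>] x(1) \<nu> by (metis ComplD image_eqI insertCI subsetD)
    qed
    then show ?thesis using UW_insert by simp
  qed
  \<comment> \<open>By \<open>onto\<close>, v agrees with some u in \<open>UV F\<close> up to a
    kernel vector of the member at \<mu>, and that vector also lies in \<open>UV F\<close>.\<close>
  have pre: "v \<in> UV F" if v: "v \<in> V" and \<mu>: "\<mu> \<notin> F" and m: "member \<mu> v \<in> UW F" for v \<mu>
  proof -
    obtain u where u: "u \<in> UV F" "member \<mu> v = member \<mu> u" using onto[of \<mu>] m by auto
    have "member \<mu> (v - u) = 0" using u(2) p.linear_diff[OF linear_member] by simp
    moreover have "v - u \<in> V" using subspace_diff[OF subspace_V v] u(1) UV_V by blast
    ultimately have "v - u \<in> UV F" using K_UV[OF \<mu>] by (auto simp: K_def)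
    then have "(v - u) + u \<in> UV F" using subspace_add[OF sUV] u(1) by blast
    then show ?thesis by simp
  qed
  have A_UV: "A u \<in> UW F \<and> D u \<in> UW F" if "u \<in> UV F" for u
  proof -
    have "subspace {x. A x \<in> UW F \<and> D x \<in> UW F}"
      using sUW unfolding subspace_def by (auto simp: A.add A.scale D.add D.scale A.zero D.zero)
    moreover have "K \<nu> \<subseteq> {x. A x \<in> UW F \<and> D x \<in> UW F}" if "\<nu> \<notin> F" for \<nu>
    proof
      fix x assume x: "x \<in> K \<nu>"
      then have "D x \<in> UW F" using DK_UW that by auto
      then show "x \<in> {x. A x \<in> UW F \<and> D x \<in> UW F}"
        using A_K[OF x] subspace_neg[OF sUW] subspace_scale[OF sUW] by simp
    qed
    ultimately show ?thesis using that unfolding UV_def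
      by (metis (no_types, lifting) ComplD UN_least mem_Collect_eq span_minimal subsetD)
  qed
  obtain B where B: "B \<subseteq> (\<Union>\<mu>\<in>-F. D ` K \<mu>)" "independent B" "(\<Union>\<mu>\<in>-F. D ` K \<mu>) \<subseteq> span B"
    using maximal_independent_subset .
  have spB: "span B = UW F" unfolding UW_def
    using B(1,3) by (metis span_mono span_span subset_antisym)
  have finB: "finite B"
    using independent_card_le_dim'(1)[OF fdim_W _ B(2)] spB UW_W span_superset by blast
  have "\<forall>y\<in>B. \<exists>\<mu> x. \<mu> \<notin> F \<and> x \<in> K \<mu> \<and> D x = y" using B(1) by fastforce
  then obtain m x where mx: "\<And>y. y \<in> B \<Longrightarrow> m y \<notin> F" "\<And>y. y \<in> B \<Longrightarrow> x y \<in> K (m y)"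
      "\<And>y. y \<in> B \<Longrightarrow> D (x y) = y"
    by metis
  obtain q where q: "endo q" "\<And>u. u \<in> UV F \<Longrightarrow> q u = u" "\<And>v. q v \<in> UV F"
    using projection_exists[OF sUV subspace_single_0] by (metis inf_le2)
  interpret q: Vector_Spaces.linear scale scale q by (rule q(1))
  define V0 where "V0 = {v \<in> V. q v = 0}"
  have sV0: "subspace V0"
    using subspace_V unfolding V0_def subspace_def by (auto simp: q.add q.scale q.zero)
  have "\<exists>\<phi>. Vector_Spaces.linear scale (*) \<phi> \<and> (\<forall>b\<in>B. \<phi> b = (if b = y then 1 else 0)) \<and>
      (\<forall>v\<in>V0. \<phi> (member (m y) v) = 0)" if y: "y \<in> B" for y
  proof -
    \<comment> \<open>By \<open>pre\<close> such a v lies in \<open>UV F\<close>, where q is the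
      identity, while q v = 0 on \<open>V0\<close>. Hence a functional can be prescribed on
      \<open>B\<close> and still vanish on the image of \<open>V0\<close>.\<close>
    have "v = 0" if v: "v \<in> V0" "member (m y) v \<in> span B" for v
    proof -
      have "v \<in> UV F" using pre[of v "m y"] v mx(1)[OF y] spB by (simp add: V0_def)
      then show ?thesis using q(2) v(1) by (simp add: V0_def)
    qed
    then have "span B \<inter> member (m y) ` V0 \<subseteq> {0}"
      using p.linear_0[OF linear_member] by auto
    then show ?thesis
      using functional_exists[OF B(2) linear_subspace_image[OF linear_member sV0],
          where h = "\<lambda>b. if b = y then 1 else 0"]
      by (metis image_eqI)
  qed
  then obtain \<phi> where phi: "\<And>y. y \<in> B \<Longrightarrow> Vector_Spaces.linear scale (*) (\<phi> y)"
      "\<And>y b. y \<in> B \<Longrightarrow> b \<in> B \<Longrightarrow> \<phi> y b = (if b = y then 1 else 0)"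
      "\<And>y v. y \<in> B \<Longrightarrow> v \<in> V0 \<Longrightarrow> \<phi> y (member (m y) v) = 0"
    by metis
  interpret k: vector_space_pair scale "(*) :: 'a \<Rightarrow> 'a \<Rightarrow> 'a" by (rule pair_scalar)
  have phi_sum: "\<phi> y (\<Sum>b\<in>B. c b *s b) = c y" if y: "y \<in> B" for y c
  proof -
    have "\<phi> y (\<Sum>b\<in>B. c b *s b) = (\<Sum>b\<in>B. c b * \<phi> y b)"
      by (simp add: k.linear_sum[OF phi(1)[OF y]] k.linear_scale[OF phi(1)[OF y]])
    also have "\<dots> = (\<Sum>b\<in>B. if b = y then c y else 0)"
      by (intro sum.cong) (auto simp: phi(2)[OF y])
    also have "\<dots> = c y" using finB y by simp
    finally show ?thesis .
  qed
  define W' where "W' = {w \<in> W. \<forall>y\<in>B. \<phi> y w = 0}"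
  define V' where "V' = {v \<in> V. A v \<in> W' \<and> D v \<in> W'}"
  have sW': "subspace W'"
    using subspace_W unfolding W'_def subspace_def
    by (auto simp: k.linear_add[OF phi(1)] k.linear_scale[OF phi(1)] k.linear_0[OF phi(1)])
  have sV': "subspace V'"
    using subspace_V sW' unfolding V'_def subspace_def
    by (auto simp: A.add A.scale D.add D.scale A.zero D.zero)
  have W_disj: "UW F \<inter> W' \<subseteq> {0}"
  proof
    fix w assume w: "w \<in> UW F \<inter> W'"
    then obtain c where c: "w = (\<Sum>b\<in>B. c b *s b)" using span_finite[OF finB] spB by auto
    then have "c y = 0" if "y \<in> B" for y using phi_sum[OF that, of c] w that by (auto simp: W'_def)
    then show "w \<in> {0}" using c by simp
  qed
  have V_disj: "UV F \<inter> V' \<subseteq> {0}"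
  proof
    fix v assume "v \<in> UV F \<inter> V'"
    then have "A v \<in> UW F \<inter> W'" "D v \<in> UW F \<inter> W'" "v \<in> V" using A_UV by (auto simp: V'_def)
    then show "v \<in> {0}" using W_disj joint_kernel[of v] by blast
  qed
  have W_sum: "\<exists>u\<in>UW F. w - u \<in> W'" if w: "w \<in> W" for w
  proof
    let ?u = "\<Sum>b\<in>B. \<phi> b w *s b"
    show u: "?u \<in> UW F" unfolding spB[symmetric] by (intro span_sum span_scale span_base)
    have "w - ?u \<in> W" using subspace_diff[OF subspace_W w] u UW_W by blast
    moreover have "\<phi> y (w - ?u) = 0" if "y \<in> B" for y
      using phi_sum[OF that, of "\<lambda>b. \<phi> b w"] k.linear_diff[OF phi(1)[OF that]] by simp
    ultimately show "w - ?u \<in> W'" by (simp add: W'_def)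
  qed
  have V_sum: "\<exists>u\<in>UV F. v - u \<in> V'" if v: "v \<in> V" for v
  proof
    define v0 where "v0 = v - q v"
    have qv: "q v \<in> V" using q(3) UV_V by blast
    have v0: "v0 \<in> V0" unfolding V0_def v0_def
      using subspace_diff[OF subspace_V v qv] q(2)[OF q(3)] by (simp add: q.diff)
    \<comment> \<open>\<open>u\<close> is made of kernel vectors so that D u and D v0 have the same
      values under the functionals. The same then holds for A u and A v0, because
      \<open>\<phi> y\<close> kills \<open>member (m y) v0\<close> and A (x b) = - m b D (x
      b).\<close>
    define u where "u = (\<Sum>b\<in>B. \<phi> b (D v0) *s x b)"
    have uUV: "u \<in> UV F" unfolding u_def
      by (intro subspace_sum[OF sUV] subspace_scale[OF sUV]) (use mx(1,2) K_UV in blast)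
    show "q v + u \<in> UV F" using subspace_add[OF sUV q(3) uUV] .
    have Du: "D u = (\<Sum>b\<in>B. \<phi> b (D v0) *s b)"
      unfolding u_def by (simp add: D.sum D.scale mx(3) cong: sum.cong)
    have Au: "A u = (\<Sum>b\<in>B. (- m b * \<phi> b (D v0)) *s b)"
      unfolding u_def A.sum
    proof (intro sum.cong refl)
      fix b assume "b \<in> B"
      then show "A (\<phi> b (D v0) *s x b) = (- m b * \<phi> b (D v0)) *s b"
        using A_K[OF mx(2)] mx(3) by (simp add: A.scale mult.commute)
    qed
    have phiA: "\<phi> y (A v0) = - m y * \<phi> y (D v0)" if y: "y \<in> B" for y
      using phi(3)[OF y v0] unfolding member_def
      by (simp add: k.linear_add[OF phi(1)[OF y]] k.linear_scale[OF phi(1)[OF y]] eq_neg_iff_add_eq_0)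
    have phiu: "\<phi> y (A u) = - m y * \<phi> y (D v0)" "\<phi> y (D u) = \<phi> y (D v0)" if "y \<in> B" for y
      by (simp_all only: Au Du phi_sum[OF that])
    have V: "v0 - u \<in> V" using subspace_diff[OF subspace_V] v0 uUV UV_V by (auto simp: V0_def)
    have "D (v0 - u) \<in> W'" "A (v0 - u) \<in> W'" unfolding W'_def
      using A_closed[OF V] D_closed[OF V]
      by (auto simp: A.diff D.diff k.linear_diff[OF phi(1)] phiu phiA)
    moreover have e: "v - (q v + u) = v0 - u" by (simp add: v0_def)
    ultimately show "v - (q v + u) \<in> V'" unfolding e using V by (simp add: V'_def)
  qed
  obtain \<mu> where \<mu>: "\<mu> \<notin> F" using F(1) infinite_field ex_new_if_finite by blast
  \<comment> \<open>If \<open>UV F\<close> is trivial, the member at \<mu> has no kernel. Otherwise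
    the complement is trivial, the member maps V onto W, and equal dimensions make it
    injective.\<close>
  consider "UV F \<subseteq> {0}" | "V' \<subseteq> {0}" "W' \<subseteq> {0}"
    using indecomposable[OF sUV sV' sUW sW' UV_V _ UW_W _ A_UV _ V_disj W_disj V_sum W_sum]
    by (auto simp: V'_def W'_def)
  then have "inj_on (member \<mu>) V"
  proof cases
    case 1
    then have "K \<mu> \<subseteq> {0}" using K_UV[OF \<mu>] by blast
    then show ?thesis using p.linear_inj_on_iff_eq_0[OF linear_member subspace_V]
      by (auto simp: K_def)
  next
    case 2
    have "V \<subseteq> UV F"
    proof
      fix v assume "v \<in> V"
      then obtain u where u: "u \<in> UV F" "v - u \<in> V'" using V_sum by blast
      then have "v = u" using 2 by auto
      then show "v \<in> UV F" using u by simp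
    qed
    then have V: "UV F = V" using UV_V by blast
    have "W \<subseteq> UW F"
    proof
      fix v assume "v \<in> W"
      then obtain u where u: "u \<in> UW F" "v - u \<in> W'" using W_sum by blast
      then have "v = u" using 2 by auto
      then show "v \<in> UW F" using u by simp
    qed
    then have "member \<mu> ` V = W" using onto[of \<mu>] V member_closed by auto
    then show ?thesis
      using surj_imp_inj_of_dim[OF linear_member subspace_V fdim_V subspace_W] dim_eq by simp
  qed
  then show ?thesis by blast
qed

lemma funpow_linear:
  assumes "endo T"
  shows "endo (T ^^ n)"
proof (induction n)
  case 0
  then show ?case using linear_id by (simp add: id_def)
next
  case (Suc n)
  then show ?case using Vector_Spaces.linear_compose[OF Suc assms] by (simp only: funpow.simps(2))
qed

text \<open>\<open>T\<close> stands for D followed by the inverse of the member. As A is the member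
  minus \<mu> D, a \<open>T\<close>-invariant subspace together with its image under the member is a
  subpencil, so a \<open>T\<close>-invariant splitting of V splits the pencil.\<close>

lemma no_invariant_splitting:
  assumes inj: "inj_on (member \<mu>) V" and T: "\<And>v. v \<in> V \<Longrightarrow> member \<mu> (T v) = D v"
    and V1: "subspace V1" "V1 \<subseteq> V" "\<And>v. v \<in> V1 \<Longrightarrow> T v \<in> V1"
    and V2: "subspace V2" "V2 \<subseteq> V" "\<And>v. v \<in> V2 \<Longrightarrow> T v \<in> V2"
    and disj: "V1 \<inter> V2 \<subseteq> {0}" and V_sum: "\<And>v. v \<in> V \<Longrightarrow> \<exists>u\<in>V1. v - u \<in> V2"
  shows "V1 \<subseteq> {0} \<or> V2 \<subseteq> {0}"
proof -
  let ?B = "member \<mu>"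
  interpret B: Vector_Spaces.linear scale scale ?B by (rule linear_member)
  have BV: "?B ` V = W"
    by (rule inj_imp_surj_of_dim[OF linear_member subspace_V fdim_W _ _ inj])
      (use member_closed dim_eq in auto)
  have sub: "A v \<in> ?B ` U \<and> D v \<in> ?B ` U"
    if U: "subspace U" "U \<subseteq> V" "\<And>u. u \<in> U \<Longrightarrow> T u \<in> U" and v: "v \<in> U" for U v
  proof
    have "A v = ?B v - \<mu> *s D v" by (simp add: member_def)
    also have "\<dots> = ?B (v - \<mu> *s T v)" using T[of v] U(2) v by (auto simp: B.diff B.scale)
    finally show "A v \<in> ?B ` U" using subspace_diff[OF U(1) v subspace_scale[OF U(1) U(3)[OF v]]] by blast
    have "D v = ?B (T v)" using T[of v] U(2) v by auto
    then show "D v \<in> ?B ` U" using U(3)[OF v] by blast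
  qed
  have W_disj: "?B ` V1 \<inter> ?B ` V2 \<subseteq> {0}"
  proof
    fix w assume "w \<in> ?B ` V1 \<inter> ?B ` V2"
    then obtain a b where ab: "a \<in> V1" "b \<in> V2" "w = ?B a" "w = ?B b" by auto
    then have "a = b" using inj V1(2) V2(2) by (metis inj_onD subsetD)
    then show "w \<in> {0}" using disj ab B.zero by auto
  qed
  have W_sum: "\<exists>u\<in>?B ` V1. w - u \<in> ?B ` V2" if w: "w \<in> W" for w
  proof -
    obtain v where v: "v \<in> V" "w = ?B v" using w BV by auto
    then obtain u where "u \<in> V1" "v - u \<in> V2" using V_sum by blast
    then show ?thesis using v(2) by (intro bexI[of _ "?B u"]) (auto simp: B.diff[symmetric])
  qed
  have BW: "?B ` V1 \<subseteq> W" "?B ` V2 \<subseteq> W" using V1(2) V2(2) member_closed by blast+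
  have "(V1 \<subseteq> {0} \<and> ?B ` V1 \<subseteq> {0}) \<or> (V2 \<subseteq> {0} \<and> ?B ` V2 \<subseteq> {0})"
    by (rule indecomposable[OF V1(1) V2(1) linear_subspace_image[OF linear_member V1(1)]
        linear_subspace_image[OF linear_member V2(1)] V1(2) V2(2) BW sub[OF V1] sub[OF V2] disj W_disj V_sum W_sum])
  then show ?thesis by blast
qed

text \<open>Fitting decomposition: once the kernels of the powers of \<open>T\<close> have
  stabilised at n, V is the direct sum of the kernel and the image of \<open>T ^^ n\<close>, both
  \<open>T\<close>-invariant. As T x0 = 0 with x0 nonzero, the kernel part is nonzero and the image
  must vanish.\<close>

lemma nilpotent_quotient:
  assumes inj: "inj_on (member \<mu>) V" and x0: "x0 \<in> V" "x0 \<noteq> 0" "D x0 = 0"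
  obtains T n where "endo T" "\<And>v. v \<in> V \<Longrightarrow> T v \<in> V"
    "\<And>v. v \<in> V \<Longrightarrow> member \<mu> (T v) = D v" "\<And>v. v \<in> V \<Longrightarrow> (T ^^ n) v = 0"
proof -
  let ?B = "member \<mu>"
  interpret B: Vector_Spaces.linear scale scale ?B by (rule linear_member)
  have BV: "?B ` V = W"
    by (rule inj_imp_surj_of_dim[OF linear_member subspace_V fdim_W _ _ inj])
      (use member_closed dim_eq in auto)
  obtain g where g: "range g \<subseteq> V" "endo g" "\<forall>v\<in>V. g (?B v) = v"
    using p.linear_exists_left_inverse_on[OF linear_member subspace_V inj] by (elim exE conjE)
  define T where "T v = g (D v)" for v
  have lin: "endo T"
    using Vector_Spaces.linear_compose[OF linear_D g(2)] by (simp add: T_def[abs_def] o_def)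
  have TV: "T v \<in> V" for v using g(1) unfolding T_def by blast
  have BT: "?B (T v) = D v" if v: "v \<in> V" for v
  proof -
    obtain u where "u \<in> V" "D v = ?B u" using BV D_closed[OF v] by auto
    then show ?thesis using g(3) unfolding T_def by simp
  qed
  have linn: "endo (T ^^ n)" for n by (rule funpow_linear[OF lin])
  have TnV: "(T ^^ n) v \<in> V" if "v \<in> V" for n v using that TV by (induction n) auto
  define Kn where "Kn n = {v \<in> V. (T ^^ n) v = 0}" for n
  have sKn: "subspace (Kn n)" for n
    using subspace_V unfolding Kn_def subspace_def
    by (auto simp: p.linear_add[OF linn] p.linear_scale[OF linn] p.linear_0[OF linn])
  have KnV: "Kn n \<subseteq> V" for n by (auto simp: Kn_def)
  have mono: "Kn n \<subseteq> Kn (m + n)" for n m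
    by (auto simp: Kn_def funpow_add p.linear_0[OF linn])
  obtain n where n: "\<And>m. dim (Kn m) \<le> dim (Kn n)"
    using ex_has_greatest_nat[of "\<lambda>_. True" 0 "\<lambda>n. dim (Kn n)" "Suc (dim V)"] dim_mono'[OF fdim_V KnV]
    by (auto simp: less_Suc_eq_le)
  have stable: "Kn (m + n) = Kn n" for m
    using subspace_eq_of_dim[OF fdim_subset[OF fdim_V KnV] sKn mono n] by simp
  define V2 where "V2 = (T ^^ n) ` V"
  have sV2: "subspace V2" unfolding V2_def by (rule linear_subspace_image[OF linn subspace_V])
  have V2V: "V2 \<subseteq> V" unfolding V2_def using TnV by auto
  have disj: "Kn n \<inter> V2 \<subseteq> {0}"
  proof
    fix v assume "v \<in> Kn n \<inter> V2"
    then obtain u where u: "u \<in> V" "v = (T ^^ n) u" "(T ^^ n) v = 0" by (auto simp: V2_def Kn_def)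
    then have "u \<in> Kn (n + n)" by (simp add: Kn_def funpow_add)
    then have "u \<in> Kn n" using stable by simp
    then show "v \<in> {0}" using u by (simp add: Kn_def)
  qed
  have T1: "T v \<in> Kn n" if "v \<in> Kn n" for v
    using that TV p.linear_0[OF lin] by (auto simp: Kn_def simp flip: funpow_swap1)
  have T2: "T v \<in> V2" if v: "v \<in> V2" for v
  proof -
    obtain u where u: "u \<in> V" "v = (T ^^ n) u" using v by (auto simp: V2_def)
    then have "T v = (T ^^ n) (T u)" by (simp add: funpow_swap1)
    then show ?thesis using TV by (auto simp: V2_def)
  qed
  have "inj_on (T ^^ n) V2"
    using disj V2V by (auto simp: p.linear_inj_on_iff_eq_0[OF linn sV2] Kn_def)
  moreover have "(T ^^ n) ` V2 \<subseteq> V2"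
    using V2V by (auto simp: V2_def)
  ultimately have onto: "(T ^^ n) ` V2 = V2"
    using inj_imp_surj_of_dim[OF linn sV2 fdim_subset[OF fdim_V V2V]] by blast
  have V_sum: "\<exists>u\<in>Kn n. v - u \<in> V2" if v: "v \<in> V" for v
  proof -
    have "(T ^^ n) v \<in> (T ^^ n) ` V2" using onto v by (simp add: V2_def)
    then obtain v2 where v2: "v2 \<in> V2" "(T ^^ n) v = (T ^^ n) v2" by auto
    then have "v - v2 \<in> Kn n" using subspace_diff[OF subspace_V v] V2V
      by (auto simp: Kn_def p.linear_diff[OF linn])
    then show ?thesis using v2 by (intro bexI[of _ "v - v2"]) auto
  qed
  have "x0 \<in> Kn (1 + n)"
    using x0 by (simp add: Kn_def funpow_swap1 T_def p.linear_0[OF g(2)] p.linear_0[OF linn])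
  then have "x0 \<in> Kn n" using stable[of 1] by simp
  moreover have "Kn n \<subseteq> {0} \<or> V2 \<subseteq> {0}"
    by (rule no_invariant_splitting[OF inj BT sKn KnV T1 sV2 V2V T2 disj V_sum])
  ultimately have "V2 \<subseteq> {0}" using x0(2) by auto
  then have "(T ^^ n) v = 0" if "v \<in> V" for v using that by (auto simp: V2_def)
  then show ?thesis using that lin TV BT by blast
qed

text \<open>Once A is known to be invertible from V onto W, D followed by the inverse of A is a
  nilpotent map \<open>T\<close> under which V does not split. So V is one Jordan block: the cyclic
  subspace of a vector of maximal height has a \<open>T\<close>-invariant complement, which must
  vanish.\<close>

lemma jordan_chain:
  assumes x0: "x0 \<in> V" "x0 \<noteq> 0" "D x0 = 0"
  obtains x where "inj_on x {..<dim V}" "independent (x ` {..<dim V})" "span (x ` {..<dim V}) = V"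
    "D (x 0) = 0" "\<And>i. Suc i < dim V \<Longrightarrow> D (x (Suc i)) = A (x i)" "inj_on A V" "A ` V = W"
proof -
  have injA: "inj_on A V"
  proof -
    obtain \<mu> where \<mu>: "inj_on (member \<mu>) V" using member_inj_ex by blast
    obtain T n where T: "endo T" "\<And>v. v \<in> V \<Longrightarrow> T v \<in> V"
      "\<And>v. v \<in> V \<Longrightarrow> member \<mu> (T v) = D v" "\<And>v. v \<in> V \<Longrightarrow> (T ^^ n) v = 0"
      using nilpotent_quotient[OF \<mu> x0] by metis
    have "v = 0" if v: "v \<in> V" "A v = 0" for v
    proof -
      have "member \<mu> v = \<mu> *s D v" using v(2) by (simp add: member_def)
      also have "\<dots> = member \<mu> (\<mu> *s T v)" using T(3)[OF v(1)] p.linear_scale[OF linear_member] by simp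
      finally have e: "v = \<mu> *s T v"
        using \<mu> v(1) subspace_scale[OF subspace_V T(2)[OF v(1)]] by (meson inj_onD)
      \<comment> \<open>Iterating v = \<mu> T v makes v a multiple of every power of the nilpotent
        \<open>T\<close> applied to v, hence zero.\<close>
      have "\<exists>c. v = c *s (T ^^ k) v" for k
      proof (induction k)
        case (Suc k)
        then obtain c where "v = c *s (T ^^ k) v" by blast
        then have "T v = c *s (T ^^ Suc k) v" using p.linear_scale[OF T(1)] by (metis funpow.simps(2) o_apply)
        then show ?case using e by (metis scale_scale)
      qed (auto intro: exI[of _ 1])
      then show ?thesis using T(4)[OF v(1)] by (metis scale_zero_right)
    qed
    then show ?thesis using p.linear_inj_on_iff_eq_0[OF linear_A subspace_V] by blast
  qed
  have AV: "A ` V = W"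
    using inj_imp_surj_of_dim[OF linear_A subspace_V fdim_W _ _ injA] A_closed dim_eq by auto
  have m0: "member 0 = A" by (simp add: member_def fun_eq_iff)
  have inj0: "inj_on (member 0) V" using injA m0 by simp
  obtain T k where lin: "endo T" and TV: "\<And>v. v \<in> V \<Longrightarrow> T v \<in> V"
    and AT: "\<And>v. v \<in> V \<Longrightarrow> A (T v) = D v" and k: "\<And>v. v \<in> V \<Longrightarrow> (T ^^ k) v = 0"
    using nilpotent_quotient[OF inj0 x0] unfolding m0 by metis
  have linn: "endo (T ^^ n)" for n by (rule funpow_linear[OF lin])
  have TnV: "(T ^^ n) v \<in> V" if "v \<in> V" for n v using that TV by (induction n) auto
  define n where "n = (LEAST n. \<forall>v\<in>V. (T ^^ n) v = 0)"
  have n: "(T ^^ n) v = 0" if "v \<in> V" for v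
    using LeastI[of "\<lambda>n. \<forall>v\<in>V. (T ^^ n) v = 0" k] k that unfolding n_def by blast
  have "n \<noteq> 0" using n[OF x0(1)] x0(2) by (auto intro: gr0I)
  then obtain m where m: "n = Suc m" by (cases n) auto
  have "\<not> (\<forall>v\<in>V. (T ^^ m) v = 0)" using not_less_Least[of m "\<lambda>n. \<forall>v\<in>V. (T ^^ n) v = 0"] m
    unfolding n_def by simp
  then obtain v where v: "v \<in> V" "(T ^^ m) v \<noteq> 0" by blast
  define e where "e i = (T ^^ i) v" for i
  have eV: "e i \<in> V" for i unfolding e_def by (rule TnV[OF v(1)])
  have Te: "(T ^^ j) (e i) = e (j + i)" for i j by (simp add: e_def funpow_add)
  have e0: "e i = 0" if "i > m" for i
  proof -
    have "e i = (T ^^ (i - n + n)) v" using that m by (simp add: e_def)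
    also have "\<dots> = (T ^^ (i - n)) ((T ^^ n) v)" by (simp only: funpow_add o_apply)
    finally have "e i = (T ^^ (i - n)) ((T ^^ n) v)" .
    then show ?thesis using n[OF v(1)] p.linear_0[OF linn] by simp
  qed
  have ind0: "c i = 0" if c: "(\<Sum>i\<in>{..m}. c i *s e i) = 0" and i: "i \<in> {..m}" for c i
  proof -
    from i have "i \<le> m" by simp
    then show "c i = 0"
    proof (induction i rule: less_induct)
      case (less i)
      \<comment> \<open>This power kills the e j with j > i, and those with j < i have coefficient 0
        by induction; what remains is c i times the nonzero last vector.\<close>
      have "0 = (T ^^ (m - i)) (\<Sum>j\<in>{..m}. c j *s e j)" using c p.linear_0[OF linn] by simp
      also have "\<dots> = (\<Sum>j\<in>{..m}. c j *s e (m - i + j))"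
        by (simp add: p.linear_sum[OF linn] p.linear_scale[OF linn] Te)
      also have "\<dots> = (\<Sum>j\<in>{i}. c j *s e (m - i + j))"
      proof (rule sum.mono_neutral_right)
        show "\<forall>j\<in>{..m} - {i}. c j *s e (m - i + j) = 0"
        proof
          fix j assume "j \<in> {..m} - {i}"
          then consider "j < i" | "j > i" by fastforce
          then show "c j *s e (m - i + j) = 0" using less e0[of "m - i + j"] by cases auto
        qed
      qed (use less.prems in auto)
      also have "\<dots> = c i *s (T ^^ m) v" using less.prems by (simp add: e_def)
      finally show ?case using v(2) by simp
    qed
  qed
  have ind: "inj_on e {..m}" "independent (e ` {..m})"
    using independent_family[of "{..m}" e] ind0 by blast+
  interpret k: vector_space_pair scale "(*) :: 'a \<Rightarrow> 'a \<Rightarrow> 'a" by (rule pair_scalar)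
  \<comment> \<open>The coordinate functional of the last chain vector; composed with the powers of
    \<open>T\<close> it reads off all coordinates, as \<open>fsum\<close> shows.\<close>
  obtain f where f: "Vector_Spaces.linear scale (*) f" "\<And>b. b \<in> e ` {..m} \<Longrightarrow> f b = (if b = e m then 1 else 0)"
    using functional_exists[OF ind(2) subspace_single_0 Int_lower2,
        where h = "\<lambda>b. if b = e m then 1 else 0"] by metis
  have fe: "f (e i) = (if i = m then 1 else 0)" for i
  proof (cases "i \<le> m")
    case True
    then show ?thesis using f(2)[of "e i"] inj_on_eq_iff[OF ind(1), of i m] by auto
  next
    case False
    then show ?thesis using e0[of i] k.linear_0[OF f(1)] by simp
  qed
  have fsum: "f ((T ^^ j) (\<Sum>i\<in>{..m}. c i *s e i)) = c (m - j)" if j: "j \<le> m" for j c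
  proof -
    have "f ((T ^^ j) (\<Sum>i\<in>{..m}. c i *s e i)) = (\<Sum>i\<in>{..m}. c i * f (e (j + i)))"
      by (simp add: p.linear_sum[OF linn] p.linear_scale[OF linn] k.linear_sum[OF f(1)] k.linear_scale[OF f(1)] Te)
    also have "\<dots> = (\<Sum>i\<in>{..m}. if i = m - j then c i else 0)"
      using j by (intro sum.cong) (auto simp: fe)
    also have "\<dots> = c (m - j)" by simp
    finally show ?thesis .
  qed
  define V1 where "V1 = span (e ` {..m})"
  \<comment> \<open>The common kernel of f, f T, ..., f T^m. It is \<open>T\<close>-invariant
    because T^(m+1) = 0 on V, and complementary to \<open>V1\<close> because f (T^j (e i)) is 1 for
    i + j = m and 0 otherwise.\<close>
  define V2 where "V2 = {w \<in> V. \<forall>j\<le>m. f ((T ^^ j) w) = 0}"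
  have sV1: "subspace V1" unfolding V1_def by (rule subspace_span)
  have V1V: "V1 \<subseteq> V" unfolding V1_def by (intro span_minimal subspace_V) (use eV in auto)
  have V2V: "V2 \<subseteq> V" by (auto simp: V2_def)
  have sV2: "subspace V2"
    using subspace_V unfolding V2_def subspace_def
    by (auto simp: p.linear_add[OF linn] p.linear_scale[OF linn] p.linear_0[OF linn]
        k.linear_add[OF f(1)] k.linear_scale[OF f(1)] k.linear_0[OF f(1)])
  have T1: "T w \<in> V1" if "w \<in> V1" for w
  proof -
    have "T (e i) \<in> V1" for i
    proof -
      have "T (e i) = e (Suc i)" by (simp add: e_def)
      then show ?thesis using e0[of "Suc i"] span_zero span_base unfolding V1_def
        by (metis atMost_iff image_eqI leI)
    qed
    then have "T ` e ` {..m} \<subseteq> V1" by blast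
    then have "T ` span (e ` {..m}) \<subseteq> V1"
      using p.linear_span_image[OF lin] span_minimal[OF _ sV1] by metis
    then show ?thesis using that by (auto simp: V1_def)
  qed
  have T2: "T w \<in> V2" if w: "w \<in> V2" for w
  proof -
    have "f ((T ^^ j) (T w)) = 0" if "j \<le> m" for j
    proof (cases "j = m")
      case True
      then have "(T ^^ j) (T w) = (T ^^ n) w" by (simp add: m funpow_swap1)
      then show ?thesis using n V2V w k.linear_0[OF f(1)] by auto
    next
      case False
      moreover have "(T ^^ j) (T w) = (T ^^ Suc j) w"
        by (simp add: funpow_Suc_right del: funpow.simps)
      ultimately show ?thesis using w that by (simp add: V2_def del: funpow.simps)
    qed
    then show ?thesis using w TV by (auto simp: V2_def)
  qed
  have disj: "V1 \<inter> V2 \<subseteq> {0}"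
  proof
    fix w assume w: "w \<in> V1 \<inter> V2"
    then obtain c where c: "w = (\<Sum>i\<in>{..m}. c i *s e i)"
      using span_finite[of "e ` {..m}"] unfolding V1_def by (auto simp: sum.reindex[OF ind(1)])
    have "c i = 0" if "i \<le> m" for i
      using fsum[of "m - i" c] w that by (auto simp: c V2_def)
    then show "w \<in> {0}" using c by simp
  qed
  have V_sum: "\<exists>u\<in>V1. w - u \<in> V2" if w: "w \<in> V" for w
  proof
    let ?u = "\<Sum>i\<in>{..m}. f ((T ^^ (m - i)) w) *s e i"
    show u: "?u \<in> V1" unfolding V1_def by (intro span_sum span_scale span_base) auto
    have "w - ?u \<in> V" using subspace_diff[OF subspace_V w] u V1V by blast
    moreover have "f ((T ^^ j) (w - ?u)) = 0" if "j \<le> m" for j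
      using fsum[OF that, of "\<lambda>i. f ((T ^^ (m - i)) w)"] that
      by (simp add: p.linear_diff[OF linn] k.linear_diff[OF f(1)])
    ultimately show "w - ?u \<in> V2" by (simp add: V2_def)
  qed
  have "V1 \<subseteq> {0} \<or> V2 \<subseteq> {0}"
    by (rule no_invariant_splitting[of 0 T])
      (use inj0 AT sV1 V1V T1 sV2 V2V T2 disj V_sum in \<open>simp_all add: m0\<close>)
  moreover have "e m \<in> V1" "e m \<noteq> 0" using v(2) by (auto simp: V1_def e_def intro: span_base)
  ultimately have "V2 \<subseteq> {0}" by auto
  then have V: "V1 = V" using V_sum V1V by fastforce
  have dV: "dim V = Suc m"
    using dim_eq_card[of "e ` {..m}" V] ind V card_image[OF ind(1)] by (simp add: V1_def span_span flip: V)
  \<comment> \<open>Order reversed, so that T lowers the index: D (x (Suc i)) = A (T (x (Suc i))) =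
    A (x i).\<close>
  define x where "x i = e (m - i)" for i
  have im: "x ` {..<dim V} = e ` {..m}"
  proof -
    have "i \<in> (\<lambda>i. m - i) ` {..m}" if "i \<le> m" for i
      using that by (intro image_eqI[of _ _ "m - i"]) auto
    then have "(\<lambda>i. m - i) ` {..m} = {..m}" by auto
    then have "(e \<circ> (\<lambda>i. m - i)) ` {..m} = e ` {..m}" by (metis image_comp)
    then show ?thesis by (simp add: x_def dV o_def lessThan_Suc_atMost)
  qed
  show ?thesis
  proof (rule that)
    show "inj_on x {..<dim V}"
      by (rule eq_card_imp_inj_on) (use card_image[OF ind(1)] im dV in auto)
    show "independent (x ` {..<dim V})" "span (x ` {..<dim V}) = V" using im ind V by (auto simp: V1_def)
    show "D (x 0) = 0" using AT[OF eV[of m]] e0[of "Suc m"] A.zero by (simp add: x_def e_def)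
    show "D (x (Suc i)) = A (x i)" if "Suc i < dim V" for i
    proof -
      have "T (x (Suc i)) = x i" using that dV by (simp add: x_def e_def Suc_diff_Suc flip: funpow.simps(2) comp_apply[of T])
      then show ?thesis using AT[OF eV] by (metis x_def)
    qed
  qed (use injA AV in auto)
qed

end

section \<open>Modules on which b = c\<close>

text \<open>
  On a module with \<open>b = c\<close> the relations say that \<open>a\<close> and \<open>d\<close> generate an exterior algebra and
  anticommute with the involution \<open>b\<close>.
\<close>

locale exterior_module = vectorspace "class_ring :: 'k::field ring" M
  for M :: "('k::field, 'v) D4_mod" (structure) +
  assumes two: "(2 :: 'k) \<noteq> 0"
    and act_closed: "x \<in> carrier M \<Longrightarrow> act M g x \<in> carrier M"
    and act_add: "x \<in> carrier M \<Longrightarrow> y \<in> carrier M \<Longrightarrow> act M g (x \<oplus> y) = act M g x \<oplus> act M g y"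
    and act_smult: "x \<in> carrier M \<Longrightarrow> act M g (k \<odot> x) = k \<odot> act M g x"
    and act_c: "x \<in> carrier M \<Longrightarrow> act M gen_c x = act M gen_b x"
    and bb: "x \<in> carrier M \<Longrightarrow> act M gen_b (act M gen_b x) = x"
    and ba: "x \<in> carrier M \<Longrightarrow> act M gen_b (act M gen_a x) \<oplus> act M gen_a (act M gen_b x) = \<zero>"
    and bd: "x \<in> carrier M \<Longrightarrow> act M gen_b (act M gen_d x) \<oplus> act M gen_d (act M gen_b x) = \<zero>"
    and aa: "x \<in> carrier M \<Longrightarrow> act M gen_a (act M gen_a x) = \<zero>"
    and dd: "x \<in> carrier M \<Longrightarrow> act M gen_d (act M gen_d x) = \<zero>"
    and da: "x \<in> carrier M \<Longrightarrow> act M gen_d (act M gen_a x) \<oplus> act M gen_a (act M gen_d x) = \<zero>"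

text \<open>The laws of scalar multiplication with the operations of \<open>class_ring\<close>
  replaced by those of the type \<open>'k\<close>, the form in which scalars are simplified
  below.\<close>

lemma vs_smult:
  fixes M :: "('k::field, 'v, 'e) module_scheme" (structure)
  assumes "vectorspace (class_ring :: 'k ring) M"
  shows "x \<in> carrier M \<Longrightarrow> k \<odot> x \<in> carrier M"
    "x \<in> carrier M \<Longrightarrow> (k + l) \<odot> x = k \<odot> x \<oplus> l \<odot> x"
    "x \<in> carrier M \<Longrightarrow> y \<in> carrier M \<Longrightarrow> k \<odot> (x \<oplus> y) = k \<odot> x \<oplus> k \<odot> y"
    "x \<in> carrier M \<Longrightarrow> (k * l) \<odot> x = k \<odot> (l \<odot> x)"
    "x \<in> carrier M \<Longrightarrow> (1::'k) \<odot> x = x"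
    "x \<in> carrier M \<Longrightarrow> (0::'k) \<odot> x = \<zero>"
    "k \<odot> \<zero> = \<zero>"
    "x \<in> carrier M \<Longrightarrow> (- k) \<odot> x = \<ominus> (k \<odot> x)"
    "x \<in> carrier M \<Longrightarrow> y \<in> carrier M \<Longrightarrow> x \<oplus> y = \<zero> \<Longrightarrow> x = (- 1 :: 'k) \<odot> y"
proof -
  interpret vectorspace class_ring M by fact
  show c: "x \<in> carrier M \<Longrightarrow> k \<odot> x \<in> carrier M" for k :: 'k and x
    using smult_closed[of k x] by simp
  show "x \<in> carrier M \<Longrightarrow> y \<in> carrier M \<Longrightarrow> k \<odot> (x \<oplus> y) = k \<odot> x \<oplus> k \<odot> y"
    using smult_r_distr[of k x y] by simp
  show l: "x \<in> carrier M \<Longrightarrow> (k + l) \<odot> x = k \<odot> x \<oplus> l \<odot> x" for k l :: 'k and x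
    using smult_l_distr[of k l x] by simp
  show a: "x \<in> carrier M \<Longrightarrow> (k * l) \<odot> x = k \<odot> (l \<odot> x)" for k l :: 'k and x
    using smult_assoc1[of k l x] by simp
  show o: "x \<in> carrier M \<Longrightarrow> (1::'k) \<odot> x = x" for x using smult_one[of x] by simp
  show z: "x \<in> carrier M \<Longrightarrow> (0::'k) \<odot> x = \<zero>" for x using lmult_0[of x] by simp
  show "k \<odot> \<zero> = \<zero>" using rmult_0[of k] by simp
  show m: "x \<in> carrier M \<Longrightarrow> (- k) \<odot> x = \<ominus> (k \<odot> x)" for k :: 'k and x
    using l[of x "- k" k] z[of x] c[of x] by (simp add: minus_equality)
  show "x \<in> carrier M \<Longrightarrow> y \<in> carrier M \<Longrightarrow> x \<oplus> y = \<zero> \<Longrightarrow> x = (- 1 :: 'k) \<odot> y"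
    using m[of y 1] o[of y] minus_equality[of x y] by simp
qed

lemma D4_submodule_iff:
  fixes M :: "('k::field, 'v) D4_mod" (structure)
  assumes "vectorspace (class_ring :: 'k ring) M"
  shows "D4_submodule N M \<longleftrightarrow> N \<subseteq> carrier M \<and> \<zero> \<in> N \<and> (\<forall>x\<in>N. \<forall>y\<in>N. x \<oplus> y \<in> N) \<and>
     (\<forall>k. \<forall>x\<in>N. k \<odot> x \<in> N) \<and> (\<forall>g. \<forall>x\<in>N. act M g x \<in> N)"
proof -
  interpret vectorspace class_ring M by fact
  show ?thesis
    unfolding D4_submodule_def VectorSpace.subspace_def submodule_def
    using vectorspace_axioms module_axioms by auto
qed

section \<open>Submodules, quotients, simple modules and socle when b = c\<close>

context exterior_module
begin

lemmas smult = vs_smult[OF vectorspace_axioms]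

lemma act_zero: "act M g \<zero> = \<zero>"
  using act_smult[of \<zero> g 0] act_closed[of \<zero> g] smult(6) by simp

lemmas D4_submodule_iff = D4_submodule_iff[OF vectorspace_axioms]

lemma exterior_restrict:
  assumes "D4_submodule N M"
  shows "exterior_module (D4_restrict M N)"
proof -
  have "VectorSpace.subspace class_ring N M" using assms by (simp add: D4_submodule_def)
  then interpret N: vectorspace class_ring "M\<lparr>carrier := N\<rparr>" by (rule subspace_is_vs)
  have N: "N \<subseteq> carrier M" "\<And>g x. x \<in> N \<Longrightarrow> act M g x \<in> N" using assms by (auto simp: D4_submodule_iff)
  have c: "x \<in> carrier M" if "x \<in> N" for x using that N(1) by blast
  show ?thesis unfolding D4_restrict_def
    by unfold_locales (simp_all add: c N(2) two act_add act_smult act_c bb ba bd aa dd da)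
qed

text \<open>A surjection compatible with all operations carries the axioms over, although
  \<open>Q\<close> is not known beforehand to be a vector space. Quotients are treated this way,
  since their operations are known on cosets of representatives.\<close>

lemma exterior_image:
  fixes Q :: "('k, 'w) D4_mod"
  assumes onto: "\<pi> ` carrier M = carrier Q"
    and z: "\<pi> \<zero> = \<zero>\<^bsub>Q\<^esub>"
    and add: "\<And>x y. x \<in> carrier M \<Longrightarrow> y \<in> carrier M \<Longrightarrow> \<pi> x \<oplus>\<^bsub>Q\<^esub> \<pi> y = \<pi> (x \<oplus> y)"
    and sm: "\<And>k x. x \<in> carrier M \<Longrightarrow> k \<odot>\<^bsub>Q\<^esub> \<pi> x = \<pi> (k \<odot> x)"
    and act: "\<And>g x. x \<in> carrier M \<Longrightarrow> act Q g (\<pi> x) = \<pi> (act M g x)"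
  shows "exterior_module Q"
proof -
  have Q: "y \<in> carrier Q \<longleftrightarrow> (\<exists>x\<in>carrier M. y = \<pi> x)" for y using onto by auto
  have "vectorspace (class_ring :: 'k ring) Q"
  proof (rule vs_criteria)
    show "field (class_ring :: 'k ring)" by (rule class_field)
    show "\<forall>v\<in>carrier Q. \<exists>n\<in>carrier Q. v \<oplus>\<^bsub>Q\<^esub> n = \<zero>\<^bsub>Q\<^esub>"
    proof
      fix v assume "v \<in> carrier Q"
      then obtain x where "x \<in> carrier M" "v = \<pi> x" using Q by blast
      then show "\<exists>n\<in>carrier Q. v \<oplus>\<^bsub>Q\<^esub> n = \<zero>\<^bsub>Q\<^esub>"
        using add[of x "\<ominus> x"] z by (intro bexI[of _ "\<pi> (\<ominus> x)"]) (auto simp: Q r_neg)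
    qed
  qed (auto simp: Q z[symmetric] add sm smult a_ac)
  then interpret Q: vectorspace class_ring Q .
  show ?thesis
    by unfold_locales
      (auto simp: Q add sm act act_closed act_add act_smult smult two act_c bb ba bd aa dd da z[symmetric])
qed

lemma coset_eq_iff:
  assumes N: "D4_submodule N M" and x: "x \<in> carrier M" and y: "y \<in> carrier M"
  shows "N +> x = N +> y \<longleftrightarrow> (\<exists>n\<in>N. x = n \<oplus> y)"
proof
  assume "N +> x = N +> y"
  moreover have "\<zero> \<oplus> x \<in> N +> x" using N unfolding D4_submodule_iff a_r_coset_def' by blast
  ultimately have "x \<in> N +> y" using x by simp
  then show "\<exists>n\<in>N. x = n \<oplus> y" unfolding a_r_coset_def' by blast
next
  assume "\<exists>n\<in>N. x = n \<oplus> y"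
  then obtain n where n: "n \<in> N" "x = n \<oplus> y" by blast
  have NM: "N \<subseteq> carrier M" using N by (simp add: D4_submodule_iff)
  have n': "\<ominus> n \<in> N" 
  proof -
    have "\<ominus> n = (-1) \<odot> n" using smult(8)[of n 1] smult(5)[of n] n(1) NM by auto
    then show ?thesis using N n(1) by (simp add: D4_submodule_iff)
  qed
  show "N +> x = N +> y"
  proof (intro subset_antisym subsetI)
    fix z assume "z \<in> N +> x"
    then obtain m where "m \<in> N" "z = m \<oplus> x" by (auto simp: a_r_coset_def')
    then have "m \<oplus> n \<in> N" "z = (m \<oplus> n) \<oplus> y" using N n y NM by (auto simp: D4_submodule_iff a_ac subset_iff)
    then show "z \<in> N +> y" by (auto simp: a_r_coset_def')
  next
    fix z assume "z \<in> N +> y"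
    then obtain m where m: "m \<in> N" "z = m \<oplus> y" by (auto simp: a_r_coset_def')
    have c: "m \<in> carrier M" "n \<in> carrier M" using m n NM by auto
    have "(m \<oplus> \<ominus> n) \<oplus> x = m \<oplus> ((\<ominus> n \<oplus> n) \<oplus> y)" unfolding n(2) using c y by (simp add: a_assoc)
    also have "\<dots> = z" using c y m by (simp add: l_neg)
    finally have "(m \<oplus> \<ominus> n) \<oplus> x = z" .
    moreover have "m \<oplus> \<ominus> n \<in> N" using N m n' by (simp add: D4_submodule_iff)
    ultimately show "z \<in> N +> x" by (auto simp: a_r_coset_def')
  qed
qed

text \<open>Covers scalar multiplication and the four generators at once: in
  \<open>D4_quotient\<close> both act on a coset by adding N to the image of the coset.\<close>

lemma coset_map:
  assumes N: "D4_submodule N M" and x: "x \<in> carrier M"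
    and fN: "\<And>n. n \<in> N \<Longrightarrow> f n \<in> N" and fx: "f x \<in> carrier M"
    and f: "\<And>n. n \<in> N \<Longrightarrow> f (n \<oplus> x) = f n \<oplus> f x"
  shows "set_add M N (f ` (N +> x)) = N +> f x"
proof (intro subset_antisym subsetI)
  have NM: "N \<subseteq> carrier M" using N by (simp add: D4_submodule_iff)
  fix z assume "z \<in> set_add M N (f ` (N +> x))"
  then obtain m n where "m \<in> N" "n \<in> N" "z = m \<oplus> (f n \<oplus> f x)"
    by (auto simp: set_add_def' a_r_coset_def' f)
  then have "z = (m \<oplus> f n) \<oplus> f x" "m \<oplus> f n \<in> N"
    using N NM fN fx by (auto simp: D4_submodule_iff a_assoc subset_iff)
  then show "z \<in> N +> f x" by (auto simp: a_r_coset_def')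
next
  fix z assume "z \<in> N +> f x"
  then obtain m where m: "m \<in> N" "z = m \<oplus> f x" by (auto simp: a_r_coset_def')
  have "\<zero> \<in> N" using N by (simp add: D4_submodule_iff)
  then have "x \<in> N +> x" using x by (force simp: a_r_coset_def')
  then show "z \<in> set_add M N (f ` (N +> x))" using m by (auto simp: set_add_def')
qed

lemma coset_add:
  assumes N: "D4_submodule N M" and x: "x \<in> carrier M" and y: "y \<in> carrier M"
  shows "set_add M (N +> x) (N +> y) = N +> (x \<oplus> y)"
proof (intro subset_antisym subsetI)
  have NM: "N \<subseteq> carrier M" using N by (simp add: D4_submodule_iff)
  fix z assume "z \<in> set_add M (N +> x) (N +> y)"
  then obtain m n where "m \<in> N" "n \<in> N" "z = (m \<oplus> x) \<oplus> (n \<oplus> y)"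
    by (auto simp: set_add_def' a_r_coset_def')
  moreover from this have "z = (m \<oplus> n) \<oplus> (x \<oplus> y)" using NM x y by (auto simp: a_ac subset_iff)
  moreover have "m \<oplus> n \<in> N" using calculation N by (simp add: D4_submodule_iff)
  ultimately show "z \<in> N +> (x \<oplus> y)" unfolding a_r_coset_def' by blast
next
  have NM: "N \<subseteq> carrier M" and 0: "\<zero> \<in> N" using N by (simp_all add: D4_submodule_iff)
  fix z assume "z \<in> N +> (x \<oplus> y)"
  then obtain m where m: "m \<in> N" "z = m \<oplus> (x \<oplus> y)" by (auto simp: a_r_coset_def')
  then have "z = (m \<oplus> x) \<oplus> (\<zero> \<oplus> y)" using NM x y by (auto simp: a_assoc subset_iff)
  moreover have "m \<oplus> x \<in> N +> x" "\<zero> \<oplus> y \<in> N +> y" using m(1) 0 unfolding a_r_coset_def' by blast+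
  ultimately show "z \<in> set_add M (N +> x) (N +> y)" unfolding set_add_def' by blast
qed

lemma quotient_simps:
  assumes N: "D4_submodule N M"
  shows "carrier (D4_quotient M N) = (\<lambda>x. N +> x) ` carrier M" "\<zero>\<^bsub>D4_quotient M N\<^esub> = N"
    "N +> \<zero> = N"
    "x \<in> carrier M \<Longrightarrow> y \<in> carrier M \<Longrightarrow> (N +> x) \<oplus>\<^bsub>D4_quotient M N\<^esub> (N +> y) = N +> (x \<oplus> y)"
    "x \<in> carrier M \<Longrightarrow> k \<odot>\<^bsub>D4_quotient M N\<^esub> (N +> x) = N +> (k \<odot> x)"
    "x \<in> carrier M \<Longrightarrow> act (D4_quotient M N) g (N +> x) = N +> act M g x"
proof -
  have NM: "N \<subseteq> carrier M" using N by (simp add: D4_submodule_iff)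
  show "N +> \<zero> = N" using NM by (force simp: a_r_coset_def' subset_iff)
  show "x \<in> carrier M \<Longrightarrow> k \<odot>\<^bsub>D4_quotient M N\<^esub> (N +> x) = N +> (k \<odot> x)"
    unfolding D4_quotient_def using N NM
    by (simp, intro coset_map[OF N]) (auto simp: D4_submodule_iff smult)
  show "x \<in> carrier M \<Longrightarrow> act (D4_quotient M N) g (N +> x) = N +> act M g x"
    unfolding D4_quotient_def using N NM
    by (simp, intro coset_map[OF N]) (auto simp: D4_submodule_iff act_add act_closed)
qed (auto simp: D4_quotient_def A_RCOSETS_def' coset_add[OF N])

lemma exterior_quotient:
  assumes "D4_submodule N M"
  shows "exterior_module (D4_quotient M N)"
  by (rule exterior_image[of "\<lambda>x. N +> x"]) (simp_all add: quotient_simps[OF assms])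

text \<open>This turns out to be the socle, because a and d act as zero on simple modules.\<close>

definition annihilated :: "'v set" where
  "annihilated = {x \<in> carrier M. act M gen_a x = \<zero> \<and> act M gen_d x = \<zero>}"

lemma b_eigen_annihilated: "x \<in> annihilated \<Longrightarrow> act M gen_b x \<in> annihilated"
  using ba[of x] bd[of x] act_closed[of x gen_b] act_zero
  by (auto simp: annihilated_def act_closed)

definition line :: "'v \<Rightarrow> 'v set" where "line x = range (\<lambda>k. k \<odot> x)"

lemma line_submodule:
  assumes x: "x \<in> annihilated" and e: "act M gen_b x = e \<odot> x"
  shows "D4_submodule (line x) M"
proof -
  have xM: "x \<in> carrier M" using x by (simp add: annihilated_def)
  have "act M g (k \<odot> x) \<in> line x" for g k
  proof (cases g)
    case gen_a
    then show ?thesis using x smult(6)[of x] smult(7) by (force simp: annihilated_def line_def act_smult)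
  next
    case gen_d
    then show ?thesis using x smult(6)[of x] smult(7) by (force simp: annihilated_def line_def act_smult)
  next
    case gen_b
    then show ?thesis using xM by (auto simp: line_def act_smult e simp flip: smult)
  next
    case gen_c
    then show ?thesis using xM by (auto simp: line_def act_smult act_c e smult simp flip: smult(4))
  qed
  moreover have "\<zero> \<in> line x" using smult(6)[OF xM] by (force simp: line_def)
  ultimately show ?thesis
    using xM by (auto simp: D4_submodule_iff line_def smult simp flip: smult(2,4))
qed

lemma line_subset: "D4_submodule N M \<Longrightarrow> x \<in> N \<Longrightarrow> line x \<subseteq> N"
  by (auto simp: line_def D4_submodule_iff)

lemma line_eq:
  assumes x: "x \<in> carrier M" and y: "y \<in> line x" "y \<noteq> \<zero>"
  shows "x \<in> line y"
proof -
  obtain k where k: "y = k \<odot> x" using y by (auto simp: line_def)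
  then have "k \<noteq> 0" using y smult(6)[OF x] by auto
  then have "x = inverse k \<odot> y" using smult(4)[OF x, of "inverse k" k] smult(5)[OF x] k by simp
  then show ?thesis by (auto simp: line_def)
qed

lemma line_simple:
  assumes x: "x \<in> annihilated" and e: "act M gen_b x = e \<odot> x" and nz: "x \<noteq> \<zero>"
  shows "D4_simple (D4_restrict M (line x))"
proof -
  have L: "D4_submodule (line x) M" by (rule line_submodule[OF x e])
  interpret L: exterior_module "D4_restrict M (line x)" by (rule exterior_restrict[OF L])
  have xM: "x \<in> carrier M" using x by (simp add: annihilated_def)
  have xl: "x \<in> line x" using smult(5)[OF xM] unfolding line_def by (metis rangeI)
  show ?thesis unfolding D4_simple_def
  proof (intro conjI allI impI)
    show "carrier (D4_restrict M (line x)) \<noteq> {\<zero>\<^bsub>D4_restrict M (line x)\<^esub>}"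
      using xl nz by (auto simp: D4_restrict_def)
    fix N assume "D4_submodule N (D4_restrict M (line x))"
    then have N: "N \<subseteq> line x" "\<zero> \<in> N" "\<And>k y. y \<in> N \<Longrightarrow> k \<odot> y \<in> N"
      unfolding L.D4_submodule_iff by (auto simp: D4_restrict_def)
    show "N = {\<zero>\<^bsub>D4_restrict M (line x)\<^esub>} \<or> N = carrier (D4_restrict M (line x))"
    proof (cases "N = {\<zero>}")
      case False
      then obtain y where y: "y \<in> N" "y \<noteq> \<zero>" using N(2) by blast
      then have "x \<in> line y" using line_eq[OF xM] N(1) by blast
      then have "x \<in> N" using N(3) y by (auto simp: line_def)
      then have "line x \<subseteq> N" using N(3) by (auto simp: line_def)
      then show ?thesis using N(1) by (auto simp: D4_restrict_def)
    qed (simp add: D4_restrict_def)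
  qed
qed

text \<open>The two components are the projections to the eigenspaces of b without the factor 1/2;
  characteristic different from 2 enters when they are recombined.\<close>

lemma eigen_decomp:
  assumes x: "x \<in> carrier M"
  shows "act M gen_b (x \<oplus> act M gen_b x) = x \<oplus> act M gen_b x"
    "act M gen_b (x \<oplus> (-1) \<odot> act M gen_b x) = (-1) \<odot> (x \<oplus> (-1) \<odot> act M gen_b x)"
    "x = inverse 2 \<odot> ((x \<oplus> act M gen_b x) \<oplus> (x \<oplus> (-1) \<odot> act M gen_b x))"
proof -
  note c = x act_closed[OF x]
  show "act M gen_b (x \<oplus> act M gen_b x) = x \<oplus> act M gen_b x"
    using c by (simp add: act_add bb a_comm)
  show "act M gen_b (x \<oplus> (-1) \<odot> act M gen_b x) = (-1) \<odot> (x \<oplus> (-1) \<odot> act M gen_b x)"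
    using c by (simp add: act_add act_smult bb smult(1,3,5) a_comm flip: smult(4))
  have 2: "(2::'k) \<odot> x = x \<oplus> x" using smult(2)[OF x, of 1 1] smult(5)[OF x] by simp
  have "(x \<oplus> act M gen_b x) \<oplus> (x \<oplus> (-1) \<odot> act M gen_b x) = 
    (x \<oplus> x) \<oplus> (act M gen_b x \<oplus> \<ominus> act M gen_b x)"
    using c by (simp add: smult a_ac)
  also have "\<dots> = 2 \<odot> x" using c by (simp add: r_neg 2)
  finally show "x = inverse 2 \<odot> ((x \<oplus> act M gen_b x) \<oplus> (x \<oplus> (-1) \<odot> act M gen_b x))"
    using smult(4)[OF x, of "inverse 2" 2] smult(5)[OF x] two by simp
qed

lemma annihilated_submodule: "D4_submodule annihilated M"
proof -
  have "act M g x \<in> annihilated" if x: "x \<in> annihilated" for g x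
    by (cases g) (use x b_eigen_annihilated act_c[of x] act_zero in \<open>auto simp: annihilated_def\<close>)
  then show ?thesis
    by (auto simp: D4_submodule_iff annihilated_def act_zero act_add act_smult smult)
qed

text \<open>Pushing a nonzero vector by a and then by d, as long as the result is nonzero, ends in a
  vector killed by both, since a and d anticommute and square to zero. One of its two b-components
  is nonzero and spans a submodule.\<close>

lemma simple_eq_line:
  assumes "D4_simple M"
  obtains q where "q \<in> annihilated" "q \<noteq> \<zero>" "carrier M = line q"
proof -
  obtain x where x: "x \<in> carrier M" "x \<noteq> \<zero>" using assms unfolding D4_simple_def by blast
  define y where "y = (if act M gen_a x = \<zero> then x else act M gen_a x)"
  have y: "y \<in> carrier M" "y \<noteq> \<zero>" "act M gen_a y = \<zero>" using x act_closed aa by (auto simp: y_def)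
  have "act M gen_a (act M gen_d y) = \<zero>"
    using da[OF y(1)] y act_zero act_closed by auto
  define z where "z = (if act M gen_d y = \<zero> then y else act M gen_d y)"
  have z: "z \<in> annihilated" "z \<noteq> \<zero>"
    using y act_closed dd \<open>act M gen_a (act M gen_d y) = \<zero>\<close> by (auto simp: z_def annihilated_def)
  have zM: "z \<in> carrier M" using z by (simp add: annihilated_def)
  note A = annihilated_submodule[unfolded D4_submodule_iff]
  have bz: "act M gen_b z \<in> annihilated" using z b_eigen_annihilated by blast
  let ?p = "z \<oplus> act M gen_b z" and ?m = "z \<oplus> (-1) \<odot> act M gen_b z"
  have pm: "?p \<in> annihilated" "?m \<in> annihilated" using A z(1) bz by auto
  have "?p \<noteq> \<zero> \<or> ?m \<noteq> \<zero>" using eigen_decomp(3)[OF zM] z(2) smult(7) by fastforce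
  then obtain q e where q: "q \<in> annihilated" "q \<noteq> \<zero>" "act M gen_b q = e \<odot> q"
    using eigen_decomp[OF zM] pm smult(5) unfolding annihilated_def by (metis (no_types, lifting) mem_Collect_eq)
  have qM: "q \<in> carrier M" using q by (simp add: annihilated_def)
  have "q \<in> line q" using smult(5)[OF qM] unfolding line_def by (metis rangeI)
  then have "carrier M = line q"
    using assms line_submodule[OF q(1,3)] q(2) unfolding D4_simple_def by blast
  then show ?thesis using that q by blast
qed

text \<open>Simple submodules are lines of annihilated vectors, which gives one inclusion.
  Conversely an annihilated vector is a combination of annihilated b-eigenvectors, each zero or
  spanning a simple submodule.\<close>

lemma socle_eq: "D4_socle M = annihilated"
proof
  have "S \<subseteq> annihilated" if S: "D4_submodule S M" "D4_simple (D4_restrict M S)" for S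
  proof -
    interpret S: exterior_module "D4_restrict M S" by (rule exterior_restrict[OF S(1)])
    obtain q where q: "q \<in> S.annihilated" "S = S.line q"
      using S.simple_eq_line[OF S(2)] by (metis D4_restrict_def module.select_convs partial_object.select_convs(1) partial_object.update_convs(1) partial_object.surjective)
    have "S \<subseteq> carrier M" using S(1) by (simp add: D4_submodule_iff)
    then have "q \<in> annihilated" using q(1) unfolding S.annihilated_def annihilated_def
      by (auto simp: D4_restrict_def)
    then have "line q \<subseteq> annihilated" by (rule line_subset[OF annihilated_submodule])
    then show ?thesis using q(2) unfolding line_def S.line_def by (simp add: D4_restrict_def)
  qed
  then show "D4_socle M \<subseteq> annihilated"
    unfolding D4_socle_def using annihilated_submodule by blast
  show "annihilated \<subseteq> D4_socle M" unfolding D4_socle_def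
  proof (intro subsetI InterI)
    fix x N assume x: "x \<in> annihilated"
      and "N \<in> {N. D4_submodule N M \<and> (\<forall>S. D4_submodule S M \<and> D4_simple (D4_restrict M S) \<longrightarrow> S \<subseteq> N)}"
    then have N: "D4_submodule N M" "\<And>S. D4_submodule S M \<Longrightarrow> D4_simple (D4_restrict M S) \<Longrightarrow> S \<subseteq> N" by auto
    have ev: "q \<in> N" if q: "q \<in> annihilated" "act M gen_b q = e \<odot> q" for q e
    proof (cases "q = \<zero>")
      case False
      have qM: "q \<in> carrier M" using q by (simp add: annihilated_def)
      have "q \<in> line q" using smult(5)[OF qM] unfolding line_def by (metis rangeI)
      then show ?thesis using N(2)[OF line_submodule[OF q] line_simple[OF q False]] by blast
    qed (use N in \<open>simp add: D4_submodule_iff\<close>)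
    have xM: "x \<in> carrier M" using x by (simp add: annihilated_def)
    note A = annihilated_submodule[unfolded D4_submodule_iff]
    have bx: "act M gen_b x \<in> annihilated" using x b_eigen_annihilated by blast
    let ?p = "x \<oplus> act M gen_b x" and ?m = "x \<oplus> (-1) \<odot> act M gen_b x"
    have pm: "?p \<in> annihilated" "?m \<in> annihilated" using A x(1) bx by auto
    have "?p \<in> N" using ev[OF pm(1), of 1] eigen_decomp(1)[OF xM] pm smult(5) by (auto simp: annihilated_def)
    moreover have "?m \<in> N" using ev[OF pm(2), of "-1"] eigen_decomp(2)[OF xM] by simp
    ultimately show "x \<in> N" using eigen_decomp(3)[OF xM] N(1) unfolding D4_submodule_iff by metis
  qed
qed

end

section \<open>Coordinates\<close>

lemma lookup_fs_scale [simp]: "Poly_Mapping.lookup (fs_scale k f) x = k * Poly_Mapping.lookup f x"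
  unfolding fs_scale_def by (simp add: Poly_Mapping.map.rep_eq when_def)

interpretation fs: lin_space "fs_scale :: 'k::field \<Rightarrow> ('x \<Rightarrow>\<^sub>0 'k) \<Rightarrow> ('x \<Rightarrow>\<^sub>0 'k)"
  by unfold_locales (auto intro!: poly_mapping_eqI simp: lookup_add algebra_simps)

definition supported :: "'x set \<Rightarrow> ('x \<Rightarrow>\<^sub>0 'k::field) set" where
  "supported I = {f. Poly_Mapping.keys f \<subseteq> I}"

lemma supported_iff: "f \<in> supported I \<longleftrightarrow> (\<forall>x. x \<notin> I \<longrightarrow> Poly_Mapping.lookup f x = 0)"
  by (auto simp: supported_def in_keys_iff)

lemma subspace_supported: "fs.subspace (supported I)"
  by (auto simp: fs.subspace_def supported_iff lookup_add)

lemma poly_mapping_decomp: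
  assumes "finite I" "f \<in> supported I"
  shows "f = (\<Sum>i\<in>I. fs_scale (Poly_Mapping.lookup f i) (Poly_Mapping.single i 1))"
proof (rule poly_mapping_eqI)
  fix j
  have "(\<Sum>i\<in>I. Poly_Mapping.lookup f i * (1 when i = j)) = (\<Sum>i\<in>I. if i = j then Poly_Mapping.lookup f j else 0)"
    by (intro sum.cong) (auto simp: when_def)
  also have "\<dots> = Poly_Mapping.lookup f j" using assms by (auto simp: supported_iff)
  finally show "Poly_Mapping.lookup f j =
    Poly_Mapping.lookup (\<Sum>i\<in>I. fs_scale (Poly_Mapping.lookup f i) (Poly_Mapping.single i 1)) j"
    by (simp add: lookup_sum lookup_single)
qed

lemma fdim_supported:
  fixes I :: "'x set"
  assumes "finite I"
  shows "fs.fdim (supported I :: ('x \<Rightarrow>\<^sub>0 'k::field) set)"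
  unfolding fs.fdim_def
proof (intro exI conjI subsetI)
  fix f :: "'x \<Rightarrow>\<^sub>0 'k" assume "f \<in> supported I"
  with assms show "f \<in> fs.span ((\<lambda>i. Poly_Mapping.single i 1) ` I)"
    by (subst poly_mapping_decomp[of I f]) (auto intro!: fs.span_sum fs.span_scale intro: fs.span_base)
qed (use assms in auto)

text \<open>Coordinates with respect to a basis indexed by \<open>I\<close>; finitely supported
  functions give modules with unrelated element types a common home.\<close>

definition coords :: "('k::field, 'v, 'e) module_scheme \<Rightarrow> 'x set \<Rightarrow> ('v \<Rightarrow> ('x \<Rightarrow>\<^sub>0 'k)) \<Rightarrow> bool" where
  "coords M I \<phi> \<longleftrightarrow> bij_betw \<phi> (carrier M) (supported I) \<and>
     (\<forall>x\<in>carrier M. \<forall>y\<in>carrier M. \<phi> (x \<oplus>\<^bsub>M\<^esub> y) = \<phi> x + \<phi> y) \<and>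
     (\<forall>k. \<forall>x\<in>carrier M. \<phi> (k \<odot>\<^bsub>M\<^esub> x) = fs_scale k (\<phi> x))"

lemma coords_of_parametrization:
  fixes M :: "('k::field, 'v, 'e) module_scheme" (structure)
  assumes bij: "bij_betw L (supported I) (carrier M)"
    and add: "\<And>f g. f \<in> supported I \<Longrightarrow> g \<in> supported I \<Longrightarrow> L (f + g) = L f \<oplus> L g"
    and sm: "\<And>k f. f \<in> supported I \<Longrightarrow> L (fs_scale k f) = k \<odot> L f"
  shows "coords M I (the_inv_into (supported I) L)" (is "coords M I ?\<gamma>")
proof -
  have inj: "inj_on L (supported I)" and im: "L ` supported I = carrier M"
    using bij by (simp_all add: bij_betw_def)
  have inv: "?\<gamma> (L f) = f" if "f \<in> supported I" for f using inj that by (rule the_inv_into_f_f)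
  have ex: "\<exists>f\<in>supported I. x = L f" if "x \<in> carrier M" for x using that im by auto
  note cl = fs.subspace_add[OF subspace_supported] fs.subspace_scale[OF subspace_supported]
  show ?thesis unfolding coords_def
  proof (intro conjI ballI allI)
    show "bij_betw ?\<gamma> (carrier M) (supported I)" by (rule bij_betw_the_inv_into[OF bij])
    fix x assume "x \<in> carrier M"
    then obtain f where f: "f \<in> supported I" "x = L f" using ex by blast
    show "?\<gamma> (x \<oplus> y) = ?\<gamma> x + ?\<gamma> y" if "y \<in> carrier M" for y
    proof -
      obtain g where g: "g \<in> supported I" "y = L g" using ex[OF \<open>y \<in> carrier M\<close>] by blast
      show ?thesis unfolding f(2) g(2) add[OF f(1) g(1), symmetric] inv[OF f(1)] inv[OF g(1)]
        by (rule inv[OF cl(1)[OF f(1) g(1)]])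
    qed
    show "?\<gamma> (k \<odot> x) = fs_scale k (?\<gamma> x)" for k
      unfolding f(2) sm[OF f(1), symmetric] inv[OF f(1)] by (rule inv[OF cl(2)[OF f(1)]])
  qed
qed

text \<open>The basis itself serves as index set, so no enumeration has to be chosen.\<close>

lemma coords_exist:
  fixes M :: "('k::field, 'v, 'e) module_scheme" (structure)
  assumes "vectorspace (class_ring :: 'k ring) M" "vectorspace.fin_dim (class_ring :: 'k ring) M"
  obtains A :: "'v set" and \<phi> where "finite A" "coords M A \<phi>"
proof -
  interpret vectorspace class_ring M by fact
  obtain A where A: "finite A" "basis A" using finite_basis_exists assms(2) by blast
  then have AM: "A \<subseteq> carrier M" by (simp add: basis_def)
  have ex1: "\<exists>!a. a \<in> A \<rightarrow>\<^sub>E UNIV \<and> lincomb a A = v" if "v \<in> carrier M" for v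
    using basis_criterion[OF A(1) AM] A(2) that by simp
  define \<psi> where "\<psi> f = lincomb (Poly_Mapping.lookup f) A" for f :: "'v \<Rightarrow>\<^sub>0 'k"
  have closed: "\<psi> f \<in> carrier M" for f unfolding \<psi>_def by (rule lincomb_closed[OF AM]) simp
  have add: "\<psi> (f + g) = \<psi> f \<oplus> \<psi> g" for f g
    using lincomb_sum[OF A(1) AM, of "Poly_Mapping.lookup f" "Poly_Mapping.lookup g"]
    by (simp add: \<psi>_def lookup_add[abs_def] plus_poly_mapping.rep_eq)
  have sm: "\<psi> (fs_scale k f) = k \<odot> \<psi> f" for k f
  proof -
    have "Poly_Mapping.lookup (fs_scale k f) = (\<lambda>w. k * Poly_Mapping.lookup f w)" by (simp add: fun_eq_iff)
    then show ?thesis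
      using lincomb_smult[OF AM, of "Poly_Mapping.lookup f" k] by (simp add: \<psi>_def)
  qed
  have cong: "lincomb a A = lincomb b A" if "\<And>i. i \<in> A \<Longrightarrow> a i = b i" for a b
    by (rule lincomb_cong) (use AM that in auto)
  have "bij_betw \<psi> (supported A) (carrier M)"
  proof (rule bij_betw_imageI)
    show "inj_on \<psi> (supported A)"
    proof (rule inj_onI)
      fix f g :: "'v \<Rightarrow>\<^sub>0 'k" assume fg: "f \<in> supported A" "g \<in> supported A" "\<psi> f = \<psi> g"
      have "restrict (Poly_Mapping.lookup f) A = restrict (Poly_Mapping.lookup g) A"
      proof -
        have "lincomb (restrict (Poly_Mapping.lookup f) A) A = \<psi> f"
          "lincomb (restrict (Poly_Mapping.lookup g) A) A = \<psi> f"
          using fg(3) cong[of "restrict (Poly_Mapping.lookup f) A" "Poly_Mapping.lookup f"]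
            cong[of "restrict (Poly_Mapping.lookup g) A" "Poly_Mapping.lookup g"]
          by (simp_all add: \<psi>_def)
        then show ?thesis using ex1[OF closed, of f] by (metis restrict_PiE_iff UNIV_I)
      qed
      then have "Poly_Mapping.lookup f x = Poly_Mapping.lookup g x" for x
        using fg(1,2) by (cases "x \<in> A") (auto simp: supported_iff dest: restrict_apply' fun_cong[of _ _ x])
      then show "f = g" by (rule poly_mapping_eqI)
    qed
    show "\<psi> ` supported A = carrier M"
    proof (intro subset_antisym subsetI)
      fix v assume "v \<in> carrier M"
      then obtain a where a: "lincomb a A = v" using ex1 by blast
      define f where "f = Abs_poly_mapping (\<lambda>i. if i \<in> A then a i else 0)"
      have f: "Poly_Mapping.lookup f = (\<lambda>i. if i \<in> A then a i else 0)"
        unfolding f_def by (rule lookup_Abs_poly_mapping) (use A(1) in \<open>auto intro: finite_subset\<close>)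
      then have "\<psi> f = v" using cong[of "\<lambda>i. if i \<in> A then a i else 0" a] a by (simp add: \<psi>_def)
      moreover have "f \<in> supported A" by (simp add: supported_iff f)
      ultimately show "v \<in> \<psi> ` supported A" by blast
    qed (use closed in auto)
  qed
  then have "coords M A (the_inv_into (supported A) \<psi>)"
    by (rule coords_of_parametrization) (simp_all add: add sm)
  then show ?thesis using that A(1) by blast
qed

section \<open>Composition series and Loewy length when b = c\<close>

context exterior_module
begin

text \<open>Dimension one of F'/F, said without forming the quotient. For submodules it amounts to
  simplicity of the quotient, because simple modules are lines here.\<close>

definition step :: "'v set \<Rightarrow> 'v set \<Rightarrow> bool" where
  "step F F' \<longleftrightarrow> F \<subseteq> F' \<and> (\<exists>e\<in>F'. e \<notin> F \<and> (\<forall>y\<in>F'. \<exists>h\<in>F. \<exists>k. y = h \<oplus> k \<odot> e))"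

lemma coset_eq_self: "D4_submodule F M \<Longrightarrow> y \<in> carrier M \<Longrightarrow> F +> y = F \<longleftrightarrow> y \<in> F"
  using coset_eq_iff[of F y \<zero>] quotient_simps(3)[of F] by (auto simp: D4_submodule_iff subset_iff)

lemma simple_quotient_iff:
  assumes F: "D4_submodule F M"
  shows "D4_simple (D4_quotient M F) \<longleftrightarrow> step F (carrier M)"
proof -
  interpret Q: exterior_module "D4_quotient M F" by (rule exterior_quotient[OF F])
  note Q = quotient_simps[OF F]
  have FM: "F \<subseteq> carrier M" using F by (simp add: D4_submodule_iff)
  show ?thesis
  proof
    assume "D4_simple (D4_quotient M F)"
    then obtain q where q: "q \<in> Q.annihilated" "q \<noteq> F" "carrier (D4_quotient M F) = Q.line q"
      using Q.simple_eq_line unfolding Q(2) by metis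
    have "q \<in> carrier (D4_quotient M F)" using q(1) unfolding Q.annihilated_def by blast
    then obtain e where e: "e \<in> carrier M" "q = F +> e" unfolding Q(1) by blast
    then have "e \<notin> F" using q(2) coset_eq_self[OF F] by blast
    moreover have "\<exists>h\<in>F. \<exists>k. y = h \<oplus> k \<odot> e" if y: "y \<in> carrier M" for y
    proof -
      have "F +> y \<in> Q.line q" using q(3) y by (auto simp: Q(1))
      then obtain k where "F +> y = F +> (k \<odot> e)" using e by (auto simp: Q.line_def Q(5))
      then have "\<exists>h\<in>F. y = h \<oplus> k \<odot> e" using coset_eq_iff[OF F y smult(1)[OF e(1)]] by simp
      then show ?thesis by blast
    qed
    ultimately show "step F (carrier M)" unfolding step_def using FM e(1) by blast
  next
    assume "step F (carrier M)"
    then obtain e where e: "e \<in> carrier M" "e \<notin> F" and ex: "\<And>y. y \<in> carrier M \<Longrightarrow> \<exists>h\<in>F. \<exists>k. y = h \<oplus> k \<odot> e"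
      unfolding step_def by blast
    have coset: "\<exists>k. F +> y = k \<odot>\<^bsub>D4_quotient M F\<^esub> (F +> e)" if y: "y \<in> carrier M" for y
      using ex[OF y] coset_eq_iff[OF F y] e(1) smult(1) Q(5)[OF e(1)] by metis
    show "D4_simple (D4_quotient M F)" unfolding D4_simple_def Q(2)
    proof (intro conjI allI impI)
      show "carrier (D4_quotient M F) \<noteq> {F}" using e coset_eq_self[OF F e(1)] by (auto simp: Q(1))
      fix N assume "D4_submodule N (D4_quotient M F)"
      then have N: "N \<subseteq> carrier (D4_quotient M F)" "F \<in> N" "\<And>k y. y \<in> N \<Longrightarrow> k \<odot>\<^bsub>D4_quotient M F\<^esub> y \<in> N"
        by (simp_all add: Q.D4_submodule_iff Q(2))
      show "N = {F} \<or> N = carrier (D4_quotient M F)"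
      proof (cases "N = {F}")
        case False
        then obtain X where X: "X \<in> N" "X \<noteq> F" using N(2) by blast
        then obtain y where y: "y \<in> carrier M" "X = F +> y" using N(1) by (auto simp: Q(1))
        obtain k where k: "X = k \<odot>\<^bsub>D4_quotient M F\<^esub> (F +> e)" using coset[OF y(1)] y(2) by blast
        have eQ: "F +> e \<in> carrier (D4_quotient M F)" using e(1) by (auto simp: Q(1))
        have "k \<noteq> 0" using X(2) k Q.smult(6)[OF eQ] Q(2) by auto
        then have "F +> e = inverse k \<odot>\<^bsub>D4_quotient M F\<^esub> X"
          using k Q.smult(4)[OF eQ, of "inverse k" k] Q.smult(5)[OF eQ] by simp
        then have "F +> e \<in> N" using N(3) X(1) by simp
        then have "carrier (D4_quotient M F) \<subseteq> N" using N(3) coset unfolding Q(1) by fastforce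
        then show ?thesis using N(1) by blast
      qed simp
    qed
  qed
qed

lemma composition_series_iff:
  "composition_series M n F \<longleftrightarrow> F 0 = {\<zero>} \<and> F n = carrier M \<and> (\<forall>i\<le>n. D4_submodule (F i) M) \<and>
     (\<forall>i<n. step (F i) (F (Suc i)))"
proof -
  have "D4_simple (D4_quotient (D4_restrict M F') F) \<longleftrightarrow> step F F'"
    if F: "D4_submodule F M" "D4_submodule F' M" "F \<subseteq> F'" for F F'
  proof -
    interpret R: exterior_module "D4_restrict M F'" by (rule exterior_restrict[OF F(2)])
    have "D4_submodule F (D4_restrict M F')" unfolding R.D4_submodule_iff
      using F by (auto simp: D4_submodule_iff D4_restrict_def)
    from R.simple_quotient_iff[OF this] show ?thesis
      unfolding R.step_def step_def by (simp add: D4_restrict_def)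
  qed
  then have *: "(F i \<subseteq> F (Suc i) \<and> D4_simple (D4_quotient (D4_restrict M (F (Suc i))) (F i))) \<longleftrightarrow>
      step (F i) (F (Suc i))" if "\<forall>i\<le>n. D4_submodule (F i) M" "i < n" for i
    using that(1)[rule_format, of i] that(1)[rule_format, of "Suc i"] that(2)
    unfolding step_def by auto
  show ?thesis unfolding composition_series_def
    by (intro conj_cong refl all_cong1 imp_cong) (rule *)
qed

text \<open>\<open>D4_length\<close> is a \<open>LEAST\<close> and says nothing unless a series
  exists. A chain of greatest length, available by \<open>bound\<close>, reaches the whole module: a
  b-eigenvector outside its last term spans a line stable under all generators, as a and d act as
  zero, and would prolong the chain.\<close>

lemma composition_series_exists:
  assumes ss: "annihilated = carrier M"
    and bound: "\<And>n F. F 0 = {\<zero>} \<Longrightarrow> (\<And>i. i \<le> n \<Longrightarrow> D4_submodule (F i) M) \<Longrightarrow>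
      (\<And>i. i < n \<Longrightarrow> step (F i) (F (Suc i))) \<Longrightarrow> n \<le> d"
  shows "\<exists>n F. composition_series M n F"
proof -
  define chain where "chain n F \<longleftrightarrow> F 0 = {\<zero>} \<and> (\<forall>i\<le>n. D4_submodule (F i) M) \<and>
     (\<forall>i<n. step (F i) (F (Suc i)))" for n :: nat and F :: "nat \<Rightarrow> 'v set"
  have c0: "chain 0 (\<lambda>_. {\<zero>})" by (auto simp: chain_def D4_submodule_iff act_zero smult)
  have cd: "n \<le> d" if "chain n F" for n F using bound that by (auto simp: chain_def)
  have "\<exists>n. (\<exists>F. chain n F) \<and> (\<forall>m. (\<exists>F. chain m F) \<longrightarrow> m \<le> n)"
    by (rule ex_has_greatest_nat[where P = "\<lambda>n. \<exists>F. chain n F" and f = "\<lambda>n. n" and k = 0 and b = "Suc d"])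
      (use c0 cd in \<open>auto simp: less_Suc_eq_le\<close>)
  then obtain n where n: "\<exists>F. chain n F" "\<And>m F. chain m F \<Longrightarrow> m \<le> n" by blast
  then obtain F where F: "chain n F" by blast
  have Fn: "D4_submodule (F n) M" using F by (simp add: chain_def)
  note Fn' = Fn[unfolded D4_submodule_iff]
  have "F n = carrier M"
  proof (rule ccontr)
    assume "F n \<noteq> carrier M"
    then obtain x where x: "x \<in> carrier M" "x \<notin> F n" using Fn' by blast
    note c = x(1) act_closed[OF x(1), of gen_b]
    have "x \<oplus> act M gen_b x \<notin> F n \<or> x \<oplus> (-1) \<odot> act M gen_b x \<notin> F n"
      using eigen_decomp(3)[OF x(1)] x(2) Fn' by metis
    then obtain e \<epsilon> where e: "e \<in> carrier M" "e \<notin> F n" "act M gen_b e = \<epsilon> \<odot> e"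
      using eigen_decomp(1,2)[OF x(1)] c smult(1,5) by (metis a_closed)
    define F' where "F' = {h \<oplus> k \<odot> e | h k. h \<in> F n}"
    have FnM: "F n \<subseteq> carrier M" using Fn' by blast
    have sub: "F n \<subseteq> F'"
    proof
      fix h assume "h \<in> F n"
      moreover from this have "h = h \<oplus> 0 \<odot> e" using smult(6)[OF e(1)] FnM by auto
      ultimately show "h \<in> F'" unfolding F'_def by blast
    qed
    have e': "e \<in> F'"
    proof -
      have "e = \<zero> \<oplus> 1 \<odot> e" using smult(5)[OF e(1)] e(1) by simp
      then show ?thesis using Fn' unfolding F'_def by blast
    qed
    have cl: "h \<oplus> k \<odot> e \<in> F'" if "h \<in> F n" for h k using that unfolding F'_def by blast
    have "D4_submodule F' M" unfolding D4_submodule_iff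
    proof (intro conjI ballI allI)
      show "F' \<subseteq> carrier M" using FnM smult(1)[OF e(1)] by (auto simp: F'_def)
      show "\<zero> \<in> F'" using sub Fn' by blast
      fix x assume "x \<in> F'"
      then obtain h k where hk: "h \<in> F n" "x = h \<oplus> k \<odot> e" by (auto simp: F'_def)
      have hM: "h \<in> carrier M" using hk FnM by blast
      show "x \<oplus> y \<in> F'" if "y \<in> F'" for y
      proof -
        from that obtain h' k' where hk': "h' \<in> F n" "y = h' \<oplus> k' \<odot> e" by (auto simp: F'_def)
        have "x \<oplus> y = (h \<oplus> h') \<oplus> (k + k') \<odot> e"
          using hk hk' FnM smult(1)[OF e(1)] by (auto simp: smult(2)[OF e(1)] a_ac subset_iff)
        then show ?thesis using cl[of "h \<oplus> h'"] Fn' hk(1) hk'(1) by metis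
      qed
      show "l \<odot> x \<in> F'" for l
      proof -
        have "l \<odot> x = l \<odot> h \<oplus> (l * k) \<odot> e"
          using hk hM e(1) by (simp add: smult)
        then show ?thesis using cl[of "l \<odot> h"] Fn' hk(1) by metis
      qed
      show "act M g x \<in> F'" for g
      proof -
        have "\<exists>l. act M g e = l \<odot> e"
        proof (cases g)
          case gen_a
          then show ?thesis using ss e(1) smult(6)[OF e(1)] by (auto simp: annihilated_def intro!: exI[of _ 0])
        next
          case gen_d
          then show ?thesis using ss e(1) smult(6)[OF e(1)] by (auto simp: annihilated_def intro!: exI[of _ 0])
        qed (use e act_c in auto)
        then obtain l where l: "act M g e = l \<odot> e" by blast
        have "act M g x = act M g h \<oplus> (k * l) \<odot> e"
          using hk hM e(1) by (simp add: act_add act_smult l smult)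
        then show ?thesis using cl[of "act M g h"] Fn' hk(1) by metis
      qed
    qed
    moreover have "step (F n) F'" unfolding step_def using sub e(2) e'
      by (auto simp: F'_def)
    ultimately have "chain (Suc n) (F(Suc n := F'))"
      using F by (auto simp: chain_def le_Suc_eq less_Suc_eq)
    then show False using n(2) by fastforce
  qed
  then have "composition_series M n F" using F by (simp add: composition_series_iff chain_def)
  then show ?thesis by blast
qed

lemma length_composition_series:
  assumes "\<exists>n F. composition_series M n F"
  obtains F where "composition_series M (D4_length M) F"
  using LeastI_ex[OF assms] unfolding D4_length_def by blast

context
  fixes A :: "'v set" and \<phi> :: "'v \<Rightarrow> ('v \<Rightarrow>\<^sub>0 'k)"
  assumes A: "finite A" and \<phi>: "coords M A \<phi>"
begin

lemma phi_add: "x \<in> carrier M \<Longrightarrow> y \<in> carrier M \<Longrightarrow> \<phi> (x \<oplus> y) = \<phi> x + \<phi> y"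
  and phi_smult: "x \<in> carrier M \<Longrightarrow> \<phi> (k \<odot> x) = fs_scale k (\<phi> x)"
  and phi_inj: "inj_on \<phi> (carrier M)" and phi_supported: "\<phi> ` carrier M = supported A"
  using \<phi> by (auto simp: coords_def bij_betw_def)

lemma phi_zero: "\<phi> \<zero> = 0"
  using phi_smult[of \<zero> 0] smult(6)[of \<zero>] by simp

lemma phi_subspace:
  assumes "H \<subseteq> carrier M" "\<zero> \<in> H" "\<And>x y. x \<in> H \<Longrightarrow> y \<in> H \<Longrightarrow> x \<oplus> y \<in> H" "\<And>k x. x \<in> H \<Longrightarrow> k \<odot> x \<in> H"
  shows "fs.subspace (\<phi> ` H)" "fs.fdim (\<phi> ` H)"
proof -
  have c: "\<And>x. x \<in> H \<Longrightarrow> x \<in> carrier M" using assms(1) by blast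
  show "fs.subspace (\<phi> ` H)"
    unfolding fs.subspace_def
  proof (intro conjI ballI allI)
    show "0 \<in> \<phi> ` H" using assms(2) phi_zero by (metis image_eqI)
    fix u assume "u \<in> \<phi> ` H"
    then obtain x where x: "x \<in> H" "u = \<phi> x" by blast
    show "u + v \<in> \<phi> ` H" if "v \<in> \<phi> ` H" for v
    proof -
      from \<open>v \<in> \<phi> ` H\<close> obtain y where "y \<in> H" "v = \<phi> y" by blast
      then show ?thesis using x assms(3)[of x y] phi_add[of x y] c by (metis image_eqI)
    qed
    show "fs_scale k u \<in> \<phi> ` H" for k using x assms(4) phi_smult c by (metis image_eqI)
  qed
  have "\<phi> ` H \<subseteq> supported A" using phi_supported assms(1) by blast
  then show "fs.fdim (\<phi> ` H)" using fs.fdim_subset[OF fdim_supported[OF A]] by blast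
qed

lemma phi_submodule:
  assumes "D4_submodule H M"
  shows "fs.subspace (\<phi> ` H)" "fs.fdim (\<phi> ` H)"
  using phi_subspace[of H] assms by (auto simp: D4_submodule_iff)

lemma dim_step:
  assumes H: "D4_submodule H M" and H': "D4_submodule H' M" and st: "step H H'"
  shows "fs.dim (\<phi> ` H') = Suc (fs.dim (\<phi> ` H))"
proof -
  obtain e where e: "e \<in> H'" "e \<notin> H" "\<And>y. y \<in> H' \<Longrightarrow> \<exists>h\<in>H. \<exists>k. y = h \<oplus> k \<odot> e" "H \<subseteq> H'"
    using st unfolding step_def by blast
  have HM: "H' \<subseteq> carrier M" using H' by (simp add: D4_submodule_iff)
  have "\<phi> e \<notin> \<phi> ` H" using e HM inj_on_image_mem_iff[OF phi_inj, of e H] by blast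
  then have 1: "fs.dim (fs.span (insert (\<phi> e) (\<phi> ` H))) = Suc (fs.dim (\<phi> ` H))"
    using fs.dim_insert' phi_submodule[OF H] by blast
  have "fs.span (insert (\<phi> e) (\<phi> ` H)) = \<phi> ` H'"
  proof
    show "fs.span (insert (\<phi> e) (\<phi> ` H)) \<subseteq> \<phi> ` H'"
      using e by (intro fs.span_minimal phi_submodule[OF H']) auto
    show "\<phi> ` H' \<subseteq> fs.span (insert (\<phi> e) (\<phi> ` H))"
    proof
      fix z assume "z \<in> \<phi> ` H'"
      then obtain y where y: "y \<in> H'" "z = \<phi> y" by blast
      then obtain h k where hk: "h \<in> H" "y = h \<oplus> k \<odot> e" using e(3) by blast
      have "h \<in> carrier M" "e \<in> carrier M" using hk e HM by auto
      then have z: "z = \<phi> h + fs_scale k (\<phi> e)" using y hk phi_add phi_smult smult(1) by simp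
      show "z \<in> fs.span (insert (\<phi> e) (\<phi> ` H))"
        unfolding z by (intro fs.span_add fs.span_scale fs.span_base) (use hk(1) in auto)
    qed
  qed
  then show ?thesis using 1 by simp
qed

lemma dim_chain:
  assumes "\<And>i. i \<le> n \<Longrightarrow> D4_submodule (F i) M" "\<And>i. i < n \<Longrightarrow> step (F i) (F (Suc i))"
  shows "fs.dim (\<phi> ` F n) = fs.dim (\<phi> ` F 0) + n"
  using assms
proof (induction n)
  case (Suc n)
  then show ?case using dim_step[of "F n" "F (Suc n)"] by simp
qed simp

lemma dim_zero_image: "fs.dim (\<phi> ` {\<zero>}) = 0"
  using fs.dim_zero' phi_zero by simp

lemma dim_le: "D4_submodule H M \<Longrightarrow> fs.dim (\<phi> ` H) \<le> fs.dim (supported A :: ('v \<Rightarrow>\<^sub>0 'k) set)"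
  using phi_supported by (intro fs.dim_mono'[OF fdim_supported[OF A]]) (auto simp: D4_submodule_iff)

text \<open>Length is dimension, since each \<open>step\<close> raises the dimension by one.
  Submodules of the socle are submodules of M, so the coordinates of M serve for both.\<close>

lemma dim_socle:
  "fs.dim (\<phi> ` D4_socle M) = D4_length (D4_restrict M (D4_socle M))"
proof -
  define K where "K = annihilated"
  have K: "D4_submodule K M" unfolding K_def by (rule annihilated_submodule)
  interpret R: exterior_module "D4_restrict M K" by (rule exterior_restrict[OF K])
  have sub: "D4_submodule F M" if "D4_submodule F (D4_restrict M K)" for F
    using that K unfolding R.D4_submodule_iff D4_submodule_iff by (auto simp: D4_restrict_def)
  have st: "R.step F F' \<longleftrightarrow> step F F'" for F F'
    unfolding R.step_def step_def by (simp add: D4_restrict_def)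
  have "R.annihilated = carrier (D4_restrict M K)"
    unfolding R.annihilated_def by (auto simp: D4_restrict_def K_def annihilated_def)
  moreover have "n \<le> fs.dim (supported A :: ('v \<Rightarrow>\<^sub>0 'k) set)"
    if "F 0 = {\<zero>\<^bsub>D4_restrict M K\<^esub>}" "\<And>i. i \<le> n \<Longrightarrow> D4_submodule (F i) (D4_restrict M K)"
      "\<And>i. i < n \<Longrightarrow> R.step (F i) (F (Suc i))" for n F
    using dim_chain[of n F] dim_le[of "F n"] that sub st by fastforce
  ultimately obtain F where "composition_series (D4_restrict M K) (D4_length (D4_restrict M K)) F"
    using R.composition_series_exists R.length_composition_series by metis
  then have "F 0 = {\<zero>}" "F (D4_length (D4_restrict M K)) = K"
    "\<And>i. i \<le> D4_length (D4_restrict M K) \<Longrightarrow> D4_submodule (F i) M"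
    "\<And>i. i < D4_length (D4_restrict M K) \<Longrightarrow> step (F i) (F (Suc i))"
    unfolding R.composition_series_iff st using sub by (auto simp: D4_restrict_def)
  then show ?thesis using dim_chain[of "D4_length (D4_restrict M K)" F] dim_zero_image
    by (simp add: socle_eq K_def)
qed

text \<open>A composition series of the quotient by the socle is pulled back to a chain from the
  socle up to M. The hypothesis makes a and d act as zero on the quotient, which provides the
  series.\<close>

lemma dim_quotient_socle:
  assumes L: "\<And>x. x \<in> carrier M \<Longrightarrow> act M gen_a x \<in> D4_socle M \<and> act M gen_d x \<in> D4_socle M"
  shows "fs.dim (\<phi> ` carrier M) = D4_length (D4_quotient M (D4_socle M)) + D4_length (D4_restrict M (D4_socle M))"
proof -
  define K where "K = annihilated"
  have K: "D4_submodule K M" unfolding K_def by (rule annihilated_submodule)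
  interpret Q: exterior_module "D4_quotient M K" by (rule exterior_quotient[OF K])
  note Q = quotient_simps[OF K]
  define lift where "lift G = {x \<in> carrier M. K +> x \<in> G}" for G
  have sub: "D4_submodule (lift G) M" if G: "D4_submodule G (D4_quotient M K)" for G
    unfolding D4_submodule_iff
  proof (intro conjI ballI allI)
    note G' = G[unfolded Q.D4_submodule_iff]
    show "lift G \<subseteq> carrier M" by (auto simp: lift_def)
    show "\<zero> \<in> lift G" using G' by (simp add: lift_def Q)
    fix x assume x: "x \<in> lift G"
    show "x \<oplus> y \<in> lift G" if "y \<in> lift G" for y
      using x that G' by (auto simp: lift_def simp flip: Q(4))
    show "k \<odot> x \<in> lift G" for k
      using x G' smult(1) by (auto simp: lift_def simp flip: Q(5))
    show "act M g x \<in> lift G" for g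
      using x G' act_closed by (auto simp: lift_def simp flip: Q(6))
  qed
  have st: "step (lift G) (lift G')"
    if G: "D4_submodule G (D4_quotient M K)" "D4_submodule G' (D4_quotient M K)" and s: "Q.step G G'" for G G'
  proof -
    from s[unfolded Q.step_def] obtain X where X: "X \<in> G'" "X \<notin> G" "G \<subseteq> G'"
      "\<forall>Y\<in>G'. \<exists>H\<in>G. \<exists>k. Y = H \<oplus>\<^bsub>D4_quotient M K\<^esub> k \<odot>\<^bsub>D4_quotient M K\<^esub> X"
      by (elim conjE bexE)
    obtain e where e: "e \<in> carrier M" "X = K +> e" using X G by (auto simp: Q.D4_submodule_iff Q)
    have "\<exists>h\<in>lift G. \<exists>k. y = h \<oplus> k \<odot> e" if y: "y \<in> lift G'" for y
    proof -
      have yM: "y \<in> carrier M" using y by (simp add: lift_def)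
      obtain H k where Hk: "H \<in> G" "K +> y = H \<oplus>\<^bsub>D4_quotient M K\<^esub> k \<odot>\<^bsub>D4_quotient M K\<^esub> X"
        using X(4) y unfolding lift_def by blast
      obtain h where h: "h \<in> carrier M" "H = K +> h" using Hk(1) G(1) by (auto simp: Q.D4_submodule_iff Q)
      have "K +> y = K +> (h \<oplus> k \<odot> e)" using Hk h e smult(1) by (simp add: Q)
      then obtain n where n: "n \<in> K" "y = n \<oplus> (h \<oplus> k \<odot> e)"
        using coset_eq_iff[OF K yM, of "h \<oplus> k \<odot> e"] h(1) e(1) smult(1) by auto
      have nM: "n \<in> carrier M" using n K by (auto simp: D4_submodule_iff)
      have "y = (n \<oplus> h) \<oplus> k \<odot> e" using n nM h e smult(1) by (simp add: a_assoc)
      moreover have "K +> (n \<oplus> h) = K +> h" using coset_eq_iff[OF K, of "n \<oplus> h" h] n(1) nM h(1) by auto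
      ultimately have "n \<oplus> h \<in> lift G" "y = (n \<oplus> h) \<oplus> k \<odot> e" using Hk(1) h nM by (simp_all add: lift_def)
      then show ?thesis by blast
    qed
    then show ?thesis unfolding step_def using X e by (auto simp: lift_def intro!: bexI[of _ e])
  qed
  have lift0: "lift {K} = K"
    using coset_eq_self[OF K] K by (auto simp: lift_def D4_submodule_iff)
  have liftQ: "lift (carrier (D4_quotient M K)) = carrier M" by (auto simp: lift_def Q)
  have LK: "act M gen_a x \<in> K" "act M gen_d x \<in> K" if "x \<in> carrier M" for x
    using L[OF that] by (auto simp: socle_eq K_def)
  have "K +> act M gen_a x = K" "K +> act M gen_d x = K" if "x \<in> carrier M" for x
    using LK[OF that] coset_eq_self[OF K act_closed[OF that]] by auto
  then have "Q.annihilated = carrier (D4_quotient M K)"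
    unfolding Q.annihilated_def by (auto simp only: Q mem_Collect_eq)
  moreover have "n \<le> fs.dim (supported A :: ('v \<Rightarrow>\<^sub>0 'k) set)"
    if "F 0 = {\<zero>\<^bsub>D4_quotient M K\<^esub>}" "\<And>i. i \<le> n \<Longrightarrow> D4_submodule (F i) (D4_quotient M K)"
      "\<And>i. i < n \<Longrightarrow> Q.step (F i) (F (Suc i))" for n F
    using dim_chain[of n "\<lambda>i. lift (F i)"] dim_le[of "lift (F n)"] that sub st by fastforce
  ultimately obtain F where "composition_series (D4_quotient M K) (D4_length (D4_quotient M K)) F"
    using Q.composition_series_exists Q.length_composition_series by metis
  then have F: "F 0 = {K}" "F (D4_length (D4_quotient M K)) = carrier (D4_quotient M K)"
    "\<And>i. i \<le> D4_length (D4_quotient M K) \<Longrightarrow> D4_submodule (F i) (D4_quotient M K)"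
    "\<And>i. i < D4_length (D4_quotient M K) \<Longrightarrow> Q.step (F i) (F (Suc i))"
    unfolding Q.composition_series_iff by (auto simp: Q)
  have "fs.dim (\<phi> ` lift (F (D4_length (D4_quotient M K)))) = fs.dim (\<phi> ` lift (F 0)) + D4_length (D4_quotient M K)"
    using F(3,4) sub st by (intro dim_chain) auto
  then show ?thesis using F(1,2) lift0 liftQ dim_socle by (simp add: socle_eq K_def)
qed

end

lemma socle_series_Suc:
  assumes "D4_submodule (socle_series M i) M"
  shows "socle_series M (Suc i) =
    {x \<in> carrier M. act M gen_a x \<in> socle_series M i \<and> act M gen_d x \<in> socle_series M i}"
proof -
  interpret Q: exterior_module "D4_quotient M (socle_series M i)" by (rule exterior_quotient[OF assms])
  have "socle_series M i +> x \<in> D4_socle (D4_quotient M (socle_series M i)) \<longleftrightarrow>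
      act M gen_a x \<in> socle_series M i \<and> act M gen_d x \<in> socle_series M i" if x: "x \<in> carrier M" for x
    unfolding Q.socle_eq Q.annihilated_def quotient_simps[OF assms] mem_Collect_eq
      quotient_simps(6)[OF assms x] coset_eq_self[OF assms act_closed[OF x]]
    using x by blast
  then show ?thesis by auto
qed

lemma pullback_submodule:
  assumes "D4_submodule N M"
  shows "D4_submodule {x \<in> carrier M. act M gen_a x \<in> N \<and> act M gen_d x \<in> N} M" (is "D4_submodule ?P M")
proof -
  note N = assms[unfolded D4_submodule_iff]
  have m1: "(- 1) \<odot> n \<in> N" if "n \<in> N" for n using N that by blast
  have "act M h (act M g x) \<in> N" if x: "x \<in> ?P" and h: "h = gen_a \<or> h = gen_d" for h g x
  proof (cases g)
    case gen_b
    have "act M gen_a (act M gen_b x) = (-1) \<odot> act M gen_b (act M gen_a x)"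
      "act M gen_d (act M gen_b x) = (-1) \<odot> act M gen_b (act M gen_d x)"
      using smult(9) ba bd x act_closed a_comm by (metis (no_types, lifting) mem_Collect_eq)+
    then show ?thesis using gen_b x N h m1 by auto
  next
    case gen_c
    have "act M gen_a (act M gen_b x) = (-1) \<odot> act M gen_b (act M gen_a x)"
      "act M gen_d (act M gen_b x) = (-1) \<odot> act M gen_b (act M gen_d x)"
      using smult(9) ba bd x act_closed a_comm by (metis (no_types, lifting) mem_Collect_eq)+
    then show ?thesis using gen_c x N h m1 act_c by auto
  qed (use x h N in auto)
  then show ?thesis unfolding D4_submodule_iff
    using N act_closed smult(1) by (auto simp: act_zero act_add act_smult)
qed

text \<open>The \<open>LEAST\<close> in \<open>Loewy_length\<close> is attained only if some term of
  the socle series is everything. The third term is, because any product of three factors a or d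
  vanishes; hence the second one really equals M.\<close>

lemma Loewy_two:
  assumes "Loewy_length M = 2" "x \<in> carrier M"
  shows "act M gen_a x \<in> D4_socle M \<and> act M gen_d x \<in> D4_socle M"
proof -
  have 0: "D4_submodule (socle_series M 0) M"
    by (auto simp: D4_submodule_iff act_zero smult)
  have s1: "socle_series M (Suc 0) = annihilated"
    using socle_series_Suc[OF 0] by (auto simp: annihilated_def)
  have 1: "D4_submodule (socle_series M (Suc 0)) M" unfolding s1 by (rule annihilated_submodule)
  note s2 = socle_series_Suc[OF 1]
  have 2: "D4_submodule (socle_series M (Suc (Suc 0))) M" unfolding s2 by (rule pullback_submodule[OF 1])
  have ann: "act M gen_d (act M gen_a x) \<in> annihilated" "act M gen_a (act M gen_d x) \<in> annihilated"
    if x: "x \<in> carrier M" for x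
    using x da[of x] da[of "act M gen_a x"] da[of "act M gen_d x"] aa dd act_closed act_zero
    by (auto simp: annihilated_def)
  have "socle_series M (Suc (Suc (Suc 0))) = carrier M"
    unfolding socle_series_Suc[OF 2] s2 s1
    using ann act_closed annihilated_submodule aa dd by (auto simp: D4_submodule_iff)
  then have "socle_series M 2 = carrier M"
    using LeastI[of "\<lambda>n. socle_series M n = carrier M"] assms(1) unfolding Loewy_length_def by metis
  then show ?thesis using assms(2) s1 s2 by (auto simp: numeral_2_eq_2 socle_eq)
qed

end

section \<open>Normal form of the modules of type (s,s)\<close>

text \<open>
  Here \<open>B\<close> is the action of \<open>b\<close> and \<open>K\<close> the socle.  As \<open>\<alpha>\<close> and \<open>\<delta>\<close> exchange the two eigenspaces of \<open>B\<close>,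
  the space \<open>S\<close> splits into the part generated by the top in one eigenspace and the part generated by
  the top in the other; by indecomposability and the presence of \<open>x0\<close>, the eigenspace of \<open>\<sigma>\<close> is
  exactly \<open>K\<close>, and \<open>(\<alpha>, \<delta>)\<close> is an indecomposable pencil from the other eigenspace to \<open>K\<close>.
\<close>

lemma (in lin_space) graded_normal_form:
  fixes S K :: "'b set" and B \<alpha> \<delta> :: "'b \<Rightarrow> 'b" and \<sigma> :: 'a
  defines "K \<equiv> {x \<in> S. \<alpha> x = 0 \<and> \<delta> x = 0}"
  assumes inf: "infinite (UNIV :: 'a set)" and two: "(2::'a) \<noteq> 0"
    and S: "subspace S" "fdim S"
    and lB: "endo B"
    and la: "endo \<alpha>"
    and ld: "endo \<delta>"
    and cB: "\<And>x. x \<in> S \<Longrightarrow> B x \<in> S"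
    and BB: "\<And>x. x \<in> S \<Longrightarrow> B (B x) = x"
    and Ba: "\<And>x. x \<in> S \<Longrightarrow> B (\<alpha> x) = - \<alpha> (B x)"
    and Bd: "\<And>x. x \<in> S \<Longrightarrow> B (\<delta> x) = - \<delta> (B x)"
    and aK: "\<And>x. x \<in> S \<Longrightarrow> \<alpha> x \<in> K" and dK: "\<And>x. x \<in> S \<Longrightarrow> \<delta> x \<in> K"
    and dim: "dim S = 2 * dim K"
    and indec: "\<And>S1 S2. subspace S1 \<Longrightarrow> subspace S2 \<Longrightarrow> S1 \<subseteq> S \<Longrightarrow> S2 \<subseteq> S \<Longrightarrow>
      (\<And>x. x \<in> S1 \<Longrightarrow> \<alpha> x \<in> S1 \<and> \<delta> x \<in> S1 \<and> B x \<in> S1) \<Longrightarrow>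
      (\<And>x. x \<in> S2 \<Longrightarrow> \<alpha> x \<in> S2 \<and> \<delta> x \<in> S2 \<and> B x \<in> S2) \<Longrightarrow>
      S1 \<inter> S2 \<subseteq> {0} \<Longrightarrow> (\<And>x. x \<in> S \<Longrightarrow> \<exists>u\<in>S1. x - u \<in> S2) \<Longrightarrow> S1 \<subseteq> {0} \<or> S2 \<subseteq> {0}"
    and \<sigma>: "\<sigma> * \<sigma> = 1"
    and x0: "x0 \<in> S" "\<delta> x0 = 0" "\<alpha> x0 \<noteq> 0" "B x0 = - \<sigma> *s x0"
  obtains x where "\<And>i. i < dim K \<Longrightarrow> x i \<in> S" "\<And>i. i < dim K \<Longrightarrow> B (x i) = - \<sigma> *s x i"
    "\<delta> (x 0) = 0" "\<And>i. Suc i < dim K \<Longrightarrow> \<delta> (x (Suc i)) = \<alpha> (x i)"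
    "\<And>c c' i. (\<Sum>i<dim K. c i *s x i) + (\<Sum>i<dim K. c' i *s \<alpha> (x i)) = 0 \<Longrightarrow> i < dim K \<Longrightarrow> c i = 0 \<and> c' i = 0"
    "\<And>y. y \<in> S \<Longrightarrow> \<exists>c c'. y = (\<Sum>i<dim K. c i *s x i) + (\<Sum>i<dim K. c' i *s \<alpha> (x i))"
proof -
  interpret p: vector_space_pair scale scale by (rule pair_self)
  interpret B: Vector_Spaces.linear scale scale B by (rule lB)
  interpret \<alpha>: Vector_Spaces.linear scale scale \<alpha> by (rule la)
  interpret \<delta>: Vector_Spaces.linear scale scale \<delta> by (rule ld)
  have KS: "K \<subseteq> S" by (auto simp: K_def)
  have sK: "subspace K" using S(1) unfolding K_def subspace_def
    by (auto simp: \<alpha>.add \<alpha>.scale \<alpha>.zero \<delta>.add \<delta>.scale \<delta>.zero)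
  define E where "E p = {x \<in> S. B x = p *s x}" for p
  have sE: "subspace (E p)" for p using S(1) unfolding E_def subspace_def
    by (auto simp: B.add B.scale B.zero algebra_simps)
  have \<sigma>0: "\<sigma> \<noteq> 0" using \<sigma> by auto
  have Edisj: "x = 0" if "x \<in> E \<sigma>" "x \<in> E (-\<sigma>)" for x
  proof -
    have "\<sigma> *s x = - (\<sigma> *s x)" using that by (auto simp: E_def)
    then have "\<sigma> *s x + \<sigma> *s x = 0" using eq_neg_iff_add_eq_0 by blast
    moreover have "(2 * \<sigma>) *s x = \<sigma> *s x + \<sigma> *s x" by (simp only: mult_2 scale_left_distrib)
    ultimately have "(2 * \<sigma>) *s x = 0" by simp
    then show ?thesis using two \<sigma>0 by simp
  qed
  define part where "part p x = inverse 2 *s (x + p *s B x)" for p x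
  have part: "part p x \<in> E p" if "x \<in> S" "p * p = 1" for p x
  proof -
    have "x + p *s B x \<in> S" using that S(1) cB by (simp add: subspace_add subspace_scale)
    moreover have "B (x + p *s B x) = p *s (x + p *s B x)"
      using that BB by (simp add: B.add B.scale algebra_simps)
    ultimately show ?thesis using S(1) by (simp add: E_def part_def subspace_scale B.scale mult.commute)
  qed
  have part_sum: "part \<sigma> x + part (-\<sigma>) x = x" for x
  proof -
    have "part \<sigma> x + part (-\<sigma>) x = inverse 2 *s ((1 + 1) *s x)"
      unfolding part_def scale_right_distrib[symmetric] scale_left_distrib by (simp add: algebra_simps)
    then show ?thesis using two by simp
  qed
  have aE: "\<alpha> x \<in> E (-p)" and dE: "\<delta> x \<in> E (-p)" if "x \<in> E p" for x p
    using that Ba[of x] Bd[of x] aK[of x] dK[of x] KS by (auto simp: E_def \<alpha>.scale \<delta>.scale)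
  have BE: "B x = p *s x" if "x \<in> E p" for x p using that by (simp add: E_def)
  define Kp where "Kp p = K \<inter> E p" for p
  have sKp: "subspace (Kp p)" for p unfolding Kp_def by (intro subspace_inter sK sE)
  have "\<forall>p. \<exists>q. endo q \<and> (\<forall>u\<in>Kp p. q u = u) \<and> (\<forall>x. q x \<in> Kp p)"
  proof
    fix p show "\<exists>q. endo q \<and> (\<forall>u\<in>Kp p. q u = u) \<and> (\<forall>x. q x \<in> Kp p)"
      using projection_exists[OF sKp[of p] subspace_single_0 Int_lower2] by metis
  qed
  from choice[OF this] obtain q where q: "\<And>p. Vector_Spaces.linear scale scale (q p)" "\<And>p u. u \<in> Kp p \<Longrightarrow> q p u = u"
      "\<And>p x. q p x \<in> Kp p"
    by metis
  \<comment> \<open>A complement of the socle part in the eigenspace of p, that is, the top with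
    eigenvalue p.\<close>
  define C where "C p = {x \<in> E p. q p x = 0}" for p
  have sC: "subspace (C p)" for p using sE[of p] unfolding C_def subspace_def
    by (auto simp: p.linear_add[OF q(1)] p.linear_scale[OF q(1)] p.linear_0[OF q(1)])
  have Cq: "x - q p x \<in> C p" if "x \<in> E p" for x p
    using that subspace_diff[OF sE] q(2)[OF q(3)] q(3) by (simp add: C_def Kp_def p.linear_diff[OF q(1)])
  have CK: "x = 0" if "x \<in> C p" "x \<in> Kp p" for x p using that q(2) by (simp add: C_def)
  \<comment> \<open>Stable under \<alpha> and \<delta>, which carry the top with eigenvalue p into
    the socle with eigenvalue -p.\<close>
  define T where "T p = {x + y | x y. x \<in> C p \<and> y \<in> Kp (-p)}" for p
  have TI: "x + y \<in> T p" if "x \<in> C p" "y \<in> Kp (-p)" for x y p using that unfolding T_def by blast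
  have sT: "subspace (T p)" for p unfolding T_def by (rule subspace_sums[OF sC sKp])
  have TS: "T p \<subseteq> S" for p using S(1) by (auto simp: T_def C_def Kp_def E_def subspace_add)
  have Tcl: "\<alpha> x \<in> T p \<and> \<delta> x \<in> T p \<and> B x \<in> T p" if "x \<in> T p" for x p
  proof -
    from \<open>x \<in> T p\<close> obtain c k where x: "x = c + k" "c \<in> C p" "k \<in> Kp (-p)" unfolding T_def by blast
    have cE: "c \<in> E p" using x by (simp add: C_def)
    have k: "\<alpha> k = 0" "\<delta> k = 0" using x by (auto simp: Kp_def K_def)
    have "\<alpha> c \<in> Kp (-p)" "\<delta> c \<in> Kp (-p)" using aE[OF cE] dE[OF cE] aK dK cE by (auto simp: Kp_def E_def)
    then have "\<alpha> x \<in> T p" "\<delta> x \<in> T p"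
      using TI[of 0 p] subspace_0[OF sC] k by (simp_all add: x(1) \<alpha>.add \<delta>.add)
    moreover have "B x = p *s c + (-p) *s k" using BE[OF cE] x(3) BE[of k "-p"] by (simp add: x(1) B.add Kp_def)
    then have "B x \<in> T p" using TI[OF subspace_scale[OF sC x(2), of p] subspace_scale[OF sKp x(3), of "-p"]] by simp
    ultimately show ?thesis by blast
  qed
  have Tdisj: "T (-\<sigma>) \<inter> T \<sigma> \<subseteq> {0}"
  proof
    fix z assume "z \<in> T (-\<sigma>) \<inter> T \<sigma>"
    then obtain c k c' k' where z: "z = c + k" "z = c' + k'" "c \<in> C (-\<sigma>)" "k \<in> Kp \<sigma>" "c' \<in> C \<sigma>" "k' \<in> Kp (-\<sigma>)"
      unfolding T_def minus_minus by blast
    have "c - k' = c' - k" using z(1,2) by (simp add: algebra_simps)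
    moreover have "c - k' \<in> E (-\<sigma>)" "c' - k \<in> E \<sigma>"
      using z(3-6) by (auto simp: C_def Kp_def intro!: subspace_diff[OF sE])
    ultimately have "c - k' = 0" "c' - k = 0" using Edisj by metis+
    then have "c = 0" "c' = 0" using CK[of c "-\<sigma>"] CK[of c' \<sigma>] z by auto
    then show "z \<in> {0}" using z \<open>c' - k = 0\<close> by simp
  qed
  have Tsum: "\<exists>u\<in>T (-\<sigma>). x - u \<in> T \<sigma>" if x: "x \<in> S" for x
  proof
    let ?a = "part \<sigma> x" and ?b = "part (-\<sigma>) x"
    have a: "?a \<in> E \<sigma>" and b: "?b \<in> E (-\<sigma>)" using part[OF x] \<sigma> by auto
    let ?u = "(?b - q (-\<sigma>) ?b) + q \<sigma> ?a"
    show "?u \<in> T (-\<sigma>)" using TI[OF Cq[OF b]] q(3) by simp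
    have "x - ?u = (?a + ?b) - ?u" using part_sum[of x] by simp
    also have "\<dots> = (?a - q \<sigma> ?a) + q (-\<sigma>) ?b" by simp
    finally have e: "x - ?u = (?a - q \<sigma> ?a) + q (-\<sigma>) ?b" .
    show "x - ?u \<in> T \<sigma>" unfolding e by (rule TI[OF Cq[OF a] q(3)])
  qed
  have x0E: "x0 \<in> E (-\<sigma>)" using x0 by (simp add: E_def)
  \<comment> \<open>The nonzero vector \<alpha> x0 lies in \<open>T (-\<sigma>)\<close>, so by
    indecomposability the other summand vanishes.\<close>
  have "\<alpha> x0 \<in> Kp \<sigma>" using aE[OF x0E] aK[OF x0(1)] by (simp add: Kp_def)
  then have "\<alpha> x0 \<in> T (-\<sigma>)" using TI[OF subspace_0[OF sC], of "\<alpha> x0" "-\<sigma>"] by simp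
  then have "T \<sigma> \<subseteq> {0}"
    using indec[OF sT sT TS TS Tcl Tcl Tdisj Tsum] x0(3) by auto
  then have K0: "Kp (-\<sigma>) \<subseteq> {0}" and C0: "C \<sigma> \<subseteq> {0}"
    using TI[OF subspace_0[OF sC], of _ \<sigma>] TI[OF _ subspace_0[OF sKp], of _ \<sigma>] by force+
  have EK: "E \<sigma> = K"
  proof
    show "E \<sigma> \<subseteq> K"
    proof
      fix x assume "x \<in> E \<sigma>"
      then have "x = q \<sigma> x" using Cq C0 by fastforce
      then show "x \<in> K" using q(3)[of \<sigma> x] by (simp add: Kp_def)
    qed
    show "K \<subseteq> E \<sigma>"
    proof
      fix x assume x: "x \<in> K"
      then have xS: "x \<in> S" using KS by blast
      have "B x \<in> K" using x cB[OF xS] Ba[OF xS] Bd[OF xS] B.zero by (simp add: K_def)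
      then have "part (-\<sigma>) x \<in> K" unfolding part_def
        using x sK by (simp add: subspace_add subspace_diff subspace_scale)
      then have "part (-\<sigma>) x = 0" using part[OF xS, of "-\<sigma>"] \<sigma> K0 by (auto simp: Kp_def)
      then show "x \<in> E \<sigma>" using part_sum[of x] part[OF xS \<sigma>] by simp
    qed
  qed
  define V where "V = E (-\<sigma>)"
  have sV: "subspace V" unfolding V_def by (rule sE)
  have VS: "V \<subseteq> S" by (auto simp: V_def E_def)
  have VK: "V \<inter> K \<subseteq> {0}" using Edisj by (auto simp: V_def EK[symmetric])
  have VKsum: "\<exists>v\<in>V. x - v \<in> K" if "x \<in> S" for x
  proof
    show "part (-\<sigma>) x \<in> V" using part[OF that, of "-\<sigma>"] \<sigma> by (simp add: V_def)
    show "x - part (-\<sigma>) x \<in> K" using part[OF that \<sigma>] part_sum[of x] by (metis EK add_diff_cancel_right')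
  qed
  have "dim S = dim V + dim K"
    using dim_direct_sum[OF sV fdim_subset[OF S(2) VS] sK fdim_subset[OF S(2) KS] VK] VKsum S(1) VS KS
    by (meson subspace_add subsetD)
  then have dimV: "dim V = dim K" using dim by simp
  have \<alpha>V: "\<alpha> v \<in> K" and \<delta>V: "\<delta> v \<in> K" if "v \<in> V" for v using that VS aK dK by auto
  interpret P: pencil scale V K \<alpha> \<delta>
  proof
    show "infinite (UNIV :: 'a set)" by (rule inf)
    show "fdim V" "fdim K" using fdim_subset[OF S(2)] VS KS by auto
    show "v = 0" if "v \<in> V" "\<alpha> v = 0" "\<delta> v = 0" for v using that VK VS by (auto simp: K_def)
    fix V1 V2 W1 W2
    assume s: "subspace V1" "subspace V2" "subspace W1" "subspace W2"
      and sub: "V1 \<subseteq> V" "V2 \<subseteq> V" "W1 \<subseteq> K" "W2 \<subseteq> K"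
      and c1: "\<And>v. v \<in> V1 \<Longrightarrow> \<alpha> v \<in> W1 \<and> \<delta> v \<in> W1" and c2: "\<And>v. v \<in> V2 \<Longrightarrow> \<alpha> v \<in> W2 \<and> \<delta> v \<in> W2"
      and disj: "V1 \<inter> V2 \<subseteq> {0}" "W1 \<inter> W2 \<subseteq> {0}"
      and sumV: "\<And>v. v \<in> V \<Longrightarrow> \<exists>u\<in>V1. v - u \<in> V2" and sumW: "\<And>w. w \<in> K \<Longrightarrow> \<exists>u\<in>W1. w - u \<in> W2"
    \<comment> \<open>A splitting of the pencil yields the splitting of S into V1 + W1 and V2 + W2,
      to which \<open>indec\<close> applies.\<close>
    define sm where "sm A A' = {x + y | x y. x \<in> A \<and> y \<in> A'}" for A A' :: "'b set"
    have smI: "x + y \<in> sm A A'" if "x \<in> A" "y \<in> A'" for x y A A' using that unfolding sm_def by blast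
    have smE: "\<exists>x\<in>A. \<exists>y\<in>A'. z = x + y" if "z \<in> sm A A'" for z A A' using that unfolding sm_def by blast
    have sub0: "A \<subseteq> sm A A'" "A' \<subseteq> sm A A'" if "subspace A" "subspace A'" for A A'
    proof -
      show "A \<subseteq> sm A A'" using smI[OF _ subspace_0[OF that(2)], of _ A] by auto
      show "A' \<subseteq> sm A A'" using smI[OF subspace_0[OF that(1)], of _ A'] by auto
    qed
    let ?S1 = "sm V1 W1" and ?S2 = "sm V2 W2"
    have cl: "\<alpha> x \<in> sm V' W' \<and> \<delta> x \<in> sm V' W' \<and>
        B x \<in> sm V' W'"
      if sp: "subspace V'" "subspace W'" "V' \<subseteq> V" "W' \<subseteq> K" and c: "\<And>v. v \<in> V' \<Longrightarrow> \<alpha> v \<in> W' \<and> \<delta> v \<in> W'"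
        and x: "x \<in> sm V' W'" for x V' W'
    proof -
      obtain v w where vw: "x = v + w" "v \<in> V'" "w \<in> W'" using smE[OF x] by blast
      have "w \<in> K" using vw sp by blast
      then have "\<alpha> w = 0" "\<delta> w = 0" "B w = \<sigma> *s w" using EK by (auto simp: K_def E_def)
      then have "\<alpha> x = \<alpha> v" "\<delta> x = \<delta> v" "B x = (-\<sigma>) *s v + \<sigma> *s w"
        using vw sp(3) BE[of v "-\<sigma>"] by (auto simp: \<alpha>.add \<delta>.add B.add V_def)
      moreover have "(-\<sigma>) *s v \<in> V'" "\<sigma> *s w \<in> W'" using subspace_scale sp vw by blast+
      ultimately show ?thesis using c[OF vw(2)] sub0(2)[OF sp(1,2)] smI by (metis subsetD)
    qed
    have "?S1 \<inter> ?S2 \<subseteq> {0}"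
    proof
      fix z assume "z \<in> ?S1 \<inter> ?S2"
      then obtain v w v' w' where z: "z = v + w" "z = v' + w'" "v \<in> V1" "w \<in> W1" "v' \<in> V2" "w' \<in> W2"
        using smE[of z V1 W1] smE[of z V2 W2] by blast
      have "v - v' = w' - w" using z(1,2) by (simp add: algebra_simps)
      moreover have "v - v' \<in> V" "w' - w \<in> K" using z sub subspace_diff[OF sV] subspace_diff[OF sK] by blast+
      ultimately have "v - v' = 0" "w' - w = 0" using VK by auto
      then have "v = 0" "w = 0" using z(3-6) disj by auto
      then show "z \<in> {0}" using z(1) by simp
    qed
    moreover have "\<exists>u\<in>?S1. x - u \<in> ?S2" if x: "x \<in> S" for x
    proof -
      obtain v where v: "v \<in> V" "x - v \<in> K" using VKsum[OF x] by blast
      obtain u where u: "u \<in> V1" "v - u \<in> V2" using sumV[OF v(1)] by blast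
      obtain w where w: "w \<in> W1" "(x - v) - w \<in> W2" using sumW[OF v(2)] by blast
      have "x - (u + w) = (v - u) + ((x - v) - w)" by simp
      then have "x - (u + w) \<in> ?S2" using smI[OF u(2) w(2)] by (simp only:)
      then show ?thesis using smI[OF u(1) w(1)] by blast
    qed
    ultimately have "?S1 \<subseteq> {0} \<or> ?S2 \<subseteq> {0}"
    proof (intro indec)
      show "subspace ?S1" "subspace ?S2" unfolding sm_def by (intro subspace_sums s)+
      have "x + y \<in> S" if "x \<in> V" "y \<in> K" for x y using that VS KS subspace_add[OF S(1)] by blast
      then show "?S1 \<subseteq> S" "?S2 \<subseteq> S" using sub unfolding sm_def by blast+
    qed (use cl[OF s(1,3) sub(1,3) c1] cl[OF s(2,4) sub(2,4) c2] in blast)+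
    then show "(V1 \<subseteq> {0} \<and> W1 \<subseteq> {0}) \<or> (V2 \<subseteq> {0} \<and> W2 \<subseteq> {0})"
      using sub0[OF s(1,3)] sub0[OF s(2,4)] by blast
  qed (use sV sK dimV \<alpha>V \<delta>V la ld in auto)
  have "x0 \<in> V" "x0 \<noteq> 0" using x0E x0(3) \<alpha>.zero by (auto simp: V_def)
  then obtain x where x: "inj_on x {..<dim V}" "independent (x ` {..<dim V})" "span (x ` {..<dim V}) = V"
    "\<delta> (x 0) = 0" "\<And>i. Suc i < dim V \<Longrightarrow> \<delta> (x (Suc i)) = \<alpha> (x i)" "inj_on \<alpha> V" "\<alpha> ` V = K"
    using P.jordan_chain x0(2) by metis
  have xV: "x i \<in> V" if "i < dim K" for i
  proof -
    have "x i \<in> span (x ` {..<dim V})" using that dimV by (intro span_base) auto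
    then show ?thesis using x(3) by simp
  qed
  have sumV: "(\<Sum>i<dim K. c i *s x i) \<in> V" for c
    by (intro subspace_sum[OF sV] subspace_scale[OF sV] xV) auto
  have sum\<alpha>: "(\<Sum>i<dim K. c i *s \<alpha> (x i)) = \<alpha> (\<Sum>i<dim K. c i *s x i)" for c
    by (simp add: \<alpha>.sum \<alpha>.scale)
  have ind: "c i = 0" if c: "(\<Sum>i<dim K. c i *s x i) = 0" and i: "i < dim K" for c i
  proof -
    let ?f = "\<lambda>v. c (the_inv_into {..<dim V} x v)"
    have "(\<Sum>v\<in>x ` {..<dim V}. ?f v *s v) = (\<Sum>i<dim V. c i *s x i)"
      by (simp add: sum.reindex[OF x(1)] the_inv_into_f_f[OF x(1)])
    then have "?f (x i) = 0" using independentD[OF x(2) _ order_refl, of ?f "x i"] c i dimV by auto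
    then show ?thesis using the_inv_into_f_f[OF x(1), of i] i dimV by simp
  qed
  have spV: "\<exists>c. v = (\<Sum>i<dim K. c i *s x i)" if "v \<in> V" for v
  proof -
    from \<open>v \<in> V\<close> obtain u where "v = (\<Sum>v\<in>x ` {..<dim V}. u v *s v)"
      using span_finite[of "x ` {..<dim V}"] unfolding x(3) by auto
    then show ?thesis using sum.reindex[OF x(1), of "\<lambda>v. u v *s v"] dimV by auto
  qed
  show ?thesis
  proof (rule that[of x])
    show "x i \<in> S" "B (x i) = - \<sigma> *s x i" if "i < dim K" for i
      using xV[OF that] VS BE[of "x i" "-\<sigma>"] by (auto simp: V_def)
    show "\<delta> (x 0) = 0" by (rule x(4))
    show "\<delta> (x (Suc i)) = \<alpha> (x i)" if "Suc i < dim K" for i using x(5) that dimV by simp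
    show "c i = 0 \<and> c' i = 0"
      if c: "(\<Sum>i<dim K. c i *s x i) + (\<Sum>i<dim K. c' i *s \<alpha> (x i)) = 0" and i: "i < dim K" for c c' i
    proof -
      let ?v = "\<Sum>i<dim K. c i *s x i" and ?v' = "\<Sum>i<dim K. c' i *s x i"
      have e: "?v + \<alpha> ?v' = 0" using c by (simp only: sum\<alpha>)
      have "?v = - \<alpha> ?v'" using e by (rule eq_neg_iff_add_eq_0[THEN iffD2])
      then have "?v \<in> K" using subspace_neg[OF sK \<alpha>V[OF sumV]] by simp
      then have v: "?v = 0" using VK sumV by blast
      then have "\<alpha> ?v' = \<alpha> 0" using e \<alpha>.zero by simp
      then have "?v' = 0" using x(6) sumV subspace_0[OF sV] by (meson inj_onD)
      then show ?thesis using ind v i by blast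
    qed
    show "\<exists>c c'. y = (\<Sum>i<dim K. c i *s x i) + (\<Sum>i<dim K. c' i *s \<alpha> (x i))" if y: "y \<in> S" for y
    proof -
      obtain v where v: "v \<in> V" "y - v \<in> K" using VKsum[OF y] by blast
      obtain c where c: "v = (\<Sum>i<dim K. c i *s x i)" using spV[OF v(1)] by blast
      obtain v' where v': "v' \<in> V" "y - v = \<alpha> v'" using v(2) x(7) by blast
      obtain c' where "v' = (\<Sum>i<dim K. c' i *s x i)" using spV[OF v'(1)] by blast
      then have "y = v + \<alpha> (\<Sum>i<dim K. c' i *s x i)" using v'(2) by (simp add: algebra_simps)
      then show ?thesis using c sum\<alpha> by metis
    qed
  qed
qed

section \<open>The ground field, and the splitting of a module by bc\<close>

lemma infinite_alg_closed_field: "infinite (UNIV :: 'k::alg_closed_field set)"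
proof
  assume fin: "finite (UNIV :: 'k set)"
  \<comment> \<open>p vanishes at every element of a finite field, so p + 1, a polynomial of
    positive degree, would have no root.\<close>
  define p where "p = (\<Prod>a\<in>(UNIV :: 'k set). [:- a, 1:])"
  have "degree p = card (UNIV :: 'k set)"
    unfolding p_def by (subst degree_prod_eq_sum_degree) auto
  then have "degree (p + 1) > 0"
    using fin degree_add_eq_left[of 1 p] by (simp add: finite_UNIV_card_ge_0)
  then obtain x where "poly (p + 1) x = 0" using alg_closed_imp_poly_has_root by blast
  moreover have "poly p x = 0" unfolding p_def poly_prod using fin by (intro prod_zero) auto
  ultimately show False by simp
qed

lemma two_neq_zero: "CHAR('k::field) \<noteq> 2 \<Longrightarrow> (2::'k) \<noteq> 0"
proof
  assume "CHAR('k) \<noteq> 2" "(2::'k) = 0"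
  then have "of_nat 2 = (0::'k)" by simp
  then have "CHAR('k) dvd 2" by (rule of_nat_eq_0_iff_char_dvd[THEN iffD1])
  then have "CHAR('k) = 1 \<or> CHAR('k) = 2" by (metis dvd_refl prime_nat_iff two_is_prime_nat)
  then show False using \<open>CHAR('k) \<noteq> 2\<close> CHAR_not_1' by auto
qed

lemma sgn2_square [simp]: "sgn2 r * sgn2 r = (1 :: 'k::field)" "sgn2 r \<noteq> (0 :: 'k)"
  by (auto simp: sgn2_def)

lemma sgn2_add: "sgn2 (r + r') = sgn2 r * (sgn2 r' :: 'k::field)"
  by (cases r; cases r') (simp_all add: sgn2_def)

context D4_module
begin

lemmas smult = vs_smult[OF vectorspace_axioms]

lemma act_closed: "x \<in> carrier M \<Longrightarrow> act M g x \<in> carrier M"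
  using module_hom_closed[OF act_linear[of g]] by blast

lemma act_add: "x \<in> carrier M \<Longrightarrow> y \<in> carrier M \<Longrightarrow> act M g (x \<oplus> y) = act M g x \<oplus> act M g y"
  by (rule LinearCombinations.module_hom_add[OF act_linear])

lemma act_smult: "x \<in> carrier M \<Longrightarrow> act M g (k \<odot> x) = k \<odot> act M g x"
  by (rule LinearCombinations.module_hom_smult[OF act_linear]) simp_all

lemma minus_eq: "x \<in> carrier M \<Longrightarrow> \<ominus> x = (-1) \<odot> x"
  using smult(8)[of x 1] smult(5)[of x] by simp

text \<open>Both b and c anticommute with a and d, so the two signs cancel.\<close>

lemma bc_central:
  assumes x: "x \<in> carrier M"
  shows "act M gen_b (act M gen_c (act M g x)) = act M g (act M gen_b (act M gen_c x))"
proof -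
  note c = act_closed
  have bd: "act M gen_b (act M gen_d y) = (-1) \<odot> act M gen_d (act M gen_b y)"
    and cd: "act M gen_c (act M gen_d y) = (-1) \<odot> act M gen_d (act M gen_c y)" if "y \<in> carrier M" for y
    using rel_db[OF that] rel_dc[OF that] c that by (simp_all add: minus_eq flip: smult(4)) (simp_all add: smult(5) c)
  have ba: "act M gen_b (act M gen_a y) = (-1) \<odot> act M gen_a (act M gen_b y)"
    and ca: "act M gen_c (act M gen_a y) = (-1) \<odot> act M gen_a (act M gen_c y)" if "y \<in> carrier M" for y
    using rel_ba[OF that] rel_ca[OF that] c that by (simp_all add: minus_eq)
  show ?thesis
  proof (cases g)
    case gen_a
    then show ?thesis using x c ba ca by (simp add: act_smult flip: smult(4)) (simp add: smult(5) c)
  next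
    case gen_b
    then show ?thesis using x c rel_bc by simp
  next
    case gen_c
    then show ?thesis using x c rel_bc by simp
  next
    case gen_d
    then show ?thesis using x c bd cd by (simp add: act_smult flip: smult(4)) (simp add: smult(5) c)
  qed
qed

text \<open>The central involution bc splits the module into its eigenspaces for 1 and -1.
  Indecomposability leaves one of them, and y shows which. From bc = 1 and b^2 = 1 follows c = b,
  and then d a + a d = 1 - bc = 0.\<close>

lemma exterior_of_indecomposable:
  assumes two: "(2::'k) \<noteq> 0" and ind: "D4_indecomposable M"
    and y: "y \<in> carrier M" "y \<noteq> \<zero>" "act M gen_b (act M gen_c y) = y"
  shows "exterior_module M"
proof -
  define z where "z x = act M gen_b (act M gen_c x)" for x
  define E where "E e = {x \<in> carrier M. z x = e \<odot> x}" for e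
  have zc: "z x \<in> carrier M" if "x \<in> carrier M" for x using that act_closed by (simp add: z_def)
  have zz: "z (z x) = x" if "x \<in> carrier M" for x
    using that act_closed by (simp add: z_def rel_bc rel_bb rel_cc)
  have zadd: "z (x \<oplus> y) = z x \<oplus> z y" if "x \<in> carrier M" "y \<in> carrier M" for x y
    using that act_closed by (simp add: z_def act_add)
  have zsm: "z (k \<odot> x) = k \<odot> z x" if "x \<in> carrier M" for x k
    using that act_closed by (simp add: z_def act_smult)
  have zero: "act M g \<zero> = \<zero>" for g using act_smult[of \<zero> g 0] smult(6)[of \<zero>] smult(6)[OF act_closed[of \<zero> g]] by simp
  have sub: "D4_submodule (E e) M" for e
    unfolding D4_submodule_iff[OF vectorspace_axioms]
  proof (intro conjI ballI allI)
    show "E e \<subseteq> carrier M" by (auto simp: E_def)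
    show "\<zero> \<in> E e" using zero smult(7) by (simp add: E_def z_def)
    fix x assume x: "x \<in> E e"
    show "x \<oplus> y \<in> E e" if "y \<in> E e" for y using x that by (simp add: E_def zadd smult)
    show "k \<odot> x \<in> E e" for k
      using x by (simp add: E_def zsm smult(1) mult.commute flip: smult(4))
    show "act M g x \<in> E e" for g
      using x bc_central[of x g] act_closed by (simp add: E_def z_def act_smult)
  qed
  have p: "x \<oplus> e \<odot> z x \<in> E e" if "x \<in> carrier M" "e * e = 1" for x e
  proof -
    have "z (x \<oplus> e \<odot> z x) = e \<odot> (x \<oplus> e \<odot> z x)"
      using that zc by (simp add: zadd zsm zz smult(1,3,5) a_comm flip: smult(4))
    then show ?thesis using that zc smult(1) by (simp add: E_def)
  qed
  have half: "inverse 2 \<odot> (x \<oplus> 1 \<odot> z x) \<oplus> inverse 2 \<odot> (x \<oplus> (-1) \<odot> z x) = x" if x: "x \<in> carrier M" for x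
  proof -
    have "(x \<oplus> 1 \<odot> z x) \<oplus> (x \<oplus> (-1) \<odot> z x) = (x \<oplus> x) \<oplus> (z x \<oplus> \<ominus> z x)"
      using x zc by (simp add: smult a_ac)
    also have "\<dots> = 2 \<odot> x" using x zc smult(2)[OF x, of 1 1] by (simp add: r_neg smult(5))
    finally show ?thesis
      using x zc two by (simp add: smult(1) flip: smult(3)) (simp add: smult(5) flip: smult(4))
  qed
  have "E 1 \<inter> E (-1) = {\<zero>}"
  proof
    show "E 1 \<inter> E (-1) \<subseteq> {\<zero>}"
    proof
      fix x assume "x \<in> E 1 \<inter> E (-1)"
      then have x: "x \<in> carrier M" "x = (-1) \<odot> x" by (auto simp: E_def smult(5))
      then have "2 \<odot> x = x \<oplus> (-1) \<odot> x" using smult(2)[of x 1 1] smult(5)[of x] by simp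
      also have "\<dots> = \<zero>" using x(1) smult(2)[of x 1 "-1"] smult(5,6)[of x] by simp
      finally have "inverse 2 \<odot> (2 \<odot> x) = \<zero>" using smult(7) by simp
      then show "x \<in> {\<zero>}" using x(1) two by (simp add: smult(5) flip: smult(4))
    qed
    show "{\<zero>} \<subseteq> E 1 \<inter> E (-1)" using sub by (auto simp: D4_submodule_iff[OF vectorspace_axioms])
  qed
  moreover have "set_add M (E 1) (E (-1)) = carrier M"
  proof (intro subset_antisym subsetI)
    fix x assume x: "x \<in> carrier M"
    have "inverse 2 \<odot> (x \<oplus> 1 \<odot> z x) \<in> E 1" "inverse 2 \<odot> (x \<oplus> (-1) \<odot> z x) \<in> E (-1)"
      using p[OF x] sub by (auto simp: D4_submodule_iff[OF vectorspace_axioms])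
    then have "inverse 2 \<odot> (x \<oplus> 1 \<odot> z x) \<oplus> inverse 2 \<odot> (x \<oplus> (-1) \<odot> z x) \<in> set_add M (E 1) (E (-1))"
      unfolding set_add_def' by blast
    then show "x \<in> set_add M (E 1) (E (-1))" using half[OF x] by simp
  qed (auto simp: set_add_def' E_def)
  ultimately have "E 1 = {\<zero>} \<or> E (-1) = {\<zero>}"
    using ind sub unfolding D4_indecomposable_def by blast
  moreover have "y \<in> E 1" using y by (simp add: E_def z_def smult(5))
  ultimately have E: "E (-1) = {\<zero>}" using y(2) by blast
  have z: "z x = x" if x: "x \<in> carrier M" for x
  proof -
    have "x \<oplus> (-1) \<odot> z x \<in> E (-1)" by (rule p[OF x]) simp
    then have "x \<oplus> (-1) \<odot> z x = \<zero>" unfolding E by blast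
    then have "x = (-1) \<odot> ((-1) \<odot> z x)" using smult(9)[OF x] smult(1)[OF zc[OF x]] by blast
    then show ?thesis using zc[OF x] by (simp add: smult(5) flip: smult(4))
  qed
  show ?thesis
  proof
    fix x assume x: "x \<in> carrier M"
    show "act M gen_c x = act M gen_b x"
      using z[OF x] rel_bb[of "act M gen_c x"] x act_closed by (simp add: z_def)
    show "act M gen_b (act M gen_a x) \<oplus> act M gen_a (act M gen_b x) = \<zero>"
      using x act_closed by (simp add: rel_ba l_neg)
    show "act M gen_b (act M gen_d x) \<oplus> act M gen_d (act M gen_b x) = \<zero>"
      using x act_closed by (simp add: rel_db r_neg)
    show "act M gen_d (act M gen_a x) \<oplus> act M gen_a (act M gen_d x) = \<zero>"
      using x z[OF x] by (simp add: rel_da z_def a_minus_def r_neg)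
  qed (simp_all add: two act_closed act_add act_smult rel_aa rel_bb rel_dd)
qed

end

section \<open>Linear operators in coordinates, and the normal form of M_s(r,\<eta>)\<close>

abbreviation fs_linear :: "(('x \<Rightarrow>\<^sub>0 'k::field) \<Rightarrow> ('y \<Rightarrow>\<^sub>0 'k)) \<Rightarrow> bool" where
  "fs_linear \<equiv> Vector_Spaces.linear fs_scale fs_scale"

lemma fs_extend_eq:
  assumes "finite J" "Poly_Mapping.keys f \<subseteq> J"
  shows "fs_extend h f = (\<Sum>p\<in>J. fs_scale (Poly_Mapping.lookup f p) (h p))"
  unfolding fs_extend_def using assms
  by (intro sum.mono_neutral_left) (auto simp: in_keys_iff)

lemma linear_fs_extend: "fs_linear (fs_extend h)"
proof -
  have "fs_extend h (f + g) = fs_extend h f + fs_extend h g" for f g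
    using keys_add[of f g]
    by (simp add: fs_extend_eq[of "Poly_Mapping.keys f \<union> Poly_Mapping.keys g"] lookup_add
        fs.scale_left_distrib sum.distrib)
  moreover have "fs_extend h (fs_scale k f) = fs_scale k (fs_extend h f)" for k f
  proof -
    have "Poly_Mapping.keys (fs_scale k f) \<subseteq> Poly_Mapping.keys f" by (auto simp: in_keys_iff)
    then show ?thesis by (simp add: fs_extend_eq[of "Poly_Mapping.keys f"] fs.scale_sum_right)
  qed
  ultimately show ?thesis
    by (simp add: Vector_Spaces.linear_iff fs.vector_space_axioms)
qed

interpretation fsp: vector_space_pair "fs_scale :: 'k::field \<Rightarrow> ('x \<Rightarrow>\<^sub>0 'k) \<Rightarrow> ('x \<Rightarrow>\<^sub>0 'k)"
    "fs_scale :: 'k \<Rightarrow> ('y \<Rightarrow>\<^sub>0 'k) \<Rightarrow> ('y \<Rightarrow>\<^sub>0 'k)"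
  by unfold_locales

lemma fs_extend_single [simp]: "fs_extend h (Poly_Mapping.single i k) = fs_scale k (h i)"
  by (simp add: fs_extend_eq[of "{i}"])

lemma linear_eq_on_supported:
  assumes "fs_linear F" "fs_linear G"
    and I: "finite I" "f \<in> supported I"
    and eq: "\<And>i. i \<in> I \<Longrightarrow> F (Poly_Mapping.single i 1) = G (Poly_Mapping.single i 1)"
  shows "F f = G f"
  by (subst (1 2) poly_mapping_decomp[OF I])
    (simp add: fsp.linear_sum assms fsp.linear_scale cong: sum.cong)

lemma linear_in_subspace_on_supported:
  assumes "fs_linear F" "fs.subspace U"
    and I: "finite I" "f \<in> supported I" and eq: "\<And>i. i \<in> I \<Longrightarrow> F (Poly_Mapping.single i 1) \<in> U"
  shows "F f \<in> U"
  by (subst poly_mapping_decomp[OF I])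
    (simp add: fsp.linear_sum assms fsp.linear_scale fs.subspace_sum fs.subspace_scale)

lemma linear_eqI:
  assumes "fs_linear F" "fs_linear G"
    and "\<And>i. F (Poly_Mapping.single i 1) = G (Poly_Mapping.single i 1)"
  shows "F f = G f"
  by (rule linear_eq_on_supported[OF assms(1,2), of "Poly_Mapping.keys f"]) (use assms(3) in \<open>auto simp: supported_def\<close>)

lemma linear_comp:
  assumes "fs_linear G" "fs_linear F"
  shows "fs_linear (\<lambda>x. F (G x))"
  using Vector_Spaces.linear_compose[OF assms] by (simp add: o_def)

abbreviation unit :: "'x \<Rightarrow> ('x \<Rightarrow>\<^sub>0 'k::field)" where
  "unit i \<equiv> Poly_Mapping.single i 1"

lemma unit_supported: "p \<in> I \<Longrightarrow> unit p \<in> supported I"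
  by (auto simp: supported_iff lookup_single when_def)

text \<open>Coordinates in which the generators act by prescribed operators; isomorphisms are later
  deduced from a common model.\<close>

definition model :: "('k::field, 'v) D4_mod \<Rightarrow> 'x set \<Rightarrow> (gen \<Rightarrow> ('x \<Rightarrow>\<^sub>0 'k) \<Rightarrow> ('x \<Rightarrow>\<^sub>0 'k)) \<Rightarrow>
    ('v \<Rightarrow> ('x \<Rightarrow>\<^sub>0 'k)) \<Rightarrow> bool" where
  "model M I T \<gamma> \<longleftrightarrow> coords M I \<gamma> \<and> (\<forall>g. \<forall>x\<in>carrier M. \<gamma> (act M g x) = T g (\<gamma> x))"

lemma model_of_parametrization:
  fixes M :: "('k::field, 'v) D4_mod" (structure)
  assumes bij: "bij_betw L (supported I) (carrier M)"
    and add: "\<And>f g. f \<in> supported I \<Longrightarrow> g \<in> supported I \<Longrightarrow> L (f + g) = L f \<oplus> L g"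
    and sm: "\<And>k f. f \<in> supported I \<Longrightarrow> L (fs_scale k f) = k \<odot> L f"
    and act: "\<And>g f. f \<in> supported I \<Longrightarrow> T g f \<in> supported I \<and> act M g (L f) = L (T g f)"
  shows "model M I T (the_inv_into (supported I) L)" (is "model M I T ?\<gamma>")
  unfolding model_def
proof (intro conjI ballI allI coords_of_parametrization[OF bij add sm])
  fix x g assume "x \<in> carrier M"
  then obtain f where "f \<in> supported I" "x = L f" using bij by (auto simp: bij_betw_def)
  then show "?\<gamma> (act M g x) = T g (?\<gamma> x)"
    using act bij_betw_imp_inj_on[OF bij] by (simp add: the_inv_into_f_f)
qed

text \<open>
  In the normal form of \<open>M\<^sub>s(r,\<eta>)\<close> the basis vectors \<open>(False, i)\<close> and \<open>(True, i)\<close> span the top and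
  the socle; one of the two maps from the top to the socle is \<open>up\<close>, the other nilpotent one is \<open>down\<close>.
\<close>

fun up :: "bool \<times> nat \<Rightarrow> (bool \<times> nat \<Rightarrow>\<^sub>0 'k::field)" where
  "up (False, i) = Poly_Mapping.single (True, i) 1"
| "up (True, i) = 0"

fun down :: "bool \<times> nat \<Rightarrow> (bool \<times> nat \<Rightarrow>\<^sub>0 'k::field)" where
  "down (False, 0) = 0"
| "down (False, Suc i) = Poly_Mapping.single (True, i) 1"
| "down (True, i) = 0"

text \<open>Together with \<open>pencil_d\<close> this inverts the substitution A = a, D = d +
  \<eta> a (A = d, D = a at infinity), so that the single pair \<open>up\<close>,
  \<open>down\<close> serves every \<eta>.\<close>

fun pencil_a :: "'k::field proj_line \<Rightarrow> ('b \<Rightarrow> ('x \<Rightarrow>\<^sub>0 'k)) \<Rightarrow> ('b \<Rightarrow> ('x \<Rightarrow>\<^sub>0 'k)) \<Rightarrow> 'b \<Rightarrow> ('x \<Rightarrow>\<^sub>0 'k)" where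
  "pencil_a (Finite e) A D = A"
| "pencil_a Infinity A D = D"

fun pencil_d :: "'k::field proj_line \<Rightarrow> ('b \<Rightarrow> ('x \<Rightarrow>\<^sub>0 'k)) \<Rightarrow> ('b \<Rightarrow> ('x \<Rightarrow>\<^sub>0 'k)) \<Rightarrow> 'b \<Rightarrow> ('x \<Rightarrow>\<^sub>0 'k)" where
  "pencil_d (Finite e) A D = (\<lambda>x. D x - fs_scale e (A x))"
| "pencil_d Infinity A D = A"

definition sign_b :: "bit \<Rightarrow> bool \<times> nat \<Rightarrow> (bool \<times> nat \<Rightarrow>\<^sub>0 'k::field)" where
  "sign_b r p = Poly_Mapping.single p (if fst p then sgn2 r else - sgn2 r)"

fun M_op :: "bit \<Rightarrow> 'k::field proj_line \<Rightarrow> gen \<Rightarrow> (bool \<times> nat \<Rightarrow>\<^sub>0 'k) \<Rightarrow> (bool \<times> nat \<Rightarrow>\<^sub>0 'k)" where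
  "M_op r \<eta> gen_a = pencil_a \<eta> (fs_extend up) (fs_extend down)"
| "M_op r \<eta> gen_d = pencil_d \<eta> (fs_extend up) (fs_extend down)"
| "M_op r \<eta> gen_b = fs_extend (sign_b r)"
| "M_op r \<eta> gen_c = fs_extend (sign_b r)"

lemma linear_pencil:
  assumes "fs_linear A" "fs_linear D"
  shows "fs_linear (pencil_a \<eta> A D)"
    "fs_linear (pencil_d \<eta> A D)"
  using assms by (cases \<eta>; simp add: fsp.linear_compose_sub fsp.linear_compose_scale_right)+

lemma linear_M_op: "fs_linear (M_op r \<eta> g)"
  by (cases g) (simp_all add: linear_pencil linear_fs_extend)

lemma linear_pencil_on:
  assumes "\<alpha> (L f) = L (u f)" "\<delta> (L f) = L (d f)" "fs_linear L"
  shows "pencil_a \<eta> \<alpha> \<delta> (L f) = L (pencil_a \<eta> u d f)" "pencil_d \<eta> \<alpha> \<delta> (L f) = L (pencil_d \<eta> u d f)"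
  by (cases \<eta>; simp add: assms fsp.linear_diff[OF assms(3)] fsp.linear_scale[OF assms(3)])+

fun chain_vec :: "(('x \<Rightarrow>\<^sub>0 'k::field) \<Rightarrow> ('x \<Rightarrow>\<^sub>0 'k)) \<Rightarrow> (nat \<Rightarrow> ('x \<Rightarrow>\<^sub>0 'k)) \<Rightarrow> bool \<times> nat \<Rightarrow> ('x \<Rightarrow>\<^sub>0 'k)" where
  "chain_vec \<alpha> x (False, i) = x i"
| "chain_vec \<alpha> x (True, i) = \<alpha> (x i)"

text \<open>A chain obeying the relations of the top basis defines a homomorphism from the normal
  form. It is used with a Jordan chain inside M itself, and with \<open>hvec\<close> and
  \<open>zvec\<close> inside the tensor product.\<close>

lemma chain_equivariant:
  fixes \<alpha> \<delta> \<beta> :: "('x \<Rightarrow>\<^sub>0 'k::field) \<Rightarrow> ('x \<Rightarrow>\<^sub>0 'k)"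
  assumes l: "fs_linear \<alpha>" "fs_linear \<delta>"
      "fs_linear \<beta>"
    and \<alpha>\<alpha>: "\<And>i. i < s \<Longrightarrow> \<alpha> (\<alpha> (x i)) = 0" "\<And>i. i < s \<Longrightarrow> \<delta> (\<alpha> (x i)) = 0"
    and \<delta>: "\<delta> (x 0) = 0" "\<And>i. Suc i < s \<Longrightarrow> \<delta> (x (Suc i)) = \<alpha> (x i)"
    and \<beta>: "\<And>i. i < s \<Longrightarrow> \<beta> (x i) = fs_scale (- sgn2 r) (x i)"
      "\<And>i. i < s \<Longrightarrow> \<beta> (\<alpha> (x i)) = fs_scale (sgn2 r) (\<alpha> (x i))"
    and f: "f \<in> supported (UNIV \<times> {..<s})"
  shows "pencil_a \<eta> \<alpha> \<delta> (fs_extend (chain_vec \<alpha> x) f) = fs_extend (chain_vec \<alpha> x) (M_op r \<eta> gen_a f)"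
    "pencil_d \<eta> \<alpha> \<delta> (fs_extend (chain_vec \<alpha> x) f) = fs_extend (chain_vec \<alpha> x) (M_op r \<eta> gen_d f)"
    "\<beta> (fs_extend (chain_vec \<alpha> x) f) = fs_extend (chain_vec \<alpha> x) (M_op r \<eta> gen_b f)"
proof -
  let ?L = "fs_extend (chain_vec \<alpha> x)"
  have fin: "finite (UNIV \<times> {..<s} :: (bool \<times> nat) set)" by simp
  note on = linear_eq_on_supported[OF linear_comp[OF linear_fs_extend] linear_comp[OF linear_fs_extend linear_fs_extend] fin f]
  have up: "\<alpha> (?L f) = ?L (fs_extend up f)"
  proof (rule on[OF l(1)])
    fix p :: "bool \<times> nat" assume "p \<in> UNIV \<times> {..<s}"
    then show "\<alpha> (?L (unit p)) = ?L (fs_extend up (unit p))"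
      using \<alpha>\<alpha>(1) fsp.linear_0[OF linear_fs_extend] by (cases "(\<alpha>, x, p)" rule: chain_vec.cases) auto
  qed
  have down: "\<delta> (?L f) = ?L (fs_extend down f)"
  proof (rule on[OF l(2)])
    fix p :: "bool \<times> nat" assume "p \<in> UNIV \<times> {..<s}"
    then show "\<delta> (?L (unit p)) = ?L (fs_extend down (unit p))"
      using \<alpha>\<alpha>(2) \<delta> fsp.linear_0[OF linear_fs_extend] by (cases p rule: down.cases) auto
  qed
  show "pencil_a \<eta> \<alpha> \<delta> (?L f) = ?L (M_op r \<eta> gen_a f)" "pencil_d \<eta> \<alpha> \<delta> (?L f) = ?L (M_op r \<eta> gen_d f)"
    using linear_pencil_on[where \<alpha> = \<alpha> and \<delta> = \<delta> and L = ?L and f = f and u = "fs_extend up" and d = "fs_extend down",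
      OF up down linear_fs_extend] by simp_all
  have "\<beta> (?L f) = ?L (fs_extend (sign_b r) f)"
  proof (rule on[OF l(3)])
    fix p :: "bool \<times> nat" assume "p \<in> UNIV \<times> {..<s}"
    then show "\<beta> (?L (unit p)) = ?L (fs_extend (sign_b r) (unit p))"
      using \<beta> by (cases "(\<alpha>, x, p)" rule: chain_vec.cases) (auto simp: sign_b_def)
  qed
  then show "\<beta> (?L f) = ?L (M_op r \<eta> gen_b f)" by simp
qed

lemma M_op_closed:
  assumes f: "f \<in> supported (UNIV \<times> {..<s})"
  shows "M_op r \<eta> g f \<in> supported (UNIV \<times> {..<s})"
proof -
  have fin: "finite (UNIV \<times> {..<s} :: (bool \<times> nat) set)" by simp
  have "fs_extend h f \<in> supported (UNIV \<times> {..<s})"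
    if "\<And>p. p \<in> UNIV \<times> {..<s} \<Longrightarrow> h p \<in> supported (UNIV \<times> {..<s})" for h :: "bool \<times> nat \<Rightarrow> (bool \<times> nat \<Rightarrow>\<^sub>0 'a)"
    by (rule linear_in_subspace_on_supported[OF linear_fs_extend subspace_supported fin f]) (simp add: that)
  note cl = this
  have basis: "up p \<in> supported (UNIV \<times> {..<s})" "down p \<in> supported (UNIV \<times> {..<s})"
    "sign_b r p \<in> supported (UNIV \<times> {..<s})" if "p \<in> UNIV \<times> {..<s}" for p
    using that by (cases p rule: down.cases; auto simp: supported_iff lookup_single when_def sign_b_def)+
  have "fs_extend up f \<in> supported (UNIV \<times> {..<s})" "fs_extend down f \<in> supported (UNIV \<times> {..<s})"
    "fs_extend (sign_b r) f \<in> supported (UNIV \<times> {..<s})"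
    using cl[of up, OF basis(1)] cl[of down, OF basis(2)] cl[of "sign_b r", OF basis(3)] by blast+
  then show ?thesis
    by (cases g; cases \<eta>)
      (simp_all add: fs.subspace_diff[OF subspace_supported] fs.subspace_scale[OF subspace_supported])
qed

text \<open>The submodule M_1(r,\<eta>) gives two things: v_2, fixed by bc, which forces b = c on
  the indecomposable M; and v_1, a b-eigenvector killed by \<delta> but not by \<alpha>, which fixes
  the sign and the eigenvalue in the normal form. The type (s,s) gives the dimensions.\<close>

lemma is_M_model:
  fixes M :: "('k::alg_closed_field, 'm) D4_mod"
  assumes two: "(2::'k) \<noteq> 0" and isM: "is_M s r \<eta> M"
  obtains \<gamma> where "model M (UNIV \<times> {..<s}) (M_op r \<eta>) \<gamma>"
proof -
  have M: "D4_module M" "D4_indecomposable M" "Loewy_length M = 2"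
    "D4_length (D4_quotient M (D4_socle M)) = s" "D4_length (D4_restrict M (D4_socle M)) = s"
    using isM by (auto simp: is_M_def has_type_def)
  interpret D: D4_module M by (rule M(1))
  obtain N where N: "D4_submodule N M" "M1_mod r \<eta> \<cong>\<^sub>D D4_restrict M N" using isM by (auto simp: is_M_def)
  obtain f where f: "f \<in> D4_hom (M1_mod r \<eta>) (D4_restrict M N)" "bij_betw f UNIV N"
    using N(2) by (auto simp: D4_iso_def M1_mod_def D4_restrict_def)
  have NM: "N \<subseteq> carrier M" using N by (simp add: D4_submodule_iff[OF D.vectorspace_axioms])
  have fM: "f u \<in> carrier M" for u using f(2) NM by (auto simp: bij_betw_def)
  have fsm: "f (k * x, k * y) = k \<odot>\<^bsub>M\<^esub> f (x, y)" for k x y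
  proof -
    have "\<forall>k m. f (k \<odot>\<^bsub>M1_mod r \<eta>\<^esub> m) = k \<odot>\<^bsub>M\<^esub> f m"
      using f(1) by (auto simp: D4_hom_def LinearCombinations.module_hom_def M1_mod_def D4_restrict_def)
    then have "f (k \<odot>\<^bsub>M1_mod r \<eta>\<^esub> (x, y)) = k \<odot>\<^bsub>M\<^esub> f (x, y)" by blast
    then show ?thesis by (simp add: M1_mod_def)
  qed
  have f_act: "act M g (f u) = f (M1_act r \<eta> g u)" for g u
    using f(1) by (cases u) (auto simp: D4_hom_def M1_mod_def D4_restrict_def)
  have f0: "f (0, 0) = \<zero>\<^bsub>M\<^esub>" using fsm[of 0 0 0] D.smult(6)[OF fM] by simp
  define v1 v2 where "v1 = f (1, 0)" and "v2 = f (0, 1)"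
  have v: "v1 \<in> carrier M" "v2 \<in> carrier M" using fM by (auto simp: v1_def v2_def)
  have "v2 \<noteq> \<zero>\<^bsub>M\<^esub>" unfolding v2_def f0[symmetric] using f(2) by (auto simp: bij_betw_def dest: injD)
  define \<sigma> :: 'k where "\<sigma> = sgn2 r"
  have \<sigma>r: "sgn2 (r + 1) = - \<sigma>" by (simp add: \<sigma>_def sgn2_add) (simp add: sgn2_def)
  have \<sigma>: "\<sigma> * \<sigma> = 1" by (simp add: \<sigma>_def)
  have "M1_act r \<eta> gen_b (1, 0) = (sgn2 (r + 1) * 1, sgn2 r * 0)"
    by (cases \<eta>) (simp_all only: M1_act.simps)
  then have bv1: "act M gen_b v1 = (- \<sigma>) \<odot>\<^bsub>M\<^esub> v1"
    using fsm[of "- \<sigma>" 1 0] unfolding \<sigma>r by (simp add: v1_def f_act)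
  have "act M gen_b (act M gen_c v2) = v2" using \<sigma>
    by (cases \<eta>) (simp_all add: v2_def f_act \<sigma>_def)
  then interpret E: exterior_module M
    using D.exterior_of_indecomposable[OF two M(2) v(2) \<open>v2 \<noteq> _\<close>] by blast
  obtain A :: "'m set" and \<phi> where A: "finite A" and \<phi>: "coords M A \<phi>"
    using coords_exist[OF D.vectorspace_axioms D.finite_dimensional] .
  define S where "S = (supported A :: ('m \<Rightarrow>\<^sub>0 'k) set)"
  have inj: "inj_on \<phi> (carrier M)" and im: "\<phi> ` carrier M = S"
    using \<phi> by (auto simp: coords_def bij_betw_def S_def)
  have \<phi>add: "\<phi> (x \<oplus>\<^bsub>M\<^esub> y) = \<phi> x + \<phi> y" if "x \<in> carrier M" "y \<in> carrier M" for x y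
    using \<phi> that by (simp add: coords_def)
  have \<phi>sm: "\<phi> (k \<odot>\<^bsub>M\<^esub> x) = fs_scale k (\<phi> x)" if "x \<in> carrier M" for x k
    using \<phi> that by (simp add: coords_def)
  have \<phi>0: "\<phi> \<zero>\<^bsub>M\<^esub> = 0" by (rule E.phi_zero[OF A \<phi>])
  have \<phi>S: "\<phi> x \<in> S" if "x \<in> carrier M" for x using im that by blast
  have \<phi>eq0: "\<phi> x = 0 \<longleftrightarrow> x = \<zero>\<^bsub>M\<^esub>" if "x \<in> carrier M" for x
    using inj_on_eq_iff[OF inj that D.zero_closed] \<phi>0 by simp
  have sS: "fs.subspace S" unfolding S_def by (rule subspace_supported)
  have fS: "fs.fdim S" unfolding S_def by (rule fdim_supported[OF A])
  \<comment> \<open>\<open>graded_normal_form\<close> asks for operators linear on the whole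
    function space; the projection q onto the coordinates of M extends them.\<close>
  obtain q where q: "fs_linear q" "\<And>u. u \<in> S \<Longrightarrow> q u = u" "\<And>x. q x \<in> S"
    using fs.projection_exists[OF sS fs.subspace_single_0 Int_lower2] by metis
  define \<psi> where "\<psi> f = the_inv_into (carrier M) \<phi> (q f)" for f
  have \<psi>M: "\<psi> f \<in> carrier M" and \<phi>\<psi>: "\<phi> (\<psi> f) = q f" for f
    using q(3)[of f] the_inv_into_into[OF inj, of "q f" "carrier M"] f_the_inv_into_f[OF inj, of "q f"] im
    by (auto simp: \<psi>_def)
  have \<psi>\<phi>: "\<psi> (\<phi> x) = x" if "x \<in> carrier M" for x
    using that q(2)[OF \<phi>S] inj by (simp add: \<psi>_def the_inv_into_f_f)
  have \<psi>eqI: "\<psi> f = x" if "x \<in> carrier M" "q f = \<phi> x" for f x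
    using that inj by (simp add: \<psi>_def the_inv_into_f_f)
  have \<psi>add: "\<psi> (f + g) = \<psi> f \<oplus>\<^bsub>M\<^esub> \<psi> g" for f g
    by (rule \<psi>eqI) (simp_all add: \<psi>M \<phi>add \<phi>\<psi> fsp.linear_add[OF q(1)])
  have \<psi>sm: "\<psi> (fs_scale k f) = k \<odot>\<^bsub>M\<^esub> \<psi> f" for k f
    by (rule \<psi>eqI) (simp_all add: \<psi>M D.smult(1) \<phi>sm \<phi>\<psi> fsp.linear_scale[OF q(1)])
  define T where "T g f = \<phi> (act M g (\<psi> f))" for g f
  have T\<phi>: "T g (\<phi> x) = \<phi> (act M g x)" if "x \<in> carrier M" for g x using that by (simp add: T_def \<psi>\<phi>)
  have lT: "fs_linear (T g)" for g
    unfolding Vector_Spaces.linear_iff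
    by (simp add: fs.vector_space_axioms T_def \<psi>add \<psi>sm \<psi>M E.act_add E.act_smult E.act_closed \<phi>add \<phi>sm)
  have TS: "T g f \<in> S" for g f by (simp add: T_def \<psi>M E.act_closed \<phi>S)
  have ex: "\<exists>x\<in>carrier M. f = \<phi> x" if "f \<in> S" for f using that im by blast
  have neg: "\<phi> x = - \<phi> y" if "x \<in> carrier M" "y \<in> carrier M" "x \<oplus>\<^bsub>M\<^esub> y = \<zero>\<^bsub>M\<^esub>" for x y
    using \<phi>add[OF that(1,2)] that(3) \<phi>0 by (simp add: eq_neg_iff_add_eq_0)
  note cl = E.act_closed
  have soc: "act M gen_d (act M gen_a x) = \<zero>\<^bsub>M\<^esub>" "act M gen_a (act M gen_d x) = \<zero>\<^bsub>M\<^esub>" if "x \<in> carrier M" for x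
    using E.Loewy_two[OF M(3) that] by (auto simp: E.socle_eq E.annihilated_def)
  have TT: "T gen_b (T gen_b f) = f" "T gen_b (T gen_a f) = - T gen_a (T gen_b f)"
    "T gen_b (T gen_d f) = - T gen_d (T gen_b f)" "T gen_a (T gen_a f) = 0" "T gen_d (T gen_d f) = 0"
    "T gen_a (T gen_d f) = 0" "T gen_d (T gen_a f) = 0" if "f \<in> S" for f
    using ex[OF that] by (auto simp: T\<phi> cl E.bb E.aa E.dd soc \<phi>0 intro!: neg E.ba E.bd)
  \<comment> \<open>Chosen so that \<delta> kills v_1: as a v_1 = v_2 and d v_1 = -\<eta> v_2, it is
    d + \<eta> a, and it is a when \<eta> = \<infinity>.\<close>
  define \<alpha> where "\<alpha> = (case \<eta> of Finite e \<Rightarrow> T gen_a | Infinity \<Rightarrow> T gen_d)"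
  define \<delta> where "\<delta> = (case \<eta> of Finite e \<Rightarrow> (\<lambda>f. T gen_d f + fs_scale e (T gen_a f)) | Infinity \<Rightarrow> T gen_a)"
  have T\<alpha>\<delta>: "T gen_a = pencil_a \<eta> \<alpha> \<delta>" "T gen_d = pencil_d \<eta> \<alpha> \<delta>"
    by (cases \<eta>; simp add: \<alpha>_def \<delta>_def)+
  have l\<alpha>: "fs_linear \<alpha>" and l\<delta>: "fs_linear \<delta>"
    by (cases \<eta>; simp add: \<alpha>_def \<delta>_def lT fsp.linear_compose_add fsp.linear_compose_scale_right)+
  note lin = fsp.linear_add[OF lT] fsp.linear_scale[OF lT] fsp.linear_0[OF lT] fsp.linear_neg[OF lT]
  define K where "K = {x \<in> S. \<alpha> x = 0 \<and> \<delta> x = 0}"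
  have Kiff: "K = {x \<in> S. T gen_a x = 0 \<and> T gen_d x = 0}"
    by (cases \<eta>) (auto simp: K_def \<alpha>_def \<delta>_def)
  have KE: "K = \<phi> ` D4_socle M"
  proof -
    have "\<phi> x \<in> K \<longleftrightarrow> x \<in> D4_socle M" if "x \<in> carrier M" for x
      using that by (simp add: Kiff \<phi>S T\<phi> \<phi>eq0 cl E.socle_eq E.annihilated_def)
    moreover have "D4_socle M \<subseteq> carrier M" by (auto simp: E.socle_eq E.annihilated_def)
    moreover have "K \<subseteq> S" by (auto simp: K_def)
    ultimately show ?thesis using im by blast
  qed
  have dimK: "fs.dim K = s" unfolding KE by (simp add: E.dim_socle[OF A \<phi>] M)
  have dimS: "fs.dim S = 2 * fs.dim K"
    using E.dim_quotient_socle[OF A \<phi> E.Loewy_two[OF M(3)]] by (simp add: im dimK M)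
  have ST: "T g f \<in> U" if "\<And>x. x \<in> U \<Longrightarrow> \<alpha> x \<in> U \<and> \<delta> x \<in> U \<and> T gen_b x \<in> U" "fs.subspace U" "U \<subseteq> S" "f \<in> U" for U g f
  proof (cases g)
    case gen_a
    then show ?thesis using that by (cases \<eta>) (simp_all add: T\<alpha>\<delta>)
  next
    case gen_d
    then show ?thesis using that by (cases \<eta>) (simp_all add: T\<alpha>\<delta> fs.subspace_diff fs.subspace_scale)
  next
    case gen_b
    then show ?thesis using that by simp
  next
    case gen_c
    obtain y where "y \<in> carrier M" "f = \<phi> y" using ex[of f] \<open>U \<subseteq> S\<close> \<open>f \<in> U\<close> by blast
    then have "T gen_c f = T gen_b f" by (simp add: T\<phi> E.act_c)
    then show ?thesis using that gen_c by simp
  qed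
  have indec: "S1 \<subseteq> {0} \<or> S2 \<subseteq> {0}"
    if S12: "fs.subspace S1" "fs.subspace S2" "S1 \<subseteq> S" "S2 \<subseteq> S"
      and c1: "\<And>x. x \<in> S1 \<Longrightarrow> \<alpha> x \<in> S1 \<and> \<delta> x \<in> S1 \<and> T gen_b x \<in> S1"
      and c2: "\<And>x. x \<in> S2 \<Longrightarrow> \<alpha> x \<in> S2 \<and> \<delta> x \<in> S2 \<and> T gen_b x \<in> S2"
      and disj: "S1 \<inter> S2 \<subseteq> {0}" and sum: "\<And>x. x \<in> S \<Longrightarrow> \<exists>u\<in>S1. x - u \<in> S2" for S1 S2
  proof -
    \<comment> \<open>Splittings of the coordinate space are pulled back to M, whose
      indecomposability is stated on submodules.\<close>
    define pre where "pre U = {x \<in> carrier M. \<phi> x \<in> U}" for U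
    have sub: "D4_submodule (pre U) M"
      if "fs.subspace U" "U \<subseteq> S" "\<And>x. x \<in> U \<Longrightarrow> \<alpha> x \<in> U \<and> \<delta> x \<in> U \<and> T gen_b x \<in> U" for U
      unfolding E.D4_submodule_iff
    proof (intro conjI ballI allI)
      show "\<zero>\<^bsub>M\<^esub> \<in> pre U" using fs.subspace_0[OF that(1)] by (simp add: pre_def \<phi>0)
      fix x assume x: "x \<in> pre U"
      show "x \<oplus>\<^bsub>M\<^esub> y \<in> pre U" if "y \<in> pre U" for y
        using x that fs.subspace_add[OF \<open>fs.subspace U\<close>] by (simp add: pre_def \<phi>add)
      show "k \<odot>\<^bsub>M\<^esub> x \<in> pre U" for k
        using x fs.subspace_scale[OF \<open>fs.subspace U\<close>] by (simp add: pre_def \<phi>sm D.smult(1))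
      show "act M g x \<in> pre U" for g
        using x ST[OF that(3) that(1,2), of "\<phi> x" g] by (simp add: pre_def T\<phi> cl)
    qed (auto simp: pre_def)
    have "pre S1 \<inter> pre S2 = {\<zero>\<^bsub>M\<^esub>}"
      using disj \<phi>eq0 fs.subspace_0[OF S12(1)] fs.subspace_0[OF S12(2)] by (auto simp: pre_def \<phi>0)
    moreover have "set_add M (pre S1) (pre S2) = carrier M"
    proof (intro subset_antisym subsetI)
      fix x assume x: "x \<in> carrier M"
      obtain u where u: "u \<in> S1" "\<phi> x - u \<in> S2" using sum[OF \<phi>S[OF x]] by blast
      obtain y where y: "y \<in> carrier M" "u = \<phi> y" using ex u S12 by blast
      obtain w where w: "w \<in> carrier M" "\<phi> x - u = \<phi> w" using ex u S12 by blast
      have "\<phi> x = \<phi> (y \<oplus>\<^bsub>M\<^esub> w)" using y w by (simp add: \<phi>add) (metis add_diff_cancel_left' diff_add_cancel add.commute)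
      then have "x = y \<oplus>\<^bsub>M\<^esub> w" using inj x y w by (auto dest: inj_onD)
      moreover have "y \<in> pre S1" "w \<in> pre S2" using y w u by (auto simp: pre_def)
      ultimately show "x \<in> set_add M (pre S1) (pre S2)" unfolding set_add_def' by blast
    qed (auto simp: set_add_def' pre_def)
    ultimately have "pre S1 = {\<zero>\<^bsub>M\<^esub>} \<or> pre S2 = {\<zero>\<^bsub>M\<^esub>}"
      using M(2) sub[OF S12(1,3) c1] sub[OF S12(2,4) c2] unfolding D4_indecomposable_def by blast
    moreover have "U \<subseteq> {0}" if "pre U = {\<zero>\<^bsub>M\<^esub>}" "U \<subseteq> S" for U
    proof
      fix u assume u: "u \<in> U"
      then obtain x where x: "x \<in> carrier M" "u = \<phi> x" using ex \<open>U \<subseteq> S\<close> by blast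
      then have "x \<in> pre U" using u by (simp add: pre_def)
      then show "u \<in> {0}" using that(1) x \<phi>0 by simp
    qed
    ultimately show ?thesis using S12 by blast
  qed
  have x0: "\<phi> v1 \<in> S" "\<delta> (\<phi> v1) = 0" "\<alpha> (\<phi> v1) \<noteq> 0" "T gen_b (\<phi> v1) = fs_scale (- \<sigma>) (\<phi> v1)"
  proof -
    show "\<phi> v1 \<in> S" using v \<phi>S by simp
    show "T gen_b (\<phi> v1) = fs_scale (- \<sigma>) (\<phi> v1)" using v by (simp add: T\<phi> bv1 \<phi>sm)
    have "act M gen_d v1 = (- e) \<odot>\<^bsub>M\<^esub> v2" if "\<eta> = Finite e" for e
      using fsm[of "- e" 0 1] that by (simp add: v1_def v2_def f_act)
    moreover have "act M gen_a v1 = (case \<eta> of Finite e \<Rightarrow> v2 | Infinity \<Rightarrow> \<zero>\<^bsub>M\<^esub>)"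
      by (cases \<eta>) (simp_all add: v1_def v2_def f_act f0)
    moreover have "act M gen_d v1 = v2" if "\<eta> = Infinity" using that by (simp add: v1_def v2_def f_act)
    ultimately show "\<delta> (\<phi> v1) = 0" "\<alpha> (\<phi> v1) \<noteq> 0"
      using \<open>v2 \<noteq> _\<close> v by (cases \<eta>; simp add: \<alpha>_def \<delta>_def T\<phi> \<phi>eq0 \<phi>0 \<phi>sm)+
  qed
  obtain x where x: "\<And>i. i < s \<Longrightarrow> x i \<in> S" "\<And>i. i < s \<Longrightarrow> T gen_b (x i) = fs_scale (- \<sigma>) (x i)"
    "\<delta> (x 0) = 0" "\<And>i. Suc i < s \<Longrightarrow> \<delta> (x (Suc i)) = \<alpha> (x i)"
    "\<And>c c' i. (\<Sum>i<s. fs_scale (c i) (x i)) + (\<Sum>i<s. fs_scale (c' i) (\<alpha> (x i))) = 0 \<Longrightarrow> i < s \<Longrightarrow> c i = 0 \<and> c' i = 0"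
    "\<And>y. y \<in> S \<Longrightarrow> \<exists>c c'. y = (\<Sum>i<s. fs_scale (c i) (x i)) + (\<Sum>i<s. fs_scale (c' i) (\<alpha> (x i)))"
  proof (rule fs.graded_normal_form[OF infinite_alg_closed_field two sS fS lT[of gen_b] l\<alpha> l\<delta> _ _ _ _ _ _ _ indec \<sigma> x0,
        folded K_def, unfolded dimK])
    show "T gen_b (\<alpha> f) = - \<alpha> (T gen_b f)" "T gen_b (\<delta> f) = - \<delta> (T gen_b f)" if "f \<in> S" for f
      using TT[OF that] by (cases \<eta>; simp add: \<alpha>_def \<delta>_def lin)+
    show "\<alpha> f \<in> K" "\<delta> f \<in> K" if "f \<in> S" for f
      using TT[OF that] TS fs.subspace_add[OF sS] fs.subspace_scale[OF sS]
      by (cases \<eta>; simp add: Kiff \<alpha>_def \<delta>_def lin)+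
    show "fs.dim S = 2 * s" using dimS dimK by simp
  qed (use TS TT in auto)
  let ?I = "(UNIV :: bool set) \<times> {..<s}"
  define h where "h = chain_vec \<alpha> x"
  define L where "L = fs_extend h"
  have lL: "fs_linear L" unfolding L_def by (rule linear_fs_extend)
  have finI: "finite ?I" by simp
  have Leq: "L f = (\<Sum>i<s. fs_scale (Poly_Mapping.lookup f (False, i)) (x i)) +
      (\<Sum>i<s. fs_scale (Poly_Mapping.lookup f (True, i)) (\<alpha> (x i)))" if "f \<in> supported ?I" for f
  proof -
    have "L f = (\<Sum>p\<in>?I. fs_scale (Poly_Mapping.lookup f p) (h p))"
      unfolding L_def using that by (intro fs_extend_eq) (auto simp: supported_def)
    also have "\<dots> = (\<Sum>t\<in>UNIV. \<Sum>i<s. fs_scale (Poly_Mapping.lookup f (t, i)) (h (t, i)))"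
      by (simp add: sum.cartesian_product)
    finally show ?thesis by (simp add: UNIV_bool h_def add.commute)
  qed
  have \<alpha>\<alpha>: "\<alpha> (\<alpha> y) = 0" "\<delta> (\<alpha> y) = 0" "T gen_b (\<alpha> y) = - \<alpha> (T gen_b y)" if "y \<in> S" for y
    using TT[OF that] by (cases \<eta>; simp add: \<alpha>_def \<delta>_def lin)+
  have bx: "T gen_b (\<alpha> (x i)) = fs_scale \<sigma> (\<alpha> (x i))" if "i < s" for i
    using \<alpha>\<alpha>(3)[OF x(1)[OF that]] x(2)[OF that] fsp.linear_neg[OF l\<alpha>] fsp.linear_scale[OF l\<alpha>] by simp
  have LS: "L f \<in> S" if "f \<in> supported ?I" for f
  proof (rule linear_in_subspace_on_supported[OF lL sS finI that])
    fix p :: "bool \<times> nat" assume "p \<in> ?I"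
    then show "L (unit p) \<in> S"
      using x(1) TS unfolding L_def h_def by (cases p; cases "fst p"; cases \<eta>) (auto simp: \<alpha>_def)
  qed
  have eqT: "T g (L f) = L (M_op r \<eta> g f)" if f: "f \<in> supported ?I" for f g
  proof -
    have "T gen_c (L f) = T gen_b (L f)" using ex[OF LS[OF f]] by (auto simp: T\<phi> E.act_c)
    then show ?thesis
      using chain_equivariant[OF l\<alpha> l\<delta> lT \<alpha>\<alpha>(1,2)[OF x(1)] x(3,4) x(2)[unfolded \<sigma>_def] bx[unfolded \<sigma>_def] f, of \<eta>]
      by (cases g) (simp_all add: L_def h_def T\<alpha>\<delta> del: chain_vec.simps)
  qed
  have L\<psi>: "\<phi> (\<psi> (L f)) = L f" if "f \<in> supported ?I" for f by (simp add: \<phi>\<psi> q(2)[OF LS[OF that]])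
  have "bij_betw (\<lambda>f. \<psi> (L f)) (supported ?I) (carrier M)"
  proof (rule bij_betw_imageI)
    show "inj_on (\<lambda>f. \<psi> (L f)) (supported ?I)"
    proof (rule inj_onI)
      fix f f' assume f: "f \<in> supported ?I" "f' \<in> supported ?I" "\<psi> (L f) = \<psi> (L f')"
      define d where "d = f - f'"
      have d: "d \<in> supported ?I" unfolding d_def by (rule fs.subspace_diff[OF subspace_supported f(1,2)])
      have "L f = L f'" using L\<psi>[OF f(1)] L\<psi>[OF f(2)] f(3) by metis
      then have "L d = 0" unfolding d_def fsp.linear_diff[OF lL] by simp
      then have "Poly_Mapping.lookup d (t, i) = 0" for t i
        using x(5)[of "\<lambda>i. Poly_Mapping.lookup d (False, i)" "\<lambda>i. Poly_Mapping.lookup d (True, i)" i] Leq[OF d] d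
        by (cases "i < s"; cases t) (auto simp: supported_iff)
      then have "d = 0" by (intro poly_mapping_eqI) auto
      then show "f = f'" by (simp add: d_def)
    qed
    show "(\<lambda>f. \<psi> (L f)) ` supported ?I = carrier M"
    proof (intro subset_antisym subsetI)
      fix y assume y: "y \<in> carrier M"
      then obtain c c' where c: "\<phi> y = (\<Sum>i<s. fs_scale (c i) (x i)) + (\<Sum>i<s. fs_scale (c' i) (\<alpha> (x i)))"
        using x(6)[OF \<phi>S] by blast
      define f where "f = (\<Sum>i<s. fs_scale (c i) (unit (False, i))) + (\<Sum>i<s. fs_scale (c' i) (unit (True, i)))"
      have "f \<in> supported ?I" unfolding f_def
        by (intro fs.subspace_add fs.subspace_sum fs.subspace_scale subspace_supported unit_supported) auto
      moreover have "L f = \<phi> y"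
        by (simp add: f_def c L_def h_def fsp.linear_add[OF linear_fs_extend] fsp.linear_sum[OF linear_fs_extend]
            fsp.linear_scale[OF linear_fs_extend])
      ultimately show "y \<in> (\<lambda>f. \<psi> (L f)) ` supported ?I" using \<psi>\<phi>[OF y] by (metis image_eqI)
    qed (use \<psi>M in auto)
  qed
  then have "model M ?I (M_op r \<eta>) (the_inv_into (supported ?I) (\<lambda>f. \<psi> (L f)))"
  proof (rule model_of_parametrization)
    show "M_op r \<eta> g f \<in> supported ?I \<and> act M g (\<psi> (L f)) = \<psi> (L (M_op r \<eta> g f))"
      if "f \<in> supported ?I" for g f
      using M_op_closed[OF that] eqT[OF that] \<psi>\<phi>[OF cl[OF \<psi>M]] by (simp add: T_def flip: eqT[OF that])
  qed (simp_all add: fsp.linear_add[OF lL] fsp.linear_scale[OF lL] \<psi>add \<psi>sm)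
  then show ?thesis using that by blast
qed

section \<open>The projective modules P(r)\<close>

text \<open>The coefficient -1 expresses a d u = - d a u.\<close>

fun P_basis :: "bit \<Rightarrow> gen \<Rightarrow> nat \<Rightarrow> (nat \<Rightarrow>\<^sub>0 'k::field)" where
  "P_basis r gen_a i = (if i = 0 then unit 1 else if i = 2 then Poly_Mapping.single 3 (- 1) else 0)"
| "P_basis r gen_d i = (if i = 0 then unit 2 else if i = 1 then unit 3 else 0)"
| "P_basis r gen_b i = Poly_Mapping.single i (if i = 0 \<or> i = 3 then sgn2 r else - sgn2 r)"
| "P_basis r gen_c i = Poly_Mapping.single i (if i = 0 \<or> i = 3 then sgn2 r else - sgn2 r)"

text \<open>
  The basis vectors \<open>0, 1, 2, 3\<close> of \<open>P(r)\<close> are \<open>u, a u, d u, d a u\<close> for a generator \<open>u\<close>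
  on which \<open>b\<close> and \<open>c\<close> act as \<open>(-1)\<^sup>r\<close>.
\<close>

definition P_op :: "bit \<Rightarrow> gen \<Rightarrow> (nat \<Rightarrow>\<^sub>0 'k::field) \<Rightarrow> (nat \<Rightarrow>\<^sub>0 'k)" where
  "P_op r g = fs_extend (P_basis r g)"

text \<open>
  Copies of \<open>P(r)\<close> and \<open>V(r)\<close> on vectors of type \<open>nat \<Rightarrow> 'k\<close>, the type on which
  projectivity is tested.
\<close>

definition fun_mod :: "nat \<Rightarrow> (gen \<Rightarrow> (nat \<Rightarrow> 'k) \<Rightarrow> (nat \<Rightarrow> 'k)) \<Rightarrow> ('k::field, nat \<Rightarrow> 'k) D4_mod" where
  "fun_mod n A = \<lparr>carrier = {f. \<forall>i\<ge>n. f i = 0}, mult = undefined, one = undefined, zero = (\<lambda>_. 0),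
     add = (\<lambda>f g i. f i + g i), smult = (\<lambda>k f i. k * f i), act = A\<rparr>"

lemma vectorspace_fun_mod: "vectorspace (class_ring :: 'k::field ring) (fun_mod n A)"
proof (rule vs_criteria)
  show "field (class_ring :: 'k ring)" by (rule class_field)
  show "\<forall>v\<in>carrier (fun_mod n A). \<exists>w\<in>carrier (fun_mod n A). v \<oplus>\<^bsub>fun_mod n A\<^esub> w = \<zero>\<^bsub>fun_mod n A\<^esub>"
  proof
    fix v assume "v \<in> carrier (fun_mod n A)"
    then show "\<exists>w\<in>carrier (fun_mod n A). v \<oplus>\<^bsub>fun_mod n A\<^esub> w = \<zero>\<^bsub>fun_mod n A\<^esub>"
      by (intro bexI[of _ "\<lambda>i. - v i"]) (auto simp: fun_mod_def)
  qed
qed (auto simp: fun_mod_def fun_eq_iff algebra_simps)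

lemma fin_dim_fun_mod: "vectorspace.fin_dim (class_ring :: 'k::field ring) (fun_mod n A)"
proof -
  interpret vectorspace class_ring "fun_mod n A" by (rule vectorspace_fun_mod)
  define B where "B = (\<lambda>j i. if i = j then (1::'k) else 0) ` {..<n}"
  have B: "B \<subseteq> carrier (fun_mod n A)" by (auto simp: B_def fun_mod_def)
  interpret sp: submodule class_ring "span B" "fun_mod n A" by (rule span_is_submodule[OF B])
  have "f \<in> span B" if "m \<le> n" "\<forall>i\<ge>m. f i = 0" for m f using that
  proof (induction m arbitrary: f)
    case 0
    then have "f = \<zero>\<^bsub>fun_mod n A\<^esub>" by (auto simp: fun_mod_def)
    then show ?case by simp
  next
    case (Suc m)
    have "(f(m := 0)) i = 0" if "i \<ge> m" for i using Suc.prems(2) that by (cases "i = m") auto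
    then have "f(m := 0) \<in> span B" using Suc.prems(1) by (intro Suc.IH) auto
    moreover have "(\<lambda>i. if i = m then 1 else 0) \<in> B" using Suc.prems by (auto simp: B_def)
    then have "f m \<odot>\<^bsub>fun_mod n A\<^esub> (\<lambda>i. if i = m then 1 else 0) \<in> span B"
      using in_own_span[OF B] by auto
    ultimately have "f(m := 0) \<oplus>\<^bsub>fun_mod n A\<^esub> f m \<odot>\<^bsub>fun_mod n A\<^esub> (\<lambda>i. if i = m then 1 else 0) \<in> span B"
      by (rule sp.m_closed)
    moreover have "f(m := 0) \<oplus>\<^bsub>fun_mod n A\<^esub> f m \<odot>\<^bsub>fun_mod n A\<^esub> (\<lambda>i. if i = m then 1 else 0) = f"
      by (auto simp: fun_mod_def)
    ultimately show ?case by simp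
  qed
  then have "carrier (fun_mod n A) \<subseteq> span B" by (auto simp: fun_mod_def)
  then have "span B = carrier (fun_mod n A)" using sp.subset by blast
  then show ?thesis unfolding fin_dim_def using B by (intro exI[of _ B]) (auto simp: B_def)
qed

lemma a_inv_fun_mod: "f \<in> carrier (fun_mod n A) \<Longrightarrow> \<ominus>\<^bsub>fun_mod n A\<^esub> f = (\<lambda>i. - f i)"
  using vs_smult(5,8)[OF vectorspace_fun_mod, of f n A] vs_smult(8)[OF vectorspace_fun_mod, of f n A 1]
  by (simp add: fun_mod_def)

lemma D4_module_fun_mod:
  fixes A :: "gen \<Rightarrow> (nat \<Rightarrow> 'k::field) \<Rightarrow> (nat \<Rightarrow> 'k)"
  assumes closed: "\<And>g f. \<forall>i\<ge>n. f i = 0 \<Longrightarrow> \<forall>i\<ge>n. A g f i = 0"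
    and add: "\<And>g f h i. A g (\<lambda>i. f i + h i) i = A g f i + A g h i"
    and sm: "\<And>g k f i. A g (\<lambda>i. k * f i) i = k * A g f i"
    and rels: "\<And>f. \<forall>i\<ge>n. f i = 0 \<Longrightarrow> \<forall>i. A gen_b (A gen_a f) i = - A gen_a (A gen_b f) i \<and>
      A gen_d (A gen_b f) i = - A gen_b (A gen_d f) i \<and> A gen_c (A gen_a f) i = - A gen_a (A gen_c f) i \<and>
      A gen_d (A gen_c f) i = - A gen_c (A gen_d f) i \<and> A gen_b (A gen_c f) i = A gen_c (A gen_b f) i \<and>
      A gen_a (A gen_a f) i = 0 \<and> A gen_b (A gen_b f) i = f i \<and> A gen_c (A gen_c f) i = f i \<and>
      A gen_d (A gen_d f) i = 0 \<and> A gen_d (A gen_a f) i + A gen_a (A gen_d f) i = f i - A gen_b (A gen_c f) i"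
  shows "D4_module (fun_mod n A)"
proof -
  interpret vectorspace class_ring "fun_mod n A" by (rule vectorspace_fun_mod)
  have c: "f \<in> carrier (fun_mod n A) \<longleftrightarrow> (\<forall>i\<ge>n. f i = 0)" for f by (simp add: fun_mod_def)
  have Ac: "A g f \<in> carrier (fun_mod n A)" if "f \<in> carrier (fun_mod n A)" for f g
    using that closed unfolding c by blast
  have simps: "act (fun_mod n A) = A" "\<zero>\<^bsub>fun_mod n A\<^esub> = (\<lambda>_. 0)"
    "f \<oplus>\<^bsub>fun_mod n A\<^esub> h = (\<lambda>i. f i + h i)" "k \<odot>\<^bsub>fun_mod n A\<^esub> f = (\<lambda>i. k * f i)" for f h k
    by (simp_all add: fun_mod_def)
  show ?thesis
  proof (rule D4_module.intro[OF vectorspace_axioms D4_module_axioms.intro])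
    show "vectorspace.fin_dim class_ring (fun_mod n A)" by (rule fin_dim_fun_mod)
    show "act (fun_mod n A) g \<in> LinearCombinations.module_hom class_ring (fun_mod n A) (fun_mod n A)" for g
      unfolding LinearCombinations.module_hom_def
      by (auto simp: simps Ac fun_eq_iff add sm)
  qed (use rels in \<open>auto simp: simps Ac a_inv_fun_mod a_minus_def fun_eq_iff c[symmetric]\<close>)
qed

definition P_fun :: "bit \<Rightarrow> ('k::field, nat \<Rightarrow> 'k) D4_mod" where
  "P_fun r = fun_mod 4 (\<lambda>g f i. case g of
     gen_a \<Rightarrow> if i = 1 then f 0 else if i = 3 then - f 2 else 0
   | gen_d \<Rightarrow> if i = 2 then f 0 else if i = 3 then f 1 else 0
   | _ \<Rightarrow> if i = 0 \<or> i = 3 then sgn2 r * f i else - sgn2 r * f i)"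

definition V_fun :: "bit \<Rightarrow> ('k::field, nat \<Rightarrow> 'k) D4_mod" where
  "V_fun r = fun_mod 1 (\<lambda>g f i. case g of gen_a \<Rightarrow> 0 | gen_d \<Rightarrow> 0 | _ \<Rightarrow> sgn2 r * f i)"

lemma D4_module_P_fun: "D4_module (P_fun r)"
  unfolding P_fun_def
  by (rule D4_module_fun_mod) (auto simp: algebra_simps split: gen.splits)

lemma D4_module_V_fun: "D4_module (V_fun r)"
  unfolding V_fun_def
  by (rule D4_module_fun_mod) (auto simp: algebra_simps split: gen.splits)

lemma supported_4: "f \<in> supported {..<4::nat} \<longleftrightarrow> (\<forall>i\<ge>4. Poly_Mapping.lookup f i = 0)"
  by (auto simp: supported_iff not_less)

lemma lookup_P_op:
  fixes f :: "nat \<Rightarrow>\<^sub>0 'k::field"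
  assumes "f \<in> supported {..<4}"
  shows "Poly_Mapping.lookup (P_op r gen_a f) i = (if i = 1 then Poly_Mapping.lookup f 0 else if i = 3 then - Poly_Mapping.lookup f 2 else 0)"
    "Poly_Mapping.lookup (P_op r gen_d f) i = (if i = 2 then Poly_Mapping.lookup f 0 else if i = 3 then Poly_Mapping.lookup f 1 else 0)"
    "Poly_Mapping.lookup (P_op r gen_b f) i = (if i = 0 \<or> i = 3 then sgn2 r else - sgn2 r) * Poly_Mapping.lookup f i"
    "Poly_Mapping.lookup (P_op r gen_c f) i = (if i = 0 \<or> i = 3 then sgn2 r else - sgn2 r) * Poly_Mapping.lookup f i"
proof -
  have "P_op r g f = (\<Sum>p<4. fs_scale (Poly_Mapping.lookup f p) (P_basis r g p))" for g
    unfolding P_op_def using assms by (intro fs_extend_eq) (auto simp: supported_def)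
  then have e: "P_op r g f = fs_scale (Poly_Mapping.lookup f 0) (P_basis r g 0) + fs_scale (Poly_Mapping.lookup f 1) (P_basis r g 1)
     + fs_scale (Poly_Mapping.lookup f 2) (P_basis r g 2) + fs_scale (Poly_Mapping.lookup f 3) (P_basis r g 3)" for g
    by (simp add: numeral_eq_Suc lessThan_Suc algebra_simps)
  consider "i = 0" | "i = 1" | "i = 2" | "i = 3" | "i \<ge> 4" by linarith
  note i = this
  show "Poly_Mapping.lookup (P_op r gen_a f) i = (if i = 1 then Poly_Mapping.lookup f 0 else if i = 3 then - Poly_Mapping.lookup f 2 else 0)"
    "Poly_Mapping.lookup (P_op r gen_d f) i = (if i = 2 then Poly_Mapping.lookup f 0 else if i = 3 then Poly_Mapping.lookup f 1 else 0)"
    "Poly_Mapping.lookup (P_op r gen_b f) i = (if i = 0 \<or> i = 3 then sgn2 r else - sgn2 r) * Poly_Mapping.lookup f i"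
    "Poly_Mapping.lookup (P_op r gen_c f) i = (if i = 0 \<or> i = 3 then sgn2 r else - sgn2 r) * Poly_Mapping.lookup f i"
    using assms by (cases rule: i; simp add: e lookup_add lookup_single when_def supported_4)+
qed

text \<open>For an eigenvector u of b and c with nonzero image in V(r), the vectors u, a u, d u, d a
  u span a submodule that supplements the kernel of the covering map, so it is all of P.
  Projectivity gives d a u \<noteq> 0, and this makes the four vectors independent.\<close>

lemma is_P_model:
  fixes P :: "('k::field, 'p) D4_mod" (structure)
  assumes two: "(2::'k) \<noteq> 0" and isP: "is_P r P"
  obtains \<gamma> where "D4_module P" "model P {..<4} (P_op r) \<gamma>"
proof -
  have proj: "D4_projective P" and mod: "D4_module P"
    using isP by (auto simp: is_P_def projective_cover_of_def D4_projective_def)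
  interpret D: D4_module P by (rule mod)
  obtain \<pi> where \<pi>: "\<pi> \<in> D4_hom P (V_mod r)" "\<pi> ` carrier P = UNIV"
    "\<And>N. D4_submodule N P \<Longrightarrow> set_add P N {x \<in> carrier P. \<pi> x = 0} = carrier P \<Longrightarrow> N = carrier P"
    using isP by (auto simp: is_P_def projective_cover_of_def V_mod_def)
  note cl = D.act_closed and sm = D.smult
  have \<pi>add: "\<pi> (x \<oplus> y) = \<pi> x + \<pi> y" if "x \<in> carrier P" "y \<in> carrier P" for x y
    using \<pi>(1) that by (simp add: D4_hom_def LinearCombinations.module_hom_def V_mod_def)
  have \<pi>sm: "\<pi> (k \<odot> x) = k * \<pi> x" if "x \<in> carrier P" for x k
    using \<pi>(1) that by (simp add: D4_hom_def LinearCombinations.module_hom_def V_mod_def)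
  have \<pi>act: "\<pi> (act P g x) = (case g of gen_a \<Rightarrow> 0 | gen_b \<Rightarrow> sgn2 r * \<pi> x | gen_c \<Rightarrow> sgn2 r * \<pi> x | gen_d \<Rightarrow> 0)"
    if "x \<in> carrier P" for x g
    using \<pi>(1) that by (simp add: D4_hom_def V_mod_def)
  define \<sigma> :: 'k where "\<sigma> = sgn2 r"
  have \<sigma>: "\<sigma> * \<sigma> = 1" by (simp add: \<sigma>_def)
  obtain w where w: "w \<in> carrier P" "\<pi> w = 1" using \<pi>(2) by (metis UNIV_I imageE)
  \<comment> \<open>Eigenprojections for b and then for c without the factors 1/2; each doubles the
    image under \<pi>, whence the values 2 and 4.\<close>
  define u1 where "u1 = w \<oplus> \<sigma> \<odot> act P gen_b w"
  define u where "u = u1 \<oplus> \<sigma> \<odot> act P gen_c u1"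
  have u1: "u1 \<in> carrier P" "act P gen_b u1 = \<sigma> \<odot> u1" "\<pi> u1 = 2"
  proof -
    show "u1 \<in> carrier P" using w cl sm(1) by (simp add: u1_def)
    show "act P gen_b u1 = \<sigma> \<odot> u1"
      using w cl \<sigma> by (simp add: u1_def D.act_add D.act_smult D.rel_bb sm(1,3,5) D.a_comm flip: sm(4))
    show "\<pi> u1 = 2" using w cl sm(1) \<sigma> by (simp add: u1_def \<pi>add \<pi>sm \<pi>act flip: \<sigma>_def mult.assoc)
  qed
  have u: "u \<in> carrier P" "act P gen_b u = \<sigma> \<odot> u" "act P gen_c u = \<sigma> \<odot> u" "\<pi> u = 4"
  proof -
    show "u \<in> carrier P" using u1 cl sm(1) by (simp add: u_def)
    show "act P gen_c u = \<sigma> \<odot> u"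
      using u1(1) cl \<sigma> by (simp add: u_def D.act_add D.act_smult D.rel_cc sm(1,3,5) D.a_comm flip: sm(4))
    show "act P gen_b u = \<sigma> \<odot> u"
      using u1 cl \<sigma> by (simp add: u_def D.act_add D.act_smult D.rel_bc sm(1,3) mult.commute)
    show "\<pi> u = 4" using u1 cl sm(1) \<sigma> by (simp add: u_def \<pi>add \<pi>sm \<pi>act flip: \<sigma>_def mult.assoc)
  qed
  define e where "e i = (if i = 0 then u else if i = 1 then act P gen_a u else if i = 2 then act P gen_d u
    else act P gen_d (act P gen_a u))" for i :: nat
  have e: "e i \<in> carrier P" for i using u cl by (simp add: e_def)
  have neg: "x = (-1) \<odot> y" if "x \<oplus> y = \<zero>" "x \<in> carrier P" "y \<in> carrier P" for x y
    using sm(9)[OF that(2,3,1)] .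
  have zero: "act P g \<zero> = \<zero>" for g
    using D.act_smult[of \<zero> g 0] sm(6)[of \<zero>] sm(6)[OF cl[of \<zero> g]] by simp
  have bcu: "act P gen_b (act P gen_c u) = u"
    using u \<sigma> by (simp add: D.act_smult sm(5) flip: sm(4))
  have ad: "act P gen_a (act P gen_d u) = (-1) \<odot> act P gen_d (act P gen_a u)"
  proof (rule neg)
    show "act P gen_a (act P gen_d u) \<oplus> act P gen_d (act P gen_a u) = \<zero>"
      using D.rel_da[OF u(1)] u(1) cl bcu by (simp add: D.a_comm a_minus_def D.r_neg)
  qed (use u cl in auto)
  \<comment> \<open>As bc is central it fixes a u as well; there d a + a d = 0, and a^2 = 0 leaves a
    d a u = 0.\<close>
  have ada: "act P gen_a (act P gen_d (act P gen_a u)) = \<zero>"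
  proof -
    have "act P gen_b (act P gen_c (act P gen_a u)) = act P gen_a u" using D.bc_central[OF u(1)] bcu by simp
    then show ?thesis
      using D.rel_da[OF cl[OF u(1), of gen_a]] u(1) cl by (simp add: D.rel_aa zero a_minus_def D.r_neg)
  qed
  have sgn: "act P h (act P gen_a x) = (- k) \<odot> act P gen_a x" "act P h (act P gen_d x) = (- k) \<odot> act P gen_d x"
    if x: "x \<in> carrier P" "act P h x = k \<odot> x" "h = gen_b \<or> h = gen_c" for x k h
  proof -
    have "act P h (act P gen_a x) = \<ominus> (act P gen_a (act P h x))"
      using x(1,3) D.rel_ba[OF x(1)] D.rel_ca[OF x(1)] by auto
    then show "act P h (act P gen_a x) = (- k) \<odot> act P gen_a x"
      using x cl by (simp add: D.act_smult sm(8))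
    have "act P gen_d (act P h x) = \<ominus> (act P h (act P gen_d x))"
      using x(1,3) D.rel_db[OF x(1)] D.rel_dc[OF x(1)] by auto
    then have "act P h (act P gen_d x) = \<ominus> (act P gen_d (act P h x))" using x cl by simp
    then show "act P h (act P gen_d x) = (- k) \<odot> act P gen_d x"
      using x cl by (simp add: D.act_smult sm(8))
  qed
  have eact: "act P gen_a (e 0) = e 1" "act P gen_a (e 1) = \<zero>" "act P gen_a (e 2) = (-1) \<odot> e 3" "act P gen_a (e 3) = \<zero>"
    "act P gen_d (e 0) = e 2" "act P gen_d (e 1) = e 3" "act P gen_d (e 2) = \<zero>" "act P gen_d (e 3) = \<zero>"
    and esgn: "h = gen_b \<or> h = gen_c \<Longrightarrow> act P h (e 0) = \<sigma> \<odot> e 0"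
      "h = gen_b \<or> h = gen_c \<Longrightarrow> act P h (e 1) = (- \<sigma>) \<odot> e 1"
      "h = gen_b \<or> h = gen_c \<Longrightarrow> act P h (e 2) = (- \<sigma>) \<odot> e 2"
      "h = gen_b \<or> h = gen_c \<Longrightarrow> act P h (e 3) = \<sigma> \<odot> e 3" for h
  proof -
    show "act P gen_a (e 0) = e 1" "act P gen_a (e 1) = \<zero>" "act P gen_a (e 2) = (-1) \<odot> e 3" "act P gen_a (e 3) = \<zero>"
    "act P gen_d (e 0) = e 2" "act P gen_d (e 1) = e 3" "act P gen_d (e 2) = \<zero>" "act P gen_d (e 3) = \<zero>"
      using u cl ad ada by (simp_all add: e_def D.rel_aa D.rel_dd)
    assume h: "h = gen_b \<or> h = gen_c"
    show h0: "act P h (e 0) = \<sigma> \<odot> e 0" using h u by (auto simp: e_def)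
    show h1: "act P h (e 1) = (- \<sigma>) \<odot> e 1" using sgn(1)[OF u(1) _ h, of \<sigma>] h0 by (simp add: e_def)
    show "act P h (e 2) = (- \<sigma>) \<odot> e 2" using sgn(2)[OF u(1) _ h, of \<sigma>] h0 by (simp add: e_def)
    show "act P h (e 3) = \<sigma> \<odot> e 3" using sgn(2)[OF e[of 1] h1 h] by (simp add: e_def)
  qed
  define L where "L f = (Poly_Mapping.lookup f 0 \<odot> e 0 \<oplus> Poly_Mapping.lookup f 1 \<odot> e 1) \<oplus>
    (Poly_Mapping.lookup f 2 \<odot> e 2 \<oplus> Poly_Mapping.lookup f 3 \<odot> e 3)" for f :: "nat \<Rightarrow>\<^sub>0 'k"
  have LP: "L f \<in> carrier P" for f using e sm(1) by (simp add: L_def)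
  have Ladd: "L (f + g) = L f \<oplus> L g" for f g
    using e sm(1) by (simp add: L_def lookup_add sm(2) D.a_ac)
  have Lsm: "L (fs_scale k f) = k \<odot> L f" for k f
    using e sm(1) by (simp add: L_def sm(3,4))
  have Lact: "act P g (L f) = L (P_op r g f)" if f: "f \<in> supported {..<4}" for g f
  proof -
    let ?c = "Poly_Mapping.lookup f"
    have 1: "act P g (L f) = (?c 0 \<odot> act P g (e 0) \<oplus> ?c 1 \<odot> act P g (e 1)) \<oplus>
      (?c 2 \<odot> act P g (e 2) \<oplus> ?c 3 \<odot> act P g (e 3))" for g
      using e sm(1) cl by (simp add: L_def D.act_add D.act_smult)
    show ?thesis
    proof (cases g)
      case gen_a
      have "act P g (L f) = ?c 0 \<odot> e 1 \<oplus> (?c 2 * - 1) \<odot> e 3"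
        using e sm(1) sm(7) unfolding 1 gen_a eact by (simp del: One_nat_def flip: sm(4))
      also have "\<dots> = L (P_op r g f)"
        using e sm(1) sm(6) by (simp add: L_def gen_a lookup_P_op[OF f] del: One_nat_def)
      finally show ?thesis .
    next
      case gen_d
      have "act P g (L f) = ?c 0 \<odot> e 2 \<oplus> ?c 1 \<odot> e 3"
        using e sm(1) sm(7) unfolding 1 gen_d eact by (simp del: One_nat_def)
      also have "\<dots> = L (P_op r g f)"
        using e sm(1) sm(6) by (simp add: L_def gen_d lookup_P_op[OF f] del: One_nat_def)
      finally show ?thesis .
    next
      case gen_b
      then show ?thesis unfolding 1 unfolding L_def
        using e by (simp add: esgn lookup_P_op[OF f] \<sigma>_def mult.commute del: One_nat_def flip: sm(4))
    next
      case gen_c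
      then show ?thesis unfolding 1 unfolding L_def
        using e by (simp add: esgn lookup_P_op[OF f] \<sigma>_def mult.commute del: One_nat_def flip: sm(4))
    qed
  qed
  have closed: "P_op r g f \<in> supported {..<4}" if f: "f \<in> supported {..<4}" for g f
    using f by (cases g) (auto simp: supported_4 lookup_P_op[OF f])
  have onto: "L ` supported {..<4} = carrier P"
  proof (rule \<pi>(3))
    let ?N = "L ` supported {..<4}"
    have L0: "L 0 = \<zero>" using e sm(6) by (simp add: L_def)
    show "D4_submodule ?N P"
      unfolding D4_submodule_iff[OF D.vectorspace_axioms]
    proof (intro conjI ballI allI)
      show "?N \<subseteq> carrier P" using LP by blast
      show "\<zero> \<in> ?N" using L0 fs.subspace_0[OF subspace_supported] by (metis image_eqI)
      fix x assume "x \<in> ?N"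
      then obtain f where f: "f \<in> supported {..<4}" "x = L f" by blast
      show "x \<oplus> y \<in> ?N" if "y \<in> ?N" for y
      proof -
        from that obtain g where "g \<in> supported {..<4}" "y = L g" by blast
        then show ?thesis using f fs.subspace_add[OF subspace_supported] Ladd by (metis image_eqI)
      qed
      show "k \<odot> x \<in> ?N" for k
        using f fs.subspace_scale[OF subspace_supported] Lsm by (metis image_eqI)
      show "act P g x \<in> ?N" for g using f closed Lact by (metis image_eqI)
    qed
    then have NP: "?N \<subseteq> carrier P" by (simp add: D4_submodule_iff[OF D.vectorspace_axioms])
    have Lu: "k \<odot> u \<in> ?N" for k
    proof -
      have "L (Poly_Mapping.single 0 k) = k \<odot> u"
        using e sm(6) u(1) sm(1) by (simp add: L_def lookup_single when_def) (simp add: e_def)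
      moreover have "Poly_Mapping.single 0 k \<in> supported {..<4::nat}" by (simp add: supported_4 lookup_single)
      ultimately show ?thesis by (metis image_eqI)
    qed
    show "set_add P ?N {x \<in> carrier P. \<pi> x = 0} = carrier P"
    proof (intro subset_antisym subsetI)
      fix x assume x: "x \<in> carrier P"
      define k where "k = \<pi> x * inverse 4"
      have four: "(4::'k) \<noteq> 0" using two by (metis mult_2 mult_eq_0_iff numeral_Bit0)
      let ?y = "x \<oplus> (- k) \<odot> u"
      have "\<pi> ?y = 0" using x u sm(1) four by (simp add: \<pi>add \<pi>sm k_def)
      then have "?y \<in> {x \<in> carrier P. \<pi> x = 0}" using x u(1) sm(1) by simp
      then have "k \<odot> u \<oplus> ?y \<in> set_add P ?N {x \<in> carrier P. \<pi> x = 0}"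
        using Lu[of k] unfolding set_add_def' by blast
      moreover have "k \<odot> u \<oplus> ?y = x \<oplus> (k \<odot> u \<oplus> (- k) \<odot> u)"
        using x sm(1)[OF u(1)] by (simp add: D.a_ac)
      moreover have "k \<odot> u \<oplus> (- k) \<odot> u = \<zero>" using sm(2)[OF u(1), of k "- k"] sm(6)[OF u(1)] by simp
      moreover have "x \<oplus> \<zero> = x" using x by simp
      ultimately show "x \<in> set_add P ?N {x \<in> carrier P. \<pi> x = 0}" by simp
    qed (use NP in \<open>auto simp: set_add_def'\<close>)
  qed
  \<comment> \<open>The covering map lifts through \<open>P_fun r\<close>. The lift sends u to a
    vector with leading coordinate 4, and d a moves this coordinate to position 3, so the image of d
    a u is nonzero.\<close>
  have nz: "e 3 \<noteq> \<zero>"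
  proof -
    define p where "p f = (\<lambda>i::nat. if i = 0 then f 0 else 0)" for f :: "nat \<Rightarrow> 'k"
    define \<iota> where "\<iota> x = (\<lambda>i::nat. if i = 0 then \<pi> x else 0)" for x
    have p: "p \<in> D4_hom (P_fun r) (V_fun r)" unfolding D4_hom_def LinearCombinations.module_hom_def
      by (auto simp: p_def P_fun_def V_fun_def fun_mod_def fun_eq_iff split: gen.splits)
    have ponto: "p ` carrier (P_fun r) = carrier (V_fun r)"
    proof (intro subset_antisym subsetI)
      fix f :: "nat \<Rightarrow> 'k" assume "f \<in> carrier (V_fun r)"
      then have "f = p f" "f \<in> carrier (P_fun r)" by (auto simp: p_def P_fun_def V_fun_def fun_mod_def fun_eq_iff)
      then show "f \<in> p ` carrier (P_fun r)" by blast
    qed (auto simp: p_def V_fun_def fun_mod_def)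
    have \<iota>: "\<iota> \<in> D4_hom P (V_fun r)" unfolding D4_hom_def LinearCombinations.module_hom_def
      by (auto simp: \<iota>_def V_fun_def fun_mod_def fun_eq_iff \<pi>add \<pi>sm \<pi>act split: gen.splits)
    obtain h where h: "h \<in> D4_hom P (P_fun r)" "\<And>x. x \<in> carrier P \<Longrightarrow> p (h x) = \<iota> x"
      using proj D4_module_P_fun D4_module_V_fun p ponto \<iota> unfolding D4_projective_def by metis
    have hact: "h (act P g x) = act (P_fun r) g (h x)" if "x \<in> carrier P" for g x
      using h(1) that by (simp add: D4_hom_def)
    have "h u 0 = 4" using fun_cong[OF h(2)[OF u(1)], of 0] u(4) by (simp add: p_def \<iota>_def)
    moreover have "h (e 3) 3 = h u 0" using u cl by (simp add: e_def hact P_fun_def fun_mod_def)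
    moreover have "h \<zero> 3 = 0"
    proof -
      have "h (k \<odot> x) = k \<odot>\<^bsub>P_fun r\<^esub> h x" if "x \<in> carrier P" for k x
        using h(1) that by (simp add: D4_hom_def LinearCombinations.module_hom_def)
      from this[of \<zero> 0] show ?thesis using sm(6)[of \<zero>] by (simp add: P_fun_def fun_mod_def)
    qed
    moreover have "(4::'k) \<noteq> 0" using two by (metis mult_2 mult_eq_0_iff numeral_Bit0)
    ultimately show ?thesis by auto
  qed
  have inj: "inj_on L (supported {..<4})"
  proof (rule inj_onI)
    fix f g assume fg: "f \<in> supported {..<4}" "g \<in> supported {..<4}" "L f = L g"
    define k where "k = f - g"
    have ks: "k \<in> supported {..<4}" unfolding k_def by (rule fs.subspace_diff[OF subspace_supported fg(1,2)])
    have "L g = L k \<oplus> L g" using Ladd[of k g] fg(3) by (simp add: k_def)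
    then have Lk: "L k = \<zero>" using LP by (simp add: D.add.l_cancel_one)
    let ?c = "Poly_Mapping.lookup k"
    have c: "c = 0" if "c \<odot> e 3 = \<zero>" for c
    proof (rule ccontr)
      assume "c \<noteq> 0"
      then have "e 3 = inverse c \<odot> (c \<odot> e 3)" using e[of 3] by (simp add: sm(5) flip: sm(4))
      then show False using that sm(7) nz by simp
    qed
    have L1: "L (P_op r g' h') = \<zero>" if "L h' = \<zero>" "h' \<in> supported {..<4}" for g' h'
      using Lact[OF that(2), of g'] that(1) zero by simp
    \<comment> \<open>Applying d a isolates the coefficient of u at the nonzero vector
      \<open>e 3\<close>; after that a, d and the relation itself isolate the coefficients 2, 1 and
      3 in turn.\<close>
    have a: "L (P_op r gen_a k) = \<zero>" and d: "L (P_op r gen_d k) = \<zero>" using L1[OF Lk ks] by blast+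
    have da: "L (P_op r gen_d (P_op r gen_a k)) = \<zero>" using L1[OF a closed[OF ks]] .
    have "?c 0 = 0"
      by (rule c) (use da e sm(6,1) in \<open>simp add: L_def lookup_P_op[OF ks] lookup_P_op[OF closed[OF ks]]\<close>)
    moreover from this have "- ?c 2 = 0"
      by (intro c) (use a e sm(6,1) in \<open>simp add: L_def lookup_P_op[OF ks]\<close>)
    moreover from calculation have "?c 1 = 0"
      by (intro c) (use d e sm(6,1) in \<open>simp add: L_def lookup_P_op[OF ks]\<close>)
    moreover from calculation have "?c 3 = 0"
      by (intro c) (use Lk e sm(6,1) in \<open>simp add: L_def\<close>)
    moreover have "i = 0 \<or> i = 1 \<or> i = 2 \<or> i = 3 \<or> i \<ge> 4" for i :: nat by linarith
    ultimately have "?c i = 0" for i using ks unfolding supported_4 by (metis neg_equal_0_iff_equal)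
    then have "k = 0" by (intro poly_mapping_eqI) simp
    then show "f = g" by (simp add: k_def)
  qed
  have "model P {..<4} (P_op r) (the_inv_into (supported {..<4}) L)"
    using inj onto by (intro model_of_parametrization) (auto simp: bij_betw_def Ladd Lsm Lact closed)
  then show ?thesis using that mod by blast
qed

section \<open>Tensor products in coordinates\<close>

text \<open>The coordinates of a pure tensor, obtained from those of its factors.\<close>

definition ftens :: "('x \<Rightarrow>\<^sub>0 'k::field) \<Rightarrow> ('y \<Rightarrow>\<^sub>0 'k) \<Rightarrow> ('x \<times> 'y \<Rightarrow>\<^sub>0 'k)" where
  "ftens f g = Abs_poly_mapping (\<lambda>(i, j). Poly_Mapping.lookup f i * Poly_Mapping.lookup g j)"

lemma lookup_ftens [simp]:
  "Poly_Mapping.lookup (ftens f g) (i, j) = Poly_Mapping.lookup f i * Poly_Mapping.lookup g j"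
proof -
  have "{p. (case p of (i, j) \<Rightarrow> Poly_Mapping.lookup f i * Poly_Mapping.lookup g j) \<noteq> 0} \<subseteq>
      Poly_Mapping.keys f \<times> Poly_Mapping.keys g"
    by (auto simp: in_keys_iff)
  then have "finite {p. (case p of (i, j) \<Rightarrow> Poly_Mapping.lookup f i * Poly_Mapping.lookup g j) \<noteq> 0}"
    by (rule finite_subset) auto
  then show ?thesis by (simp add: ftens_def)
qed

lemma poly_mapping_eqI2:
  "(\<And>i j. Poly_Mapping.lookup f (i, j) = Poly_Mapping.lookup g (i, j)) \<Longrightarrow> f = g"
  by (rule poly_mapping_eqI) auto

lemma ftens_single [simp]:
  "ftens (Poly_Mapping.single i a) (Poly_Mapping.single j b) = Poly_Mapping.single (i, j) (a * b)"
  by (rule poly_mapping_eqI2) (simp add: lookup_single when_def)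

lemma linear_ftens:
  "fs_linear (\<lambda>f. ftens f g)"
  "fs_linear (\<lambda>g. ftens f g)"
  unfolding Vector_Spaces.linear_iff
  by (auto intro!: poly_mapping_eqI2 simp: fs.vector_space_axioms lookup_add algebra_simps)

text \<open>The comultiplication of \<open>comult_act\<close>, in coordinates and on pairs of basis
  vectors; bilinearity extends it to all pure tensors in \<open>tens_op_ftens\<close>.\<close>

fun tens_basis where
  "tens_basis S T gen_a (i, j) = ftens (S gen_a (unit i)) (T gen_b (unit j)) + ftens (unit i) (T gen_a (unit j))"
| "tens_basis S T gen_b (i, j) = ftens (S gen_b (unit i)) (T gen_b (unit j))"
| "tens_basis S T gen_c (i, j) = ftens (S gen_c (unit i)) (T gen_c (unit j))"
| "tens_basis S T gen_d (i, j) = ftens (S gen_d (unit i)) (T gen_c (unit j)) + ftens (unit i) (T gen_d (unit j))"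

definition tens_op ::
    "(gen \<Rightarrow> ('x \<Rightarrow>\<^sub>0 'k::field) \<Rightarrow> ('x \<Rightarrow>\<^sub>0 'k)) \<Rightarrow> (gen \<Rightarrow> ('y \<Rightarrow>\<^sub>0 'k) \<Rightarrow> ('y \<Rightarrow>\<^sub>0 'k)) \<Rightarrow>
      gen \<Rightarrow> ('x \<times> 'y \<Rightarrow>\<^sub>0 'k) \<Rightarrow> ('x \<times> 'y \<Rightarrow>\<^sub>0 'k)" where
  "tens_op S T g = fs_extend (tens_basis S T g)"

lemma bilinear_eqI:
  fixes F G :: "('x \<Rightarrow>\<^sub>0 'k::field) \<Rightarrow> ('y \<Rightarrow>\<^sub>0 'k) \<Rightarrow> ('z \<Rightarrow>\<^sub>0 'k)"
  assumes "\<And>g. fs_linear (\<lambda>f. F f g)" "\<And>f. fs_linear (\<lambda>g. F f g)"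
    and "\<And>g. fs_linear (\<lambda>f. G f g)" "\<And>f. fs_linear (\<lambda>g. G f g)"
    and "\<And>i j. F (unit i) (unit j) = G (unit i) (unit j)"
  shows "F f g = G f g"
proof (rule linear_eqI[OF assms(1,3)])
  fix i show "F (unit i) g = G (unit i) g" by (rule linear_eqI[OF assms(2,4)]) (rule assms(5))
qed

lemma tens_op_ftens:
  assumes S: "\<And>g. fs_linear (S g)" and T: "\<And>g. fs_linear (T g)"
  shows "tens_op S T gen_a (ftens f g) = ftens (S gen_a f) (T gen_b g) + ftens f (T gen_a g)"
    "tens_op S T gen_b (ftens f g) = ftens (S gen_b f) (T gen_b g)"
    "tens_op S T gen_c (ftens f g) = ftens (S gen_c f) (T gen_c g)"
    "tens_op S T gen_d (ftens f g) = ftens (S gen_d f) (T gen_c g) + ftens f (T gen_d g)"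
proof -
  note lins = fsp.linear_compose_add linear_comp[OF linear_ftens(1) linear_fs_extend]
    linear_comp[OF linear_ftens(2) linear_fs_extend] linear_comp[OF S linear_ftens(1)]
    linear_comp[OF T linear_ftens(2)] linear_ftens
  show "tens_op S T gen_a (ftens f g) = ftens (S gen_a f) (T gen_b g) + ftens f (T gen_a g)"
    unfolding tens_op_def by (rule bilinear_eqI; (intro lins)?; simp)
  show "tens_op S T gen_b (ftens f g) = ftens (S gen_b f) (T gen_b g)"
    unfolding tens_op_def by (rule bilinear_eqI; (intro lins)?; simp)
  show "tens_op S T gen_c (ftens f g) = ftens (S gen_c f) (T gen_c g)"
    unfolding tens_op_def by (rule bilinear_eqI; (intro lins)?; simp)
  show "tens_op S T gen_d (ftens f g) = ftens (S gen_d f) (T gen_c g) + ftens f (T gen_d g)"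
    unfolding tens_op_def by (rule bilinear_eqI; (intro lins)?; simp)
qed

lemma model_act: "model M I T \<gamma> \<Longrightarrow> x \<in> carrier M \<Longrightarrow> \<gamma> (act M g x) = T g (\<gamma> x)"
  by (simp add: model_def)

lemma model_supported: "model M I T \<gamma> \<Longrightarrow> x \<in> carrier M \<Longrightarrow> \<gamma> x \<in> supported I"
  by (auto simp: model_def coords_def bij_betw_def)

lemma free_on_pairs_simps:
  "carrier (free_on_pairs M N) = supported (carrier M \<times> carrier N)" "\<zero>\<^bsub>free_on_pairs M N\<^esub> = 0"
  "f \<oplus>\<^bsub>free_on_pairs M N\<^esub> g = f + g" "k \<odot>\<^bsub>free_on_pairs M N\<^esub> f = fs_scale k f"
  "act (free_on_pairs M N) x f = fs_extend (comult_act M N x) f"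
  by (simp_all add: free_on_pairs_def supported_def)

lemma vectorspace_free_on_pairs:
  fixes M :: "('k::field, 'v) D4_mod" and N :: "('k, 'w) D4_mod"
  shows "vectorspace (class_ring :: 'k ring) (free_on_pairs M N)"
proof (rule vs_criteria)
  show "field (class_ring :: 'k ring)" by (rule class_field)
  show "\<forall>v\<in>carrier (free_on_pairs M N). \<exists>w\<in>carrier (free_on_pairs M N). v \<oplus>\<^bsub>free_on_pairs M N\<^esub> w = \<zero>\<^bsub>free_on_pairs M N\<^esub>"
  proof
    fix v assume "v \<in> carrier (free_on_pairs M N)"
    then show "\<exists>w\<in>carrier (free_on_pairs M N). v \<oplus>\<^bsub>free_on_pairs M N\<^esub> w = \<zero>\<^bsub>free_on_pairs M N\<^esub>"
      by (intro bexI[of _ "- v"]) (simp_all add: free_on_pairs_simps fs.subspace_neg[OF subspace_supported])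
  qed
qed (auto simp: free_on_pairs_simps fs.subspace_0[OF subspace_supported] fs.subspace_add[OF subspace_supported]
      fs.subspace_scale[OF subspace_supported] fs.scale_left_distrib fs.scale_right_distrib algebra_simps)

text \<open>\<Phi> sends a formal sum of pairs to coordinates and kills the relations R; \<Psi>
  expands coordinates in pairs of basis vectors. As \<Phi> \<Psi> is the identity on the coordinates
  and F - \<Psi> (\<Phi> F) lies in R, \<Phi> induces a bijection on the quotient. Cosets are
  handled by hand, because the free space does not satisfy the relations of the generators and so is
  no \<open>exterior_module\<close>.\<close>

lemma tensor_model:
  fixes M :: "('k::field, 'v) D4_mod" and N :: "('k, 'w) D4_mod"
    and S :: "gen \<Rightarrow> ('x \<Rightarrow>\<^sub>0 'k) \<Rightarrow> ('x \<Rightarrow>\<^sub>0 'k)" and T :: "gen \<Rightarrow> ('y \<Rightarrow>\<^sub>0 'k) \<Rightarrow> ('y \<Rightarrow>\<^sub>0 'k)"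
  assumes M: "D4_module M" and N: "D4_module N"
    and mM: "model M I S \<gamma>M" and mN: "model N J T \<gamma>N"
    and fin: "finite I" "finite J"
    and S: "\<And>g. fs_linear (S g)" and T: "\<And>g. fs_linear (T g)"
  obtains \<gamma> where "model (M \<otimes>\<^sub>D N) (I \<times> J) (tens_op S T) \<gamma>"
proof -
  interpret M: D4_module M by (rule M)
  interpret N: D4_module N by (rule N)
  define X where "X = free_on_pairs M N"
  interpret X: vectorspace class_ring X unfolding X_def by (rule vectorspace_free_on_pairs)
  note Xs = free_on_pairs_simps[of M N, folded X_def]
  define Q where "Q = bilinearity_relations M N"
  define R where "R = X.span Q"
  have pair: "pair_sym x y \<in> supported (carrier M \<times> carrier N)" if "x \<in> carrier M" "y \<in> carrier N" for x y
    using that by (auto simp: pair_sym_def supported_iff lookup_single when_def)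
  note scl = fs.subspace_add[OF subspace_supported] fs.subspace_scale[OF subspace_supported] fs.subspace_diff[OF subspace_supported]
  have QX: "Q \<subseteq> carrier X"
    unfolding Q_def bilinearity_relations_def Xs
    using M.smult(1) N.smult(1) by (auto intro!: scl pair)
  interpret R: submodule class_ring R X unfolding R_def by (rule X.span_is_submodule[OF QX])
  have sR: "fs.subspace R"
    using R.zero_closed R.m_closed R.smult_closed unfolding fs.subspace_def Xs by simp
  have QR: "Q \<subseteq> R" unfolding R_def by (rule X.in_own_span[OF QX])
  have RX: "R \<subseteq> supported (carrier M \<times> carrier N)" using R.subset by (simp add: Xs)
  define \<Phi> where "\<Phi> = fs_extend (\<lambda>(x, y). ftens (\<gamma>M x) (\<gamma>N y))"
  have l\<Phi>: "fs_linear \<Phi>" unfolding \<Phi>_def by (rule linear_fs_extend)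
  have \<Phi>pair: "\<Phi> (pair_sym x y) = ftens (\<gamma>M x) (\<gamma>N y)" for x y by (simp add: \<Phi>_def pair_sym_def)
  note lin = fsp.linear_add[OF l\<Phi>] fsp.linear_scale[OF l\<Phi>] fsp.linear_diff[OF l\<Phi>]
  have \<gamma>add: "\<gamma>M (x \<oplus>\<^bsub>M\<^esub> x') = \<gamma>M x + \<gamma>M x'" "\<gamma>M (k \<odot>\<^bsub>M\<^esub> x) = fs_scale k (\<gamma>M x)"
    if "x \<in> carrier M" "x' \<in> carrier M" for x x' k using mM that by (simp_all add: model_def coords_def)
  have \<gamma>addN: "\<gamma>N (x \<oplus>\<^bsub>N\<^esub> x') = \<gamma>N x + \<gamma>N x'" "\<gamma>N (k \<odot>\<^bsub>N\<^esub> x) = fs_scale k (\<gamma>N x)"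
    if "x \<in> carrier N" "x' \<in> carrier N" for x x' k using mN that by (simp_all add: model_def coords_def)
  have \<Phi>Q: "\<Phi> f = 0" if "f \<in> Q" for f
    using that unfolding Q_def bilinearity_relations_def
    by (auto simp: lin \<Phi>pair \<gamma>add \<gamma>addN fsp.linear_add[OF linear_ftens(1)] fsp.linear_add[OF linear_ftens(2)]
        fsp.linear_scale[OF linear_ftens(1)] fsp.linear_scale[OF linear_ftens(2)])
  have \<Phi>R: "\<Phi> f = 0" if "f \<in> R" for f
  proof -
    let ?Z = "{f \<in> carrier X. \<Phi> f = 0}"
    have "submodule class_ring ?Z X"
      by (rule submodule.intro)
        (auto simp: X.module_axioms Xs scl lin fs.subspace_0[OF subspace_supported] fsp.linear_0[OF l\<Phi>])
    then have "R \<subseteq> ?Z" unfolding R_def using \<Phi>Q QX by (intro X.span_is_subset) auto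
    then show ?thesis using that by blast
  qed
  have bM: "bij_betw \<gamma>M (carrier M) (supported I)" and bN: "bij_betw \<gamma>N (carrier N) (supported J)"
    using mM mN by (simp_all add: model_def coords_def)
  define \<xi> where "\<xi> = the_inv_into (carrier M) \<gamma>M"
  define \<upsilon> where "\<upsilon> = the_inv_into (carrier N) \<gamma>N"
  have \<xi>: "\<xi> f \<in> carrier M" "\<gamma>M (\<xi> f) = f" if "f \<in> supported I" for f
    using bM that bij_betw_the_inv_into[OF bM] f_the_inv_into_f[of \<gamma>M "carrier M" f]
    by (auto simp: \<xi>_def bij_betw_def)
  have \<upsilon>: "\<upsilon> f \<in> carrier N" "\<gamma>N (\<upsilon> f) = f" if "f \<in> supported J" for f
    using bN that bij_betw_the_inv_into[OF bN] f_the_inv_into_f[of \<gamma>N "carrier N" f]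
    by (auto simp: \<upsilon>_def bij_betw_def)
  have \<xi>\<gamma>: "\<xi> (\<gamma>M x) = x" if "x \<in> carrier M" for x
    using bM that by (simp add: \<xi>_def bij_betw_def the_inv_into_f_f)
  have \<upsilon>\<gamma>: "\<upsilon> (\<gamma>N x) = x" if "x \<in> carrier N" for x
    using bN that by (simp add: \<upsilon>_def bij_betw_def the_inv_into_f_f)
  have \<xi>lin: "\<xi> (f + g) = \<xi> f \<oplus>\<^bsub>M\<^esub> \<xi> g" "\<xi> (fs_scale k f) = k \<odot>\<^bsub>M\<^esub> \<xi> f"
    if "f \<in> supported I" "g \<in> supported I" for f g k
    using \<xi>\<gamma>[of "\<xi> f \<oplus>\<^bsub>M\<^esub> \<xi> g"] \<xi>\<gamma>[of "k \<odot>\<^bsub>M\<^esub> \<xi> f"] \<xi>[OF that(1)] \<xi>[OF that(2)] \<gamma>add M.smult(1) by simp_all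
  have \<upsilon>lin: "\<upsilon> (f + g) = \<upsilon> f \<oplus>\<^bsub>N\<^esub> \<upsilon> g" "\<upsilon> (fs_scale k f) = k \<odot>\<^bsub>N\<^esub> \<upsilon> f"
    if "f \<in> supported J" "g \<in> supported J" for f g k
    using \<upsilon>\<gamma>[of "\<upsilon> f \<oplus>\<^bsub>N\<^esub> \<upsilon> g"] \<upsilon>\<gamma>[of "k \<odot>\<^bsub>N\<^esub> \<upsilon> f"] \<upsilon>[OF that(1)] \<upsilon>[OF that(2)] \<gamma>addN N.smult(1) by simp_all
  define \<Psi> where "\<Psi> = fs_extend (\<lambda>(i, j). pair_sym (\<xi> (unit i)) (\<upsilon> (unit j)) :: 'v \<times> 'w \<Rightarrow>\<^sub>0 'k)"
  have l\<Psi>: "fs_linear \<Psi>" unfolding \<Psi>_def by (rule linear_fs_extend)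
  note uI = unit_supported[of _ I] and uJ = unit_supported[of _ J]
  have relM: "pair_sym (x \<oplus>\<^bsub>M\<^esub> x') y - pair_sym x y - pair_sym x' y \<in> R" "pair_sym (k \<odot>\<^bsub>M\<^esub> x) y - fs_scale k (pair_sym x y) \<in> R"
    if "x \<in> carrier M" "x' \<in> carrier M" "y \<in> carrier N" for x x' y k
  proof -
    have "pair_sym (x \<oplus>\<^bsub>M\<^esub> x') y - pair_sym x y - pair_sym x' y \<in> Q"
      unfolding Q_def bilinearity_relations_def
      by (rule UnI1, rule UnI1, rule UnI1, rule CollectI, rule exI[of _ x], rule exI[of _ x'], rule exI[of _ y])
        (use that in simp)
    moreover have "pair_sym (k \<odot>\<^bsub>M\<^esub> x) y - fs_scale k (pair_sym x y) \<in> Q"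
      unfolding Q_def bilinearity_relations_def
      by (rule UnI1, rule UnI2, rule CollectI, rule exI[of _ k], rule exI[of _ x], rule exI[of _ y])
        (use that in simp)
    ultimately show "pair_sym (x \<oplus>\<^bsub>M\<^esub> x') y - pair_sym x y - pair_sym x' y \<in> R"
      "pair_sym (k \<odot>\<^bsub>M\<^esub> x) y - fs_scale k (pair_sym x y) \<in> R" using QR by auto
  qed
  have relN: "pair_sym x (y \<oplus>\<^bsub>N\<^esub> y') - pair_sym x y - pair_sym x y' \<in> R" "pair_sym x (k \<odot>\<^bsub>N\<^esub> y) - fs_scale k (pair_sym x y) \<in> R"
    if "x \<in> carrier M" "y \<in> carrier N" "y' \<in> carrier N" for x y y' k
  proof -
    have "pair_sym x (y \<oplus>\<^bsub>N\<^esub> y') - pair_sym x y - pair_sym x y' \<in> Q"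
      unfolding Q_def bilinearity_relations_def
      by (rule UnI1, rule UnI1, rule UnI2, rule CollectI, rule exI[of _ x], rule exI[of _ y], rule exI[of _ y'])
        (use that in simp)
    moreover have "pair_sym x (k \<odot>\<^bsub>N\<^esub> y) - fs_scale k (pair_sym x y) \<in> Q"
      unfolding Q_def bilinearity_relations_def
      by (rule UnI2, rule CollectI, rule exI[of _ k], rule exI[of _ x], rule exI[of _ y]) (use that in simp)
    ultimately show "pair_sym x (y \<oplus>\<^bsub>N\<^esub> y') - pair_sym x y - pair_sym x y' \<in> R"
      "pair_sym x (k \<odot>\<^bsub>N\<^esub> y) - fs_scale k (pair_sym x y) \<in> R" using QR by auto
  qed
  have scale_rels: "\<xi> (fs_scale k f) = k \<odot>\<^bsub>M\<^esub> \<xi> f" "\<upsilon> (fs_scale k g) = k \<odot>\<^bsub>N\<^esub> \<upsilon> g"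
    "pair_sym (k \<odot>\<^bsub>M\<^esub> x) y - fs_scale k (pair_sym x y) \<in> R" "pair_sym x (k \<odot>\<^bsub>N\<^esub> y) - fs_scale k (pair_sym x y) \<in> R"
    if "f \<in> supported I" "g \<in> supported J" "x \<in> carrier M" "y \<in> carrier N" for f g x y k
    using \<xi>lin(2)[OF that(1,1)] \<upsilon>lin(2)[OF that(2,2)] relM(2)[OF that(3,3,4)] relN(2)[OF that(3,4,4)] by auto
  have lid: "fs_linear (\<lambda>f. f)" by (rule fs.linear_ident)
  \<comment> \<open>\<open>pair_sym\<close> is linear in each argument only modulo R. The functions
    on which F and a linear G agree modulo R still form a subspace, so agreement may be checked on
    basis vectors.\<close>
  have sub: "fs.subspace {f \<in> supported I'. F f - G f \<in> R}"
    if G: "fs_linear G"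
      and add: "\<And>f g. f \<in> supported I' \<Longrightarrow> g \<in> supported I' \<Longrightarrow> F (f + g) - F f - F g \<in> R"
      and sm: "\<And>f k. f \<in> supported I' \<Longrightarrow> F (fs_scale k f) - fs_scale k (F f) \<in> R"
    for I' :: "'z set" and F G :: "('z \<Rightarrow>\<^sub>0 'k) \<Rightarrow> ('v \<times> 'w \<Rightarrow>\<^sub>0 'k)"
    unfolding fs.subspace_def
  proof (intro conjI ballI allI)
    have z: "(0 :: 'z \<Rightarrow>\<^sub>0 'k) \<in> supported I'" by (rule fs.subspace_0[OF subspace_supported])
    have "F 0 \<in> R" using sm[OF z, of 0] by simp
    then show "0 \<in> {f \<in> supported I'. F f - G f \<in> R}" using z fsp.linear_0[OF G] by simp
    fix f assume f: "f \<in> {f \<in> supported I'. F f - G f \<in> R}"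
    { fix g assume g: "g \<in> {f \<in> supported I'. F f - G f \<in> R}"
      have "(F (f + g) - F f - F g) + ((F f - G f) + (F g - G g)) \<in> R"
        using f g add by (intro fs.subspace_add[OF sR]) auto
      moreover have "(F (f + g) - F f - F g) + ((F f - G f) + (F g - G g)) = F (f + g) - G (f + g)"
        by (simp add: fsp.linear_add[OF G])
      ultimately show "f + g \<in> {f \<in> supported I'. F f - G f \<in> R}" using f g scl(1) by auto }
    show "fs_scale k f \<in> {f \<in> supported I'. F f - G f \<in> R}" for k
    proof -
      have "(F (fs_scale k f) - fs_scale k (F f)) + fs_scale k (F f - G f) \<in> R"
        using f sm by (intro fs.subspace_add[OF sR] fs.subspace_scale[OF sR]) auto
      moreover have "(F (fs_scale k f) - fs_scale k (F f)) + fs_scale k (F f - G f) = F (fs_scale k f) - G (fs_scale k f)"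
        by (simp add: fsp.linear_scale[OF G] fs.scale_right_diff_distrib)
      ultimately show ?thesis using f scl(2) by auto
    qed
  qed
  \<comment> \<open>First by linearity in g with a basis vector on the left, then by linearity in
    f.\<close>
  have key: "pair_sym (\<xi> f) (\<upsilon> g) - \<Psi> (ftens f g) \<in> R" if f: "f \<in> supported I" and g: "g \<in> supported J" for f g
  proof -
    have 1: "pair_sym (\<xi> (unit i)) (\<upsilon> g) - \<Psi> (ftens (unit i) g) \<in> R" if i: "i \<in> I" for i
    proof -
      have "g \<in> {g \<in> supported J. pair_sym (\<xi> (unit i)) (\<upsilon> g) - \<Psi> (ftens (unit i) g) \<in> R}"
      proof (rule linear_in_subspace_on_supported[OF lid sub fin(2) g])
        show "fs_linear (\<lambda>g. \<Psi> (ftens (unit i) g))"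
          by (rule linear_comp[OF linear_ftens(2) l\<Psi>])
        show "unit j \<in> {g \<in> supported J. pair_sym (\<xi> (unit i)) (\<upsilon> g) - \<Psi> (ftens (unit i) g) \<in> R}" if "j \<in> J" for j
          using uJ[OF that] fs.subspace_0[OF sR] by (simp add: \<Psi>_def)
        show "pair_sym (\<xi> (unit i)) (\<upsilon> (fs_scale k h)) - fs_scale k (pair_sym (\<xi> (unit i)) (\<upsilon> h)) \<in> R"
          if "h \<in> supported J" for h k
          using scale_rels(2,4)[OF uI[OF i] that \<xi>(1)[OF uI[OF i]] \<upsilon>(1)[OF that]] by simp
      qed (use \<xi>[OF uI[OF i]] \<upsilon> \<upsilon>lin(1) relN(1) in simp_all)
      then show ?thesis by simp
    qed
    have "f \<in> {f \<in> supported I. pair_sym (\<xi> f) (\<upsilon> g) - \<Psi> (ftens f g) \<in> R}"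
    proof (rule linear_in_subspace_on_supported[OF lid sub fin(1) f])
      show "fs_linear (\<lambda>f. \<Psi> (ftens f g))"
        by (rule linear_comp[OF linear_ftens(1) l\<Psi>])
      show "unit i \<in> {f \<in> supported I. pair_sym (\<xi> f) (\<upsilon> g) - \<Psi> (ftens f g) \<in> R}" if "i \<in> I" for i
        using uI[OF that] 1[OF that] by simp
      show "pair_sym (\<xi> (fs_scale k h)) (\<upsilon> g) - fs_scale k (pair_sym (\<xi> h) (\<upsilon> g)) \<in> R"
        if "h \<in> supported I" for h k
        using scale_rels(1,3)[OF that g \<xi>(1)[OF that] \<upsilon>(1)[OF g]] by simp
    qed (use \<upsilon>[OF g] \<xi> \<xi>lin(1) relM(1) in simp_all)
    then show ?thesis by simp
  qed
  have \<Psi>\<Phi>: "F - \<Psi> (\<Phi> F) \<in> R" if F: "F \<in> supported (carrier M \<times> carrier N)" for F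
  proof (rule linear_in_subspace_on_supported[of "\<lambda>F. F - \<Psi> (\<Phi> F)", OF _ sR])
    show "fs_linear (\<lambda>F. F - \<Psi> (\<Phi> F))"
      by (intro fsp.linear_compose_sub lid linear_comp[OF l\<Phi> l\<Psi>])
    show "unit p - \<Psi> (\<Phi> (unit p)) \<in> R" if p: "p \<in> Poly_Mapping.keys F" for p
    proof -
      obtain x y where xy: "p = (x, y)" "x \<in> carrier M" "y \<in> carrier N" using p F by (auto simp: supported_def)
      have "pair_sym (\<xi> (\<gamma>M x)) (\<upsilon> (\<gamma>N y)) - \<Psi> (ftens (\<gamma>M x) (\<gamma>N y)) \<in> R"
        using xy by (intro key model_supported[OF mM] model_supported[OF mN])
      then show ?thesis using xy \<xi>\<gamma> \<upsilon>\<gamma> \<Phi>pair[of x y] by (simp add: pair_sym_def)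
    qed
  qed (auto simp: supported_def)
  have \<Phi>IJ: "\<Phi> F \<in> supported (I \<times> J)" if F: "F \<in> supported (carrier M \<times> carrier N)" for F
  proof (rule linear_in_subspace_on_supported[OF l\<Phi> subspace_supported])
    show "\<Phi> (unit p) \<in> supported (I \<times> J)" if p: "p \<in> Poly_Mapping.keys F" for p
    proof -
      obtain x y where xy: "p = (x, y)" "x \<in> carrier M" "y \<in> carrier N" using p F by (auto simp: supported_def)
      then show ?thesis using \<Phi>pair[of x y] model_supported[OF mM xy(2)] model_supported[OF mN xy(3)]
        by (auto simp: pair_sym_def supported_iff)
    qed
  qed (auto simp: supported_def)
  have onto: "\<exists>F\<in>supported (carrier M \<times> carrier N). \<Phi> F = G" if G: "G \<in> supported (I \<times> J)" for G
  proof
    show "\<Phi> (\<Psi> G) = G"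
      by (rule linear_eq_on_supported[OF linear_comp[OF l\<Psi> l\<Phi>] lid _ G])
        (use fin \<xi>[OF uI] \<upsilon>[OF uJ] in \<open>auto simp: \<Psi>_def \<Phi>pair\<close>)
    show "\<Psi> G \<in> supported (carrier M \<times> carrier N)"
      by (rule linear_in_subspace_on_supported[OF l\<Psi> subspace_supported _ G])
        (use fin \<xi>[OF uI] \<upsilon>[OF uJ] in \<open>auto simp: \<Psi>_def intro: pair\<close>)
  qed
  have equiv: "\<Phi> (fs_extend (comult_act M N g) F) = tens_op S T g (\<Phi> F)"
    if F: "F \<in> supported (carrier M \<times> carrier N)" for F g
  proof (rule linear_eq_on_supported[of "\<lambda>F. \<Phi> (fs_extend (comult_act M N g) F)" "\<lambda>F. tens_op S T g (\<Phi> F)"])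
    show "fs_linear (\<lambda>F. \<Phi> (fs_extend (comult_act M N g) F))"
      by (rule linear_comp[OF linear_fs_extend l\<Phi>])
    show "fs_linear (\<lambda>F. tens_op S T g (\<Phi> F))"
      unfolding tens_op_def by (rule linear_comp[OF l\<Phi> linear_fs_extend])
    show "\<Phi> (fs_extend (comult_act M N g) (unit p)) = tens_op S T g (\<Phi> (unit p))" if p: "p \<in> Poly_Mapping.keys F" for p
    proof -
      obtain x y where xy: "p = (x, y)" "x \<in> carrier M" "y \<in> carrier N" using p F by (auto simp: supported_def)
      have "\<Phi> (unit p) = ftens (\<gamma>M x) (\<gamma>N y)" using \<Phi>pair[of x y] by (simp add: pair_sym_def xy)
      then show ?thesis using xy
        by (cases g) (simp_all add: lin \<Phi>pair tens_op_ftens[OF S T] model_act[OF mM] model_act[OF mN])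
    qed
  qed (auto simp: supported_def)
  \<comment> \<open>The chosen representative does not matter, as \<Phi> is constant on cosets of
    R.\<close>
  define \<gamma> where "\<gamma> Z = \<Phi> (SOME z. z \<in> Z)" for Z
  have \<gamma>I: "\<gamma> Z = v" if "Z \<noteq> {}" "\<And>z. z \<in> Z \<Longrightarrow> \<Phi> z = v" for Z v
    unfolding \<gamma>_def using that someI_ex[of "\<lambda>z. z \<in> Z"] by blast
  define cs where "cs F = (\<lambda>h. h + F) ` R" for F
  have cs: "R +>\<^bsub>X\<^esub> F = cs F" for F by (auto simp: a_r_coset_def' cs_def Xs)
  have F_cs: "F \<in> cs F" for F using fs.subspace_0[OF sR] by (force simp: cs_def)
  have ne: "cs F \<noteq> {}" for F using F_cs by blast
  have \<Phi>cs: "\<Phi> z = \<Phi> F" if "z \<in> cs F" for z F using that \<Phi>R by (auto simp: cs_def lin)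
  have \<gamma>cs: "\<gamma> (cs F) = \<Phi> F" for F using F_cs \<Phi>cs by (intro \<gamma>I) blast+
  have ten: "M \<otimes>\<^sub>D N = D4_quotient X R" by (simp add: D4_tensor_def X_def R_def Q_def)
  have carr: "carrier (M \<otimes>\<^sub>D N) = cs ` supported (carrier M \<times> carrier N)"
    by (auto simp: ten D4_quotient_def A_RCOSETS_def' cs Xs)
  have R0: "0 \<in> R" by (rule fs.subspace_0[OF sR])
  have "model (M \<otimes>\<^sub>D N) (I \<times> J) (tens_op S T) \<gamma>"
    unfolding model_def coords_def
  proof (intro conjI ballI allI)
    show "bij_betw \<gamma> (carrier (M \<otimes>\<^sub>D N)) (supported (I \<times> J))"
    proof (rule bij_betw_imageI)
      show "inj_on \<gamma> (carrier (M \<otimes>\<^sub>D N))"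
      proof (rule inj_onI)
        fix Z Z' assume "Z \<in> carrier (M \<otimes>\<^sub>D N)" "Z' \<in> carrier (M \<otimes>\<^sub>D N)" and e: "\<gamma> Z = \<gamma> Z'"
        then obtain F F' where F: "F \<in> supported (carrier M \<times> carrier N)" "Z = cs F"
          "F' \<in> supported (carrier M \<times> carrier N)" "Z' = cs F'" unfolding carr by blast
        have "\<Phi> (F - F') = 0" using e F by (simp add: \<gamma>cs lin)
        then have d: "F - F' \<in> R" using \<Psi>\<Phi>[OF scl(3)[OF F(1,3)]] fsp.linear_0[OF l\<Psi>] by simp
        have "h + F \<in> cs F'" if "h \<in> R" for h
          unfolding cs_def by (rule image_eqI[of _ _ "h + (F - F')"]) (use fs.subspace_add[OF sR that d] in auto)
        moreover have "h + F' \<in> cs F" if "h \<in> R" for h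
          unfolding cs_def by (rule image_eqI[of _ _ "h - (F - F')"]) (use fs.subspace_diff[OF sR that d] in auto)
        ultimately show "Z = Z'" unfolding F cs_def by blast
      qed
      show "\<gamma> ` carrier (M \<otimes>\<^sub>D N) = supported (I \<times> J)"
        unfolding carr using onto \<Phi>IJ by (auto simp: \<gamma>cs image_iff) metis
    qed
    fix Z assume "Z \<in> carrier (M \<otimes>\<^sub>D N)"
    then obtain F where F: "F \<in> supported (carrier M \<times> carrier N)" "Z = cs F" unfolding carr by blast
    { fix Z' assume "Z' \<in> carrier (M \<otimes>\<^sub>D N)"
      then obtain F' where F': "F' \<in> supported (carrier M \<times> carrier N)" "Z' = cs F'" unfolding carr by blast
      show "\<gamma> (Z \<oplus>\<^bsub>M \<otimes>\<^sub>D N\<^esub> Z') = \<gamma> Z + \<gamma> Z'" unfolding F F' \<gamma>cs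
        using F_cs \<Phi>cs by (intro \<gamma>I) (auto simp: ten D4_quotient_def set_add_def' Xs lin) }
    show "\<gamma> (k \<odot>\<^bsub>M \<otimes>\<^sub>D N\<^esub> Z) = fs_scale k (\<gamma> Z)" for k unfolding F \<gamma>cs
      using ne \<Phi>cs R0 \<Phi>R by (intro \<gamma>I) (auto simp: ten D4_quotient_def set_add_def' Xs lin)
    have "z \<in> supported (carrier M \<times> carrier N)" if "z \<in> cs F" for z
      using that RX F(1) scl(1) by (auto simp: cs_def)
    then show "\<gamma> (act (M \<otimes>\<^sub>D N) g Z) = tens_op S T g (\<gamma> Z)" for g unfolding F \<gamma>cs
      using ne \<Phi>cs R0 \<Phi>R by (intro \<gamma>I) (auto simp: ten D4_quotient_def set_add_def' Xs lin equiv)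
  qed
  then show ?thesis using that by blast
qed

section \<open>Generators of the tensor product\<close>

fun P_vec :: "(gen \<Rightarrow> ('x \<Rightarrow>\<^sub>0 'k::field) \<Rightarrow> ('x \<Rightarrow>\<^sub>0 'k)) \<Rightarrow> ('x \<Rightarrow>\<^sub>0 'k) \<Rightarrow> nat \<Rightarrow> ('x \<Rightarrow>\<^sub>0 'k)" where
  "P_vec \<tau> u i = (if i = 0 then u else if i = 1 then \<tau> gen_a u else if i = 2 then \<tau> gen_d u else \<tau> gen_d (\<tau> gen_a u))"

lemma P_op_closed: "f \<in> supported {..<4} \<Longrightarrow> P_op r g f \<in> supported {..<4}"
  by (cases g) (auto simp: supported_4 lookup_P_op)

locale normal_tensor =
  fixes r r' :: bit and \<eta> :: "'k::field proj_line" and s t :: nat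
  assumes pos: "1 \<le> s" "s \<le> t"
begin

abbreviation X :: "nat \<Rightarrow> bool \<times> nat" where "X i \<equiv> (False, i)"
abbreviation Y :: "nat \<Rightarrow> bool \<times> nat" where "Y i \<equiv> (True, i)"

type_synonym 'c tvec = "(bool \<times> nat) \<times> (bool \<times> nat) \<Rightarrow>\<^sub>0 'c"

definition \<tau> :: "gen \<Rightarrow> 'k tvec \<Rightarrow> 'k tvec" where
  "\<tau> = tens_op (M_op r \<eta>) (M_op r' \<eta>)"

text \<open>The action of h \<otimes> b + 1 \<otimes> h, the shape shared by the coproducts of a and
  d once c acts as b.\<close>

definition pair_map :: "(bool \<times> nat \<Rightarrow> (bool \<times> nat \<Rightarrow>\<^sub>0 'k)) \<Rightarrow> 'k tvec \<Rightarrow> 'k tvec" where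
  "pair_map h = fs_extend (\<lambda>(p, q). ftens (h p) (sign_b r' q) + ftens (unit p) (h q))"

definition A :: "'k tvec \<Rightarrow> 'k tvec" where "A = pair_map up"
definition D :: "'k tvec \<Rightarrow> 'k tvec" where "D = pair_map down"

text \<open>
  \<open>A\<close> and \<open>D\<close> are the actions of the linear combinations of \<open>a\<close> and \<open>d\<close> that act as \<open>up\<close> and \<open>down\<close>
  on modules in normal form; the comultiplication is linear on these combinations because
  \<open>b\<close> and \<open>c\<close> act in the same way.
\<close>

lemma linear_A: "fs_linear A"
  and linear_D: "fs_linear D"
  and linear_\<tau>: "fs_linear (\<tau> g)"
  unfolding A_def D_def \<tau>_def tens_op_def pair_map_def by (rule linear_fs_extend)+

lemma A_unit:
  "A (unit (X i, X j)) = unit (X i, Y j) - fs_scale (sgn2 r') (unit (Y i, X j))"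
  "A (unit (X i, Y j)) = fs_scale (sgn2 r') (unit (Y i, Y j))"
  "A (unit (Y i, X j)) = unit (Y i, Y j)"
  "A (unit (Y i, Y j)) = 0"
  by (auto intro!: poly_mapping_eqI2 simp: A_def pair_map_def sign_b_def lookup_add lookup_minus lookup_single when_def)

lemma D_unit:
  "D (unit (X i, X j)) = (case j of 0 \<Rightarrow> 0 | Suc j' \<Rightarrow> unit (X i, Y j')) -
     (case i of 0 \<Rightarrow> 0 | Suc i' \<Rightarrow> fs_scale (sgn2 r') (unit (Y i', X j)))"
  "D (unit (X i, Y j)) = (case i of 0 \<Rightarrow> 0 | Suc i' \<Rightarrow> fs_scale (sgn2 r') (unit (Y i', Y j)))"
  "D (unit (Y i, X j)) = (case j of 0 \<Rightarrow> 0 | Suc j' \<Rightarrow> unit (Y i, Y j'))"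
  "D (unit (Y i, Y j)) = 0"
  by (auto intro!: poly_mapping_eqI2 split: nat.split
      simp: D_def pair_map_def sign_b_def lookup_add lookup_minus lookup_single when_def)

lemma \<tau>_b_unit:
  "\<tau> gen_b (unit (p, q)) = fs_scale ((if fst p then sgn2 r else - sgn2 r) * (if fst q then sgn2 r' else - sgn2 r')) (unit (p, q))"
  "\<tau> gen_c f = \<tau> gen_b f"
proof -
  show "\<tau> gen_b (unit (p, q)) = fs_scale ((if fst p then sgn2 r else - sgn2 r) * (if fst q then sgn2 r' else - sgn2 r')) (unit (p, q))"
    by (rule poly_mapping_eqI2) (auto simp: \<tau>_def tens_op_def sign_b_def lookup_single when_def)
  show "\<tau> gen_c f = \<tau> gen_b f"
    by (rule linear_eqI[OF linear_\<tau> linear_\<tau>]) (auto simp: \<tau>_def tens_op_def)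
qed

lemma \<tau>_pencil: "\<tau> gen_a = pencil_a \<eta> A D" "\<tau> gen_d = pencil_d \<eta> A D"
proof -
  show "\<tau> gen_a = pencil_a \<eta> A D"
  proof (rule ext, rule linear_eqI[OF linear_\<tau> linear_pencil(1)[OF linear_A linear_D]])
    fix p :: "(bool \<times> nat) \<times> (bool \<times> nat)"
    show "\<tau> gen_a (unit p) = pencil_a \<eta> A D (unit p)"
      unfolding \<tau>_def A_def D_def pair_map_def tens_op_def
      by (cases p; cases \<eta>) simp_all
  qed
  show "\<tau> gen_d = pencil_d \<eta> A D"
  proof (rule ext, rule linear_eqI[OF linear_\<tau> linear_pencil(2)[OF linear_A linear_D]])
    fix p :: "(bool \<times> nat) \<times> (bool \<times> nat)"
    show "\<tau> gen_d (unit p) = pencil_d \<eta> A D (unit p)"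
      unfolding \<tau>_def A_def D_def pair_map_def tens_op_def
      by (cases p; cases \<eta>)
        (simp_all add: fsp.linear_diff[OF linear_ftens(1)]
          fsp.linear_diff[OF linear_ftens(2)] fsp.linear_scale[OF linear_ftens(1)]
          fsp.linear_scale[OF linear_ftens(2)] fs.scale_right_distrib)
  qed
qed

lemma cases_pq:
  obtains i j where "p = (X i, X j)" | i j where "p = (X i, Y j)" | i j where "p = (Y i, X j)" | i j where "p = (Y i, Y j)"
  by (cases p) (metis (full_types) surj_pair)

lemma unit_relI:
  fixes F G :: "'k tvec \<Rightarrow> 'k tvec"
  assumes "fs_linear F" "fs_linear G"
    "\<And>i j. F (unit (X i, X j)) = G (unit (X i, X j))" "\<And>i j. F (unit (X i, Y j)) = G (unit (X i, Y j))"
    "\<And>i j. F (unit (Y i, X j)) = G (unit (Y i, X j))" "\<And>i j. F (unit (Y i, Y j)) = G (unit (Y i, Y j))"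
  shows "F f = G f"
proof (rule linear_eqI[OF assms(1,2)])
  fix p show "F (unit p) = G (unit p)" by (cases p rule: cases_pq) (simp_all add: assms)
qed

lemmas linA = fsp.linear_diff[OF linear_A] fsp.linear_scale[OF linear_A] fsp.linear_0[OF linear_A]
  fsp.linear_add[OF linear_A] fsp.linear_neg[OF linear_A]
lemmas linD = fsp.linear_diff[OF linear_D] fsp.linear_scale[OF linear_D] fsp.linear_0[OF linear_D]
  fsp.linear_add[OF linear_D] fsp.linear_neg[OF linear_D]
lemmas lin\<tau> = fsp.linear_diff[OF linear_\<tau>] fsp.linear_scale[OF linear_\<tau>] fsp.linear_0[OF linear_\<tau>]
  fsp.linear_add[OF linear_\<tau>] fsp.linear_neg[OF linear_\<tau>]

lemma linear_zero: "fs_linear (\<lambda>f. 0)"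
  by (rule fsp.linear_zero)

lemma linear_minus: "fs_linear F \<Longrightarrow> fs_linear (\<lambda>f. - F f)"
  by (rule fsp.linear_compose_neg)

text \<open>Checked on basis vectors. In the products of A and D the cross terms cancel because b on
  the second factor anticommutes with \<open>up\<close> and \<open>down\<close>.\<close>

lemma AD_rels: "A (A f) = 0" "D (D f) = 0" "A (D f) = - D (A f)"
  "\<tau> gen_b (A f) = - A (\<tau> gen_b f)" "\<tau> gen_b (D f) = - D (\<tau> gen_b f)" "\<tau> gen_b (\<tau> gen_b f) = f"
proof -
  note c = linear_comp[OF linear_A linear_A] linear_comp[OF linear_D linear_D] linear_comp[OF linear_D linear_A]
    linear_comp[OF linear_A linear_D] linear_comp[OF linear_A linear_\<tau>] linear_comp[OF linear_\<tau> linear_A]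
    linear_comp[OF linear_D linear_\<tau>] linear_comp[OF linear_\<tau> linear_D] linear_comp[OF linear_\<tau> linear_\<tau>]
    linear_zero fs.linear_ident
  note sm = A_unit D_unit linA linD lin\<tau> \<tau>_b_unit(1)
  show "A (A f) = 0" by (rule unit_relI; (intro c)?; simp add: sm)
  show "D (D f) = 0" by (rule unit_relI; (intro c)?; simp add: sm split: nat.split)
  show "A (D f) = - D (A f)" by (rule unit_relI; (intro c linear_minus)?; simp add: sm split: nat.split)
  show "\<tau> gen_b (A f) = - A (\<tau> gen_b f)"
    by (rule unit_relI; (intro c linear_minus)?; simp add: sm algebra_simps)
  show "\<tau> gen_b (D f) = - D (\<tau> gen_b f)"
    by (rule unit_relI; (intro c linear_minus)?; simp add: sm algebra_simps split: nat.split)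
  have q: "(x * y) * (x * y) = 1" if "x * x = 1" "y * y = 1" for x y :: 'k
  proof -
    have "(x * y) * (x * y) = (x * x) * (y * y)" by (simp add: mult_ac)
    then show ?thesis using that by simp
  qed
  have "\<tau> gen_b (\<tau> gen_b (unit p)) = unit p" for p
    by (cases p) (simp add: \<tau>_b_unit(1) lin\<tau> q)
  then show "\<tau> gen_b (\<tau> gen_b f) = f"
    by (rule linear_eqI[OF linear_comp[OF linear_\<tau> linear_\<tau>] fs.linear_ident])
qed

lemma \<tau>_rels: "\<tau> gen_a (\<tau> gen_a f) = 0" "\<tau> gen_d (\<tau> gen_d f) = 0" "\<tau> gen_a (\<tau> gen_d f) = - \<tau> gen_d (\<tau> gen_a f)"
  "\<tau> gen_b (\<tau> gen_a f) = - \<tau> gen_a (\<tau> gen_b f)" "\<tau> gen_b (\<tau> gen_d f) = - \<tau> gen_d (\<tau> gen_b f)"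
proof -
  have "(\<exists>e. \<tau> gen_a = A \<and> \<tau> gen_d = (\<lambda>x. D x - fs_scale e (A x))) \<or> \<tau> gen_a = D \<and> \<tau> gen_d = A"
    unfolding \<tau>_pencil by (cases \<eta>) auto
  then consider e where "\<tau> gen_a = A" "\<tau> gen_d = (\<lambda>x. D x - fs_scale e (A x))"
    | "\<tau> gen_a = D" "\<tau> gen_d = A" by blast
  note cs = this
  note sm = AD_rels(1-5) linA linD lin\<tau>[where g = gen_b] fs.scale_right_diff_distrib
  show "\<tau> gen_a (\<tau> gen_a f) = 0" "\<tau> gen_d (\<tau> gen_d f) = 0" "\<tau> gen_a (\<tau> gen_d f) = - \<tau> gen_d (\<tau> gen_a f)"
    "\<tau> gen_b (\<tau> gen_a f) = - \<tau> gen_a (\<tau> gen_b f)" "\<tau> gen_b (\<tau> gen_d f) = - \<tau> gen_d (\<tau> gen_b f)"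
    by (cases rule: cs; simp add: sm)+
qed

text \<open>Any b-eigenvector generates an image of the normal form of P, because on the tensor
  product a and d satisfy the exterior relations and anticommute with b.\<close>

lemma P_equivariant:
  assumes u: "\<tau> gen_b u = fs_scale (sgn2 \<sigma>) u" and f: "f \<in> supported {..<4}"
  shows "\<tau> g (fs_extend (P_vec \<tau> u) f) = fs_extend (P_vec \<tau> u) (P_op \<sigma> g f)"
proof (rule linear_eq_on_supported[OF linear_comp[OF linear_fs_extend linear_\<tau>] linear_comp[OF _ linear_fs_extend] _ f])
  show "fs_linear (P_op \<sigma> g)" unfolding P_op_def by (rule linear_fs_extend)
  fix i :: nat assume "i \<in> {..<4}"
  then consider "i = 0" | "i = 1" | "i = 2" | "i = 3" by fastforce
  note i = this
  note sm = P_op_def \<tau>_rels lin\<tau> fsp.linear_0[OF linear_fs_extend]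
  have b: "\<tau> gen_b (P_vec \<tau> u i) = fs_scale (if i = 0 \<or> i = 3 then sgn2 \<sigma> else - sgn2 \<sigma>) (P_vec \<tau> u i)"
    using i by cases (simp_all add: u \<tau>_rels lin\<tau>)
  show "\<tau> g (fs_extend (P_vec \<tau> u) (unit i)) = fs_extend (P_vec \<tau> u) (P_op \<sigma> g (unit i))"
  proof (cases g)
    case gen_a
    show ?thesis unfolding gen_a using i by cases (simp_all add: sm del: single_one)
  next
    case gen_d
    show ?thesis unfolding gen_d using i by cases (simp_all add: sm del: single_one)
  next
    case gen_b
    show ?thesis unfolding gen_b using b by (simp add: P_op_def del: P_vec.simps)
  next
    case gen_c
    show ?thesis unfolding gen_c \<tau>_b_unit(2) using b by (simp add: P_op_def del: P_vec.simps)
  qed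
qed simp

definition hvec :: "nat \<Rightarrow> 'k tvec" where "hvec n = (\<Sum>i\<le>n. unit (X i, X (n - i)))"
text \<open>In the second factor, \<open>Y (t - 1)\<close> is the socle basis vector outside the
  image of \<open>down\<close>, hence the start of the downward induction in
  \<open>generators_span\<close>.\<close>

definition zvec :: "nat \<Rightarrow> 'k tvec" where "zvec n = unit (X n, Y (t - 1))"

definition \<rho> :: bit where "\<rho> = r + r'"

lemma sgn2_\<rho>: "sgn2 \<rho> = sgn2 r * (sgn2 r' :: 'k)"
  unfolding \<rho>_def by (rule sgn2_add)

text \<open>\<open>up\<close> keeps the index and \<open>down\<close> lowers it by one, so D on the
  antidiagonal of index sum n + 1 yields the same terms as A on that of index sum n; the terms with
  a zero index are killed by \<open>down\<close>.\<close>

lemma hvec_rels: "D (hvec 0) = 0" "D (hvec (Suc n)) = A (hvec n)" "\<tau> gen_b (hvec n) = fs_scale (sgn2 (\<rho>)) (hvec n)"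
proof -
  show "D (hvec 0) = 0" by (simp add: hvec_def D_unit)
  have "D (hvec (Suc n)) = (\<Sum>i\<le>Suc n. (case Suc n - i of 0 \<Rightarrow> 0 | Suc j' \<Rightarrow> unit (X i, Y j'))) -
     (\<Sum>i\<le>Suc n. (case i of 0 \<Rightarrow> 0 | Suc i' \<Rightarrow> fs_scale (sgn2 r') (unit (Y i', X (Suc n - i)))))"
    unfolding hvec_def fsp.linear_sum[OF linear_D] D_unit by (rule sum_subtractf)
  also have "(\<Sum>i\<le>Suc n. (case Suc n - i of 0 \<Rightarrow> 0 | Suc j' \<Rightarrow> unit (X i, Y j'))) = (\<Sum>i\<le>n. unit (X i, Y (n - i)) :: 'k tvec)"
    by (simp add: Suc_diff_le)
  also have "(\<Sum>i\<le>Suc n. (case i of 0 \<Rightarrow> 0 | Suc i' \<Rightarrow> fs_scale (sgn2 r') (unit (Y i', X (Suc n - i))))) =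
      (\<Sum>i\<le>n. fs_scale (sgn2 r') (unit (Y i, X (n - i))) :: 'k tvec)"
    by (subst sum.atMost_Suc_shift) simp
  also have "(\<Sum>i\<le>n. unit (X i, Y (n - i))) - (\<Sum>i\<le>n. fs_scale (sgn2 r') (unit (Y i, X (n - i)))) = A (hvec n)"
    unfolding hvec_def fsp.linear_sum[OF linear_A] A_unit by (rule sum_subtractf[symmetric])
  finally show "D (hvec (Suc n)) = A (hvec n)" .
  show "\<tau> gen_b (hvec n) = fs_scale (sgn2 (\<rho>)) (hvec n)"
    unfolding hvec_def fsp.linear_sum[OF linear_\<tau>] fs.scale_sum_right
    by (intro sum.cong) (simp_all add: \<tau>_b_unit(1) sgn2_\<rho>)
qed

lemma zvec_rels: "D (zvec 0) = 0" "D (zvec (Suc n)) = A (zvec n)" "\<tau> gen_b (zvec n) = fs_scale (- sgn2 (\<rho>)) (zvec n)"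
  by (simp_all add: zvec_def A_unit D_unit \<tau>_b_unit(1) sgn2_\<rho>)

text \<open>On the top of M_s(q,\<eta>) the eigenvalue of b is \<open>- sgn2 q\<close>. So
  \<open>zvec\<close>, with eigenvalue \<open>- sgn2 \<rho>\<close>, belongs to q = \<rho> and
  \<open>hvec\<close> to the other bit; indexing by q treats M_s(0,\<eta>) and M_s(1,\<eta>) alike
  whatever \<rho> is.\<close>

definition chain :: "bit \<Rightarrow> nat \<Rightarrow> 'k tvec" where
  "chain q = (if q = \<rho> then zvec else hvec)"

lemma chain_rels: "D (chain q 0) = 0" "D (chain q (Suc n)) = A (chain q n)"
  "\<tau> gen_b (chain q n) = fs_scale (- sgn2 q) (chain q n)"
proof -
  have "sgn2 (\<rho>) = - (sgn2 q :: 'k)" if "q \<noteq> \<rho>"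
    using that by (cases \<rho>; cases q) (simp_all add: sgn2_def)
  then show "D (chain q 0) = 0" "D (chain q (Suc n)) = A (chain q n)"
    "\<tau> gen_b (chain q n) = fs_scale (- sgn2 q) (chain q n)"
    by (auto simp: chain_def zvec_rels hvec_rels)
qed

lemma chain_op:
  assumes "f \<in> supported (UNIV \<times> {..<s})"
  shows "\<tau> g (fs_extend (chain_vec A (chain q)) f) = fs_extend (chain_vec A (chain q)) (M_op q \<eta> g f)"
proof -
  \<comment> \<open>D A = - A D, and D takes each chain vector to A of its predecessor or to 0, so A
    A = 0 finishes.\<close>
  have 1: "D (A (chain q i)) = 0" for i
  proof -
    have "D (A (chain q i)) = - A (D (chain q i))" using AD_rels(3)[of "chain q i"] by simp
    also have "\<dots> = 0" by (cases i) (simp_all add: chain_rels AD_rels linA)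
    finally show ?thesis .
  qed
  have 2: "\<tau> gen_b (A (chain q i)) = fs_scale (sgn2 q) (A (chain q i))" for i
    by (simp add: AD_rels chain_rels linA)
  note ce = chain_equivariant[of A D "\<tau> gen_b" s "chain q" q f \<eta>, OF linear_A linear_D linear_\<tau> AD_rels(1) 1
      chain_rels 2 assms]
  show ?thesis
    by (cases g) (simp_all only: \<tau>_pencil ce \<tau>_b_unit(2) M_op.simps)
qed

text \<open>Enumerates the heads X i \<otimes> X j with j \<ge> 1 by one number, as
  \<open>D4_copies\<close> requires: i and j - 1 are quotient and remainder by t - 1. For t = 1 the
  range s (t - 1) is empty.\<close>

definition uvec :: "nat \<Rightarrow> 'k tvec" where
  "uvec k = unit (X (k div (t - 1)), X (Suc (k mod (t - 1))))"

lemma uvec_b: "\<tau> gen_b (uvec k) = fs_scale (sgn2 (\<rho>)) (uvec k)"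
  by (simp add: uvec_def \<tau>_b_unit(1) sgn2_\<rho>)

lemma uvec_surj:
  assumes "i < s" "1 \<le> j" "j < t"
  shows "\<exists>k<s * (t - 1). uvec k = unit (X i, X j)"
proof -
  obtain j' where j': "j = Suc j'" using assms(2) by (cases j) auto
  then have j: "j' < t - 1" using assms(3) by simp
  have "i * (t - 1) + j' < (i + 1) * (t - 1)" using j by simp
  also have "\<dots> \<le> s * (t - 1)" using assms(1) by (intro mult_le_mono1) simp
  finally have k: "i * (t - 1) + j' < s * (t - 1)" .
  have "(i * (t - 1) + j') div (t - 1) = i" "(i * (t - 1) + j') mod (t - 1) = j'" using j by simp_all
  then have "uvec (i * (t - 1) + j') = unit (X i, X j)" by (simp only: uvec_def j')
  with k show ?thesis by blast
qed

text \<open>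
  From the heads \<open>X i \<otimes> X j\<close> with \<open>j \<ge> 1\<close> of the projective summands and the heads \<open>hvec n\<close>, \<open>zvec n\<close>
  of the two other summands one reaches \<open>X i \<otimes> X 0\<close>; then, by downward induction on \<open>j\<close>
  and starting from \<open>zvec i = X i \<otimes> Y (t - 1)\<close>, all \<open>X i \<otimes> Y j\<close> and \<open>Y i \<otimes> X j\<close>; and finally
  \<open>Y i \<otimes> Y j = A (Y i \<otimes> X j)\<close>.
\<close>

lemma generators_span:
  assumes W: "fs.subspace W" "\<And>f. f \<in> W \<Longrightarrow> A f \<in> W" "\<And>f. f \<in> W \<Longrightarrow> D f \<in> W"
    and h: "\<And>n. n < s \<Longrightarrow> hvec n \<in> W" and z: "\<And>n. n < s \<Longrightarrow> zvec n \<in> W"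
    and u: "\<And>i j. i < s \<Longrightarrow> 1 \<le> j \<Longrightarrow> j < t \<Longrightarrow> unit (X i, X j) \<in> W"
    and p: "p \<in> UNIV \<times> {..<s}" and q: "q \<in> UNIV \<times> {..<t}"
  shows "unit (p, q) \<in> W"
proof -
  note cl = fs.subspace_add[OF W(1)] fs.subspace_diff[OF W(1)] fs.subspace_scale[OF W(1)]
  define \<epsilon> :: 'k where "\<epsilon> = sgn2 r'"
  have \<epsilon>: "fs_scale \<epsilon> f \<in> W \<Longrightarrow> f \<in> W" for f using cl(3)[of "fs_scale \<epsilon> f" \<epsilon>] by (simp add: \<epsilon>_def)
  have XX: "unit (X i, X j) \<in> W" if "i < s" "j < t" for i j
  proof (cases "j = 0")
    case True
    have "hvec i = (\<Sum>k<i. unit (X k, X (i - k))) + unit (X i, X 0)"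
      by (simp add: hvec_def lessThan_Suc_atMost[symmetric])
    \<comment> \<open>The second indices i - k lie between 1 and i, and i < s \<le> t, so all these
      terms are heads of projective summands.\<close>
    moreover have sum: "(\<Sum>k<i. unit (X k, X (i - k))) \<in> W"
      using that(1) pos by (intro fs.subspace_sum[OF W(1)] u) auto
    ultimately have "unit (X i, X 0) = hvec i - (\<Sum>k<i. unit (X k, X (i - k)))" by simp
    then show ?thesis using cl(2)[OF h[OF that(1)] sum] True by simp
  qed (use u that in simp)
  have XY_YX: "unit (Y i, X j) \<in> W \<longleftrightarrow> unit (X i, Y j) \<in> W" if "i < s" "j < t" for i j
  proof -
    have A: "unit (X i, Y j) - fs_scale \<epsilon> (unit (Y i, X j)) \<in> W"
      using W(2)[OF XX[OF that]] by (simp add: A_unit \<epsilon>_def)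
    show ?thesis
    proof
      assume "unit (Y i, X j) \<in> W"
      from cl(1)[OF A cl(3)[OF this, of \<epsilon>]] show "unit (X i, Y j) \<in> W" by simp
    next
      assume "unit (X i, Y j) \<in> W"
      from cl(2)[OF this A] show "unit (Y i, X j) \<in> W" using \<epsilon> by simp
    qed
  qed
  have "unit (X i, Y (t - 1 - k)) \<in> W" if "i < s" "k < t" for i k using that
  proof (induction k arbitrary: i)
    case 0
    then show ?case using z by (simp add: zvec_def)
  next
    case (Suc k)
    define j where "j = t - 1 - Suc k"
    have j: "Suc j = t - 1 - k" "Suc j < t" using Suc.prems by (auto simp: j_def)
    \<comment> \<open>This vector is X i \<otimes> Y j up to a multiple of Y (i - 1) \<otimes> X (j
      + 1), which the induction hypothesis supplies through \<open>XY_YX\<close>; for i = 0 that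
      second term is absent.\<close>
    have "D (unit (X i, X (Suc j))) \<in> W" by (rule W(3)[OF XX[OF Suc.prems(1) j(2)]])
    then have Dj: "unit (X i, Y j) - (case i of 0 \<Rightarrow> 0 | Suc i' \<Rightarrow> fs_scale \<epsilon> (unit (Y i', X (Suc j)))) \<in> W"
      unfolding D_unit \<epsilon>_def by simp
    have "(case i of 0 \<Rightarrow> 0 | Suc i' \<Rightarrow> fs_scale \<epsilon> (unit (Y i', X (Suc j)))) \<in> W"
      using Suc.prems XY_YX[OF _ j(2)] Suc.IH[of "i - 1"] j(1) fs.subspace_0[OF W(1)]
      by (auto intro!: cl(3) split: nat.split)
    from cl(1)[OF Dj this] show ?case by (simp add: j_def)
  qed
  then have XY: "unit (X i, Y j) \<in> W" if "i < s" "j < t" for i j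
    using that by (metis One_nat_def Suc_pred diff_diff_cancel diff_less_Suc less_Suc_eq_le less_nat_zero_code not_gr_zero)
  have YX: "unit (Y i, X j) \<in> W" if "i < s" "j < t" for i j using XY_YX[OF that] XY[OF that] by simp
  have YY: "unit (Y i, Y j) \<in> W" if "i < s" "j < t" for i j using W(2)[OF YX[OF that]] by (simp add: A_unit)
  show ?thesis using p q XX XY YX YY by (cases "(p, q)" rule: cases_pq) auto
qed

end

section \<open>Direct sums in coordinates\<close>

lemma coordsI:
  assumes "\<And>x. x \<in> carrier M \<Longrightarrow> \<phi> x \<in> supported I" "inj_on \<phi> (carrier M)"
    and "\<And>f. f \<in> supported I \<Longrightarrow> \<exists>x\<in>carrier M. \<phi> x = f"
    and "\<And>x y. x \<in> carrier M \<Longrightarrow> y \<in> carrier M \<Longrightarrow> \<phi> (x \<oplus>\<^bsub>M\<^esub> y) = \<phi> x + \<phi> y"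
    and "\<And>k x. x \<in> carrier M \<Longrightarrow> \<phi> (k \<odot>\<^bsub>M\<^esub> x) = fs_scale k (\<phi> x)"
  shows "coords M I \<phi>"
proof -
  have "\<phi> ` carrier M = supported I" using assms(1,3) by blast
  then show ?thesis using assms(2,4,5) by (auto simp: coords_def bij_betw_def)
qed

lemma zero_supported: "0 \<in> supported I"
  by (simp add: supported_def)

lemma coordsD:
  assumes co: "coords M I \<phi>"
  shows "x \<in> carrier M \<Longrightarrow> \<phi> x \<in> supported I" "inj_on \<phi> (carrier M)"
    "f \<in> supported I \<Longrightarrow> \<exists>x\<in>carrier M. \<phi> x = f"
    "x \<in> carrier M \<Longrightarrow> y \<in> carrier M \<Longrightarrow> \<phi> (x \<oplus>\<^bsub>M\<^esub> y) = \<phi> x + \<phi> y"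
    "x \<in> carrier M \<Longrightarrow> \<phi> (k \<odot>\<^bsub>M\<^esub> x) = fs_scale k (\<phi> x)"
proof -
  have im: "\<phi> ` carrier M = supported I" using co by (simp add: coords_def bij_betw_def)
  then show "x \<in> carrier M \<Longrightarrow> \<phi> x \<in> supported I" "f \<in> supported I \<Longrightarrow> \<exists>x\<in>carrier M. \<phi> x = f"
    by (blast, metis imageE)
qed (use co in \<open>auto simp: coords_def bij_betw_def\<close>)

lemma D4_sum_simps [simp]:
  "carrier (M \<oplus>\<^sub>D N) = carrier M \<times> carrier N"
  "x \<oplus>\<^bsub>M \<oplus>\<^sub>D N\<^esub> y = (fst x \<oplus>\<^bsub>M\<^esub> fst y, snd x \<oplus>\<^bsub>N\<^esub> snd y)"
  "k \<odot>\<^bsub>M \<oplus>\<^sub>D N\<^esub> x = (k \<odot>\<^bsub>M\<^esub> fst x, k \<odot>\<^bsub>N\<^esub> snd x)"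
  "act (M \<oplus>\<^sub>D N) g x = (act M g (fst x), act N g (snd x))"
  by (simp_all add: D4_sum_def direct_sum_def module.defs D4_mod.defs case_prod_beta)

lemma D4_copies_simps [simp]:
  "carrier (D4_copies n M) = {..<n} \<rightarrow>\<^sub>E carrier M"
  "u \<oplus>\<^bsub>D4_copies n M\<^esub> v = (\<lambda>i\<in>{..<n}. u i \<oplus>\<^bsub>M\<^esub> v i)"
  "k \<odot>\<^bsub>D4_copies n M\<^esub> v = (\<lambda>i\<in>{..<n}. k \<odot>\<^bsub>M\<^esub> v i)"
  "act (D4_copies n M) g v = (\<lambda>i\<in>{..<n}. act M g (v i))"
  by (simp_all add: D4_copies_def)

abbreviation fs_map :: "('x \<Rightarrow> 'y) \<Rightarrow> ('x \<Rightarrow>\<^sub>0 'k::field) \<Rightarrow> ('y \<Rightarrow>\<^sub>0 'k)" where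
  "fs_map \<iota> \<equiv> fs_extend (\<lambda>i. unit (\<iota> i))"

lemmas fs_extend_linear =
  fsp.linear_add[OF linear_fs_extend] fsp.linear_scale[OF linear_fs_extend]
  fsp.linear_0[OF linear_fs_extend] fsp.linear_sum[OF linear_fs_extend]

lemma fs_extend_fs_extend: "fs_extend h (fs_extend h' f) = fs_extend (\<lambda>i. fs_extend h (h' i)) f"
  by (rule linear_eqI[OF linear_comp[OF linear_fs_extend linear_fs_extend] linear_fs_extend]) simp

lemma fs_extend_unit: "fs_extend unit f = f"
  by (rule linear_eqI[OF linear_fs_extend fs.linear_ident]) simp

lemma fs_extend_zero: "fs_extend (\<lambda>i. 0) f = 0"
  by (simp add: fs_extend_def)

lemma fs_extend_in_supported:
  assumes "finite I" "f \<in> supported I" "\<And>i. i \<in> I \<Longrightarrow> h i \<in> supported J"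
  shows "fs_extend h f \<in> supported J"
  by (rule linear_in_subspace_on_supported[OF linear_fs_extend subspace_supported assms(1,2)]) (simp add: assms(3))

lemma coords_sum:
  fixes M :: "('k::field, 'v) D4_mod" and N :: "('k, 'w) D4_mod" and I :: "'x set" and J :: "'y set"
  assumes M: "coords M I \<gamma>" "finite I" and N: "coords N J \<delta>" "finite J"
  shows "coords (M \<oplus>\<^sub>D N) (I <+> J) (\<lambda>z. fs_map Inl (\<gamma> (fst z)) + fs_map Inr (\<delta> (snd z)))"
    (is "coords _ _ ?\<theta>")
proof (rule coordsI)
  note cl = fs.subspace_add[OF subspace_supported]
  define p1 where "p1 = fs_extend (case_sum unit (\<lambda>_. 0) :: 'x + 'y \<Rightarrow> ('x \<Rightarrow>\<^sub>0 'k))"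
  define p2 where "p2 = fs_extend (case_sum (\<lambda>_. 0) unit :: 'x + 'y \<Rightarrow> ('y \<Rightarrow>\<^sub>0 'k))"
  have p: "p1 (?\<theta> z) = \<gamma> (fst z)" "p2 (?\<theta> z) = \<delta> (snd z)" for z
    by (simp_all add: p1_def p2_def fs_extend_linear fs_extend_fs_extend fs_extend_unit fs_extend_zero)
  show "?\<theta> x \<in> supported (I <+> J)" if "x \<in> carrier (M \<oplus>\<^sub>D N)" for x
    using that coordsD(1)[OF M(1)] coordsD(1)[OF N(1)]
    by (intro cl fs_extend_in_supported[OF M(2)] fs_extend_in_supported[OF N(2)]) (auto intro: unit_supported)
  show "inj_on ?\<theta> (carrier (M \<oplus>\<^sub>D N))"
  proof (rule inj_onI)
    fix z z' assume z: "z \<in> carrier (M \<oplus>\<^sub>D N)" "z' \<in> carrier (M \<oplus>\<^sub>D N)" "?\<theta> z = ?\<theta> z'"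
    have "\<gamma> (fst z) = \<gamma> (fst z')" "\<delta> (snd z) = \<delta> (snd z')" using p[of z] p[of z'] z(3) by auto
    then show "z = z'" using z(1,2) coordsD(2)[OF M(1)] coordsD(2)[OF N(1)] by (auto dest: inj_onD)
  qed
  show "\<exists>z\<in>carrier (M \<oplus>\<^sub>D N). ?\<theta> z = f" if f: "f \<in> supported (I <+> J)" for f
  proof -
    have fin: "finite (I <+> J)" using M(2) N(2) by simp
    have "p1 f \<in> supported I" unfolding p1_def
      by (rule fs_extend_in_supported[OF fin f]) (auto simp: unit_supported zero_supported)
    moreover have "p2 f \<in> supported J" unfolding p2_def
      by (rule fs_extend_in_supported[OF fin f]) (auto simp: unit_supported zero_supported)
    ultimately obtain x y where xy: "x \<in> carrier M" "\<gamma> x = p1 f" "y \<in> carrier N" "\<delta> y = p2 f"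
      using coordsD(3)[OF M(1)] coordsD(3)[OF N(1)] by metis
    have "fs_map Inl (p1 f) + fs_map Inr (p2 f) = f"
    proof (rule linear_eqI[of "\<lambda>f. fs_map Inl (p1 f) + fs_map Inr (p2 f)", OF _ fs.linear_ident])
      show "fs_linear (\<lambda>f. fs_map Inl (p1 f) + fs_map Inr (p2 f))"
        unfolding p1_def p2_def by (intro fsp.linear_compose_add linear_comp[OF linear_fs_extend linear_fs_extend])
      show "fs_map Inl (p1 (unit i)) + fs_map Inr (p2 (unit i)) = unit i" for i
        by (cases i) (simp_all add: p1_def p2_def fs_extend_linear)
    qed
    then show ?thesis using xy by (intro bexI[of _ "(x, y)"]) simp_all
  qed
qed (use coordsD(4,5)[OF M(1)] coordsD(4,5)[OF N(1)] in
    \<open>auto simp: fs_extend_linear algebra_simps fs.scale_right_distrib\<close>)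

lemma coords_copies:
  fixes M :: "('k::field, 'v) D4_mod" and I :: "'x set"
  assumes M: "coords M I \<gamma>" "finite I"
  shows "coords (D4_copies n M) ({..<n} \<times> I) (\<lambda>v. \<Sum>k<n. fs_map (Pair k) (\<gamma> (v k)))"
    (is "coords _ _ ?\<theta>")
proof (rule coordsI)
  define p where "p k = fs_extend (\<lambda>(k', i). if k' = k then unit i else 0 :: 'x \<Rightarrow>\<^sub>0 'k)" for k :: nat
  have p: "p k (?\<theta> v) = \<gamma> (v k)" if "k < n" for k v
  proof -
    have "p k (?\<theta> v) = (\<Sum>k'<n. if k' = k then \<gamma> (v k) else 0)"
      unfolding p_def fs_extend_linear by (intro sum.cong) (auto simp: fs_extend_fs_extend fs_extend_unit fs_extend_zero)
    then show ?thesis using that by simp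
  qed
  show "?\<theta> v \<in> supported ({..<n} \<times> I)" if "v \<in> carrier (D4_copies n M)" for v
    using that coordsD(1)[OF M(1)]
    by (intro fs.subspace_sum[OF subspace_supported] fs_extend_in_supported[OF M(2)]) (auto intro!: unit_supported)
  show "inj_on ?\<theta> (carrier (D4_copies n M))"
  proof (rule inj_onI)
    fix v v' assume v: "v \<in> carrier (D4_copies n M)" "v' \<in> carrier (D4_copies n M)" "?\<theta> v = ?\<theta> v'"
    have "v k = v' k" if "k < n" for k
    proof -
      have "\<gamma> (v k) = \<gamma> (v' k)" using p[OF that, of v] p[OF that, of v'] v(3) by simp
      moreover have "v k \<in> carrier M" "v' k \<in> carrier M" using v that by auto
      ultimately show ?thesis using inj_onD[OF coordsD(2)[OF M(1)]] by blast
    qed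
    then show "v = v'" using v(1,2) by (auto intro: PiE_ext)
  qed
  show "\<exists>v\<in>carrier (D4_copies n M). ?\<theta> v = f" if f: "f \<in> supported ({..<n} \<times> I)" for f
  proof -
    have fin: "finite ({..<n} \<times> I)" using M(2) by simp
    have "p k f \<in> supported I" for k unfolding p_def
      by (rule fs_extend_in_supported[OF fin f]) (auto simp: unit_supported zero_supported)
    then have "\<forall>k. \<exists>x\<in>carrier M. \<gamma> x = p k f" using coordsD(3)[OF M(1)] by blast
    then obtain x where x: "\<And>k. x k \<in> carrier M" "\<And>k. \<gamma> (x k) = p k f" by metis
    have "(\<Sum>k<n. fs_map (Pair k) (p k f)) = f"
    proof (rule linear_eq_on_supported[of "\<lambda>f. \<Sum>k<n. fs_map (Pair k) (p k f)", OF _ fs.linear_ident fin f])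
      show "fs_linear (\<lambda>f. \<Sum>k<n. fs_map (Pair k) (p k f))"
        unfolding p_def by (intro fsp.linear_compose_sum ballI linear_comp[OF linear_fs_extend linear_fs_extend])
      fix q assume "q \<in> {..<n} \<times> I"
      then obtain k0 i where q: "q = (k0, i)" "k0 < n" by auto
      have "(\<Sum>k<n. fs_map (Pair k) (p k (unit q))) = (\<Sum>k<n. if k = k0 then unit q else 0 :: nat \<times> 'x \<Rightarrow>\<^sub>0 'k)"
        by (intro sum.cong) (auto simp: p_def q fs_extend_linear)
      then show "(\<Sum>k<n. fs_map (Pair k) (p k (unit q))) = unit q" using q(2) by simp
    qed
    moreover have "?\<theta> (restrict x {..<n}) = (\<Sum>k<n. fs_map (Pair k) (p k f))" by (simp add: x(2))
    ultimately show ?thesis using x(1) by (intro bexI[of _ "restrict x {..<n}"]) auto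
  qed
  fix v k assume v: "v \<in> carrier (D4_copies n M)"
  then have "v i \<in> carrier M" if "i < n" for i using that by auto
  then show "?\<theta> (k \<odot>\<^bsub>D4_copies n M\<^esub> v) = fs_scale k (?\<theta> v)"
    by (simp add: coordsD(5)[OF M(1)] fs_extend_linear fs.scale_sum_right)
next
  fix v v' assume v: "v \<in> carrier (D4_copies n M)" "v' \<in> carrier (D4_copies n M)"
  then have "v i \<in> carrier M" "v' i \<in> carrier M" if "i < n" for i using that by auto
  then show "?\<theta> (v \<oplus>\<^bsub>D4_copies n M\<^esub> v') = ?\<theta> v + ?\<theta> v'"
    by (simp add: coordsD(4)[OF M(1)] fs_extend_linear sum.distrib)
qed

section \<open>Changes of basis and comparison of models\<close>

lemma units_independent:
  assumes "finite I"
  shows "inj_on (\<lambda>i. unit i :: 'x \<Rightarrow>\<^sub>0 'k::field) I" "fs.independent ((\<lambda>i. unit i :: 'x \<Rightarrow>\<^sub>0 'k) ` I)"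
proof -
  have "c j = 0" if 0: "(\<Sum>i\<in>I. fs_scale (c i) (unit i) :: 'x \<Rightarrow>\<^sub>0 'k) = 0" and j: "j \<in> I" for c j
  proof -
    have "c j = (\<Sum>i\<in>I. if i = j then c j else 0)" using j assms by simp
    also have "\<dots> = (\<Sum>i\<in>I. c i * (1 when i = j))" by (intro sum.cong) (auto simp: when_def)
    also have "\<dots> = Poly_Mapping.lookup (\<Sum>i\<in>I. fs_scale (c i) (unit i)) j"
      by (simp add: lookup_sum lookup_single)
    finally show ?thesis using 0 by simp
  qed
  then show "inj_on (\<lambda>i. unit i :: 'x \<Rightarrow>\<^sub>0 'k::field) I" "fs.independent ((\<lambda>i. unit i :: 'x \<Rightarrow>\<^sub>0 'k) ` I)"
    using fs.independent_family[OF assms, of "\<lambda>i. unit i :: 'x \<Rightarrow>\<^sub>0 'k"] by blast+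
qed

text \<open>\<open>coords_sum\<close> and \<open>coords_copies\<close> give the direct sum its
  natural index set; this moves it to the index set of the tensor product.\<close>

lemma coords_change_basis:
  fixes M :: "('k::field, 'v) D4_mod" and K :: "'x set" and L :: "'y set"
  assumes M: "coords M K \<gamma>" and fin: "finite K" and G: "inj_on G K" "fs.independent (G ` K)"
    and sp: "fs.span (G ` K) = supported L"
  shows "coords M L (\<lambda>x. fs_extend G (\<gamma> x))"
proof (rule coordsI)
  have GL: "G i \<in> supported L" if "i \<in> K" for i using that sp fs.span_base[of "G i" "G ` K"] by blast
  show "fs_extend G (\<gamma> x) \<in> supported L" if "x \<in> carrier M" for x
    using GL by (rule fs_extend_in_supported[OF fin coordsD(1)[OF M that]])
  have ext: "fs_extend G f = (\<Sum>i\<in>K. fs_scale (Poly_Mapping.lookup f i) (G i))" if "f \<in> supported K" for f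
    using that fin by (intro fs_extend_eq) (auto simp: supported_def)
  show "inj_on (\<lambda>x. fs_extend G (\<gamma> x)) (carrier M)"
  proof (rule inj_onI)
    fix x y assume xy: "x \<in> carrier M" "y \<in> carrier M" "fs_extend G (\<gamma> x) = fs_extend G (\<gamma> y)"
    let ?d = "\<gamma> x - \<gamma> y"
    have d: "?d \<in> supported K"
      using coordsD(1)[OF M] xy fs.subspace_diff[OF subspace_supported] by blast
    have "fs_extend G ?d = 0" using xy(3) by (simp add: fsp.linear_diff[OF linear_fs_extend])
    then have "(\<Sum>i\<in>K. fs_scale (Poly_Mapping.lookup ?d i) (G i)) = 0" using ext[OF d] by simp
    moreover have "(\<Sum>i\<in>K. fs_scale (Poly_Mapping.lookup ?d i) (G i)) =
        (\<Sum>v\<in>G ` K. fs_scale (Poly_Mapping.lookup ?d (the_inv_into K G v)) v)"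
      by (subst sum.reindex[OF G(1)]) (auto simp: the_inv_into_f_f[OF G(1)])
    ultimately have 0: "(\<Sum>v\<in>G ` K. fs_scale (Poly_Mapping.lookup ?d (the_inv_into K G v)) v) = 0" by simp
    have "Poly_Mapping.lookup ?d i = 0" if "i \<in> K" for i
      using fs.independentD[OF G(2) _ order_refl 0, of "G i"] that fin by (simp add: the_inv_into_f_f[OF G(1)])
    then have "?d = 0" using d by (intro poly_mapping_eqI) (auto simp: supported_iff)
    then show "x = y" using xy coordsD(2)[OF M] by (auto dest: inj_onD)
  qed
  fix h :: "'y \<Rightarrow>\<^sub>0 'k" assume "h \<in> supported L"
  then obtain u where u: "h = (\<Sum>v\<in>G ` K. fs_scale (u v) v)"
    using sp fs.span_finite[of "G ` K"] fin by auto
  define f where "f = (\<Sum>i\<in>K. fs_scale (u (G i)) (unit i))"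
  have "f \<in> supported K" unfolding f_def
    by (intro fs.subspace_sum fs.subspace_scale subspace_supported unit_supported)
  then obtain x where x: "x \<in> carrier M" "\<gamma> x = f" using coordsD(3)[OF M] by blast
  have "fs_extend G f = h" by (simp add: f_def u fs_extend_linear sum.reindex[OF G(1)])
  then show "\<exists>x\<in>carrier M. fs_extend G (\<gamma> x) = h" using x by blast
qed (use coordsD(4,5)[OF M] in \<open>auto simp: fs_extend_linear\<close>)

text \<open>What \<open>iso_of_models\<close> asks of its target besides a model. It passes to sums
  and copies at once, without re-establishing the module axioms there.\<close>

definition operations_closed :: "('k, 'v) D4_mod \<Rightarrow> bool" where
  "operations_closed M \<longleftrightarrow>
     (\<forall>x\<in>carrier M. \<forall>y\<in>carrier M. x \<oplus>\<^bsub>M\<^esub> y \<in> carrier M) \<and>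
     (\<forall>x\<in>carrier M. (\<forall>k. k \<odot>\<^bsub>M\<^esub> x \<in> carrier M) \<and> (\<forall>g. act M g x \<in> carrier M))"

lemma (in D4_module) operations_closed: "operations_closed M"
  by (auto simp: operations_closed_def act_closed smult(1))

lemma operations_closed_sum:
  "operations_closed M \<Longrightarrow> operations_closed N \<Longrightarrow> operations_closed (M \<oplus>\<^sub>D N)"
  by (auto simp: operations_closed_def)

lemma operations_closed_copies: "operations_closed M \<Longrightarrow> operations_closed (D4_copies n M)"
  unfolding operations_closed_def D4_copies_simps by (intro conjI ballI allI restrict_PiE_iff[THEN iffD2]) (metis PiE_mem)+

text \<open>One coordinate map followed by the inverse of the other. Closure of B puts the results
  of its operations in the carrier, where the inverse can be computed.\<close>

lemma iso_of_models:
  assumes A: "model A K T \<gamma>" and B: "model B K T \<delta>"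
    and closed: "operations_closed B"
  shows "A \<cong>\<^sub>D B"
proof -
  have cA: "coords A K \<gamma>" and cB: "coords B K \<delta>" using A B by (auto simp: model_def)
  define \<beta> where "\<beta> = the_inv_into (carrier B) \<delta>"
  have bA: "bij_betw \<gamma> (carrier A) (supported K)" and bB: "bij_betw \<delta> (carrier B) (supported K)"
    using cA cB by (auto simp: coords_def)
  have \<beta>: "bij_betw \<beta> (supported K) (carrier B)" unfolding \<beta>_def by (rule bij_betw_the_inv_into[OF bB])
  have inv: "\<beta> (\<delta> y) = y" if "y \<in> carrier B" for y
    unfolding \<beta>_def by (rule the_inv_into_f_f[OF coordsD(2)[OF cB] that])
  have fB: "\<beta> (\<gamma> x) \<in> carrier B" "\<delta> (\<beta> (\<gamma> x)) = \<gamma> x" if "x \<in> carrier A" for x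
    using coordsD(1)[OF cA that] coordsD(3)[OF cB] inv by metis+
  have cl: "x \<oplus>\<^bsub>B\<^esub> y \<in> carrier B" "k \<odot>\<^bsub>B\<^esub> x \<in> carrier B" "act B g x \<in> carrier B"
    if "x \<in> carrier B" "y \<in> carrier B" for x y k g
    using closed that by (auto simp: operations_closed_def)
  have hom: "\<beta> (\<gamma> (x \<oplus>\<^bsub>A\<^esub> y)) = \<beta> (\<gamma> x) \<oplus>\<^bsub>B\<^esub> \<beta> (\<gamma> y)"
    "\<beta> (\<gamma> (k \<odot>\<^bsub>A\<^esub> x)) = k \<odot>\<^bsub>B\<^esub> \<beta> (\<gamma> x)" "\<beta> (\<gamma> (act A g x)) = act B g (\<beta> (\<gamma> x))"
    if x: "x \<in> carrier A" and y: "y \<in> carrier A" for x y k g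
    using inv[OF cl(1)[OF fB(1)[OF x] fB(1)[OF y]]] inv[OF cl(2)[OF fB(1)[OF x] fB(1)[OF x]], of k]
      inv[OF cl(3)[OF fB(1)[OF x] fB(1)[OF x]], of g] x y fB
    by (simp_all add: coordsD(4,5)[OF cA] coordsD(4,5)[OF cB] model_act[OF A] model_act[OF B])
  then have "\<beta> \<circ> \<gamma> \<in> D4_hom A B"
    using fB(1) by (auto simp: D4_hom_def LinearCombinations.module_hom_def)
  moreover have "bij_betw (\<beta> \<circ> \<gamma>) (carrier A) (carrier B)" by (rule bij_betw_trans[OF bA \<beta>])
  ultimately show ?thesis unfolding D4_iso_def by blast
qed

section \<open>Decomposition of the tensor product\<close>

context normal_tensor
begin

abbreviation n :: nat where "n \<equiv> s * (t - 1)"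

abbreviation summand_basis :: "(nat \<times> nat + (bool \<times> nat) + (bool \<times> nat)) set" where
  "summand_basis \<equiv> ({..<n} \<times> {..<4}) <+> (UNIV \<times> {..<s}) <+> (UNIV \<times> {..<s})"

text \<open>Where the basis of the right-hand side goes in the tensor product: four vectors for each
  projective head, then the two chains.\<close>

fun summand_vec :: "nat \<times> nat + (bool \<times> nat) + (bool \<times> nat) \<Rightarrow> 'k tvec" where
  "summand_vec (Inl (k, i)) = P_vec \<tau> (uvec k) i"
| "summand_vec (Inr (Inl p)) = chain_vec A (chain 0) p"
| "summand_vec (Inr (Inr p)) = chain_vec A (chain 1) p"

abbreviation summand_span :: "'k tvec set" where
  "summand_span \<equiv> fs.span (summand_vec ` summand_basis)"

lemma summand_extend_closed:
  "k < n \<Longrightarrow> f \<in> supported {..<4} \<Longrightarrow> fs_extend (P_vec \<tau> (uvec k)) f \<in> summand_span"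
  "h \<in> supported (UNIV \<times> {..<s}) \<Longrightarrow> fs_extend (chain_vec A (chain q)) h \<in> summand_span"
proof -
  have fin: "finite (UNIV \<times> {..<s} :: (bool \<times> nat) set)" by simp
  note lin = linear_in_subspace_on_supported[OF linear_fs_extend fs.subspace_span]
  show "fs_extend (P_vec \<tau> (uvec k)) f \<in> summand_span" if k: "k < n" and f: "f \<in> supported {..<4}"
  proof (rule lin[OF _ f])
    fix i :: nat assume "i \<in> {..<4}"
    then have "summand_vec (Inl (k, i)) \<in> summand_span"
      using k by (intro fs.span_base imageI) auto
    then show "fs_extend (P_vec \<tau> (uvec k)) (unit i) \<in> summand_span" by (simp del: P_vec.simps)
  qed simp
  show "fs_extend (chain_vec A (chain q)) h \<in> summand_span" if h: "h \<in> supported (UNIV \<times> {..<s})"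
  proof (rule lin[OF fin h])
    fix p :: "bool \<times> nat" assume p: "p \<in> UNIV \<times> {..<s}"
    then have "summand_vec (Inr (Inl p)) \<in> summand_span" "summand_vec (Inr (Inr p)) \<in> summand_span"
      by (intro fs.span_base imageI; auto)+
    then show "fs_extend (chain_vec A (chain q)) (unit p) \<in> summand_span" by (cases q) simp_all
  qed
qed

text \<open>By equivariance each generator acts on a spanning vector as it does in the normal form
  of its summand, so it does not leave the span.\<close>

lemma \<tau>_summand_span:
  assumes "f \<in> summand_span"
  shows "\<tau> g f \<in> summand_span"
proof -
  have "summand_span \<subseteq> \<tau> g -` summand_span"
  proof (rule fs.span_minimal)
    show "fs.subspace (\<tau> g -` summand_span)" by (rule fsp.linear_subspace_vimage[OF linear_\<tau> fs.subspace_span])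
    show "summand_vec ` summand_basis \<subseteq> \<tau> g -` summand_span"
    proof (rule image_subsetI)
      fix \<kappa> assume \<kappa>: "\<kappa> \<in> summand_basis"
      show "summand_vec \<kappa> \<in> \<tau> g -` summand_span"
      proof (cases \<kappa> rule: summand_vec.cases)
        case (1 k i)
        then have k: "k < n" "unit i \<in> supported {..<4}" using \<kappa> by (auto intro: unit_supported)
        have "\<tau> g (fs_extend (P_vec \<tau> (uvec k)) (unit i)) \<in> summand_span"
          unfolding P_equivariant[OF uvec_b k(2)] by (rule summand_extend_closed(1)[OF k(1) P_op_closed[OF k(2)]])
        then show ?thesis by (simp add: 1 del: P_vec.simps)
      next
        case (2 p)
        then have p: "unit p \<in> supported (UNIV \<times> {..<s})" using \<kappa> by (auto intro: unit_supported)
        have "\<tau> g (fs_extend (chain_vec A (chain 0)) (unit p)) \<in> summand_span"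
          unfolding chain_op[OF p] by (rule summand_extend_closed(2)[OF M_op_closed[OF p]])
        then show ?thesis by (simp add: 2)
      next
        case (3 p)
        then have p: "unit p \<in> supported (UNIV \<times> {..<s})" using \<kappa> by (auto intro: unit_supported)
        have "\<tau> g (fs_extend (chain_vec A (chain 1)) (unit p)) \<in> summand_span"
          unfolding chain_op[OF p] by (rule summand_extend_closed(2)[OF M_op_closed[OF p]])
        then show ?thesis by (simp add: 3)
      qed
    qed
  qed
  then show ?thesis using assms by blast
qed

text \<open>\<open>generators_span\<close> works with A and D, which are linear combinations of the
  actions of a and d.\<close>

lemma AD_summand_span:
  assumes "f \<in> summand_span"
  shows "A f \<in> summand_span" "D f \<in> summand_span"
proof -
  have a: "\<tau> gen_a f \<in> summand_span" and d: "\<tau> gen_d f \<in> summand_span" by (rule \<tau>_summand_span[OF assms])+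
  have "(\<exists>e. \<tau> gen_a = A \<and> \<tau> gen_d = (\<lambda>x. D x - fs_scale e (A x))) \<or> \<tau> gen_a = D \<and> \<tau> gen_d = A"
    unfolding \<tau>_pencil by (cases \<eta>) auto
  then obtain e where "A f = \<tau> gen_a f \<and> D f = \<tau> gen_d f + fs_scale e (\<tau> gen_a f) \<or> A f = \<tau> gen_d f \<and> D f = \<tau> gen_a f"
    by fastforce
  then show "A f \<in> summand_span" "D f \<in> summand_span"
    using a d fs.span_add[OF d fs.span_scale[OF a, of e]] by auto
qed

lemma unit_summand_span:
  assumes "p \<in> UNIV \<times> {..<s}" "q \<in> UNIV \<times> {..<t}"
  shows "unit (p, q) \<in> summand_span"
proof (rule generators_span[OF fs.subspace_span AD_summand_span _ _ _ assms])
  have ch: "chain q n \<in> summand_span" if "n < s" for q n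
    using summand_extend_closed(2)[OF unit_supported, of "X n" q] that by simp
  show "hvec n \<in> summand_span" if "n < s" for n
  proof -
    \<comment> \<open>\<open>hvec\<close> is the chain attached to the bit other than
      \<rho>.\<close>
    obtain q where "q \<noteq> \<rho>" by (metis bit_not_zero_iff zero_neq_one)
    then show ?thesis using ch[OF that, of q] by (simp only: chain_def if_False)
  qed
  show "zvec n \<in> summand_span" if "n < s" for n
    using ch[OF that, of \<rho>] by (simp add: chain_def cong: if_cong)
  fix i j assume "i < s" "1 \<le> j" "j < t"
  then obtain k where k: "k < n" "uvec k = unit (X i, X j)" using uvec_surj by blast
  then show "unit (X i, X j) \<in> summand_span"
    using summand_extend_closed(1)[OF k(1) unit_supported, of 0] by (simp del: single_one)
qed

abbreviation tensor_basis :: "((bool \<times> nat) \<times> (bool \<times> nat)) set" where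
  "tensor_basis \<equiv> (UNIV \<times> {..<s}) \<times> (UNIV \<times> {..<t})"

text \<open>Spanning comes from \<open>unit_summand_span\<close>; independence then follows from the
  equality of the two cardinalities.\<close>

lemma summand_vec_basis:
  "inj_on summand_vec summand_basis" "fs.independent (summand_vec ` summand_basis)"
  "summand_span = supported tensor_basis"
proof -
  let ?U = "(\<lambda>p. unit p :: 'k tvec) ` tensor_basis"
  have fin: "finite tensor_basis" by simp
  note units = units_independent[OF fin, where 'k = 'k]
  have sub: "?U \<subseteq> summand_span" using unit_summand_span by auto
  \<comment> \<open>Removes the truncated subtraction t - 1 before the count.\<close>
  obtain t' where t': "t = Suc t'" using pos by (cases t) auto
  have card: "card summand_basis = card tensor_basis"
    by (simp add: card_Plus card_cartesian_product t' algebra_simps)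
  show inj: "inj_on summand_vec summand_basis" and ind: "fs.independent (summand_vec ` summand_basis)"
    using card fs.independent_of_card_spanning[of summand_basis "\<lambda>p. unit p" tensor_basis summand_vec] units sub by auto
  have "supported tensor_basis = fs.span ?U"
  proof
    show "supported tensor_basis \<subseteq> fs.span ?U"
    proof
      fix f :: "'k tvec" assume "f \<in> supported tensor_basis"
      then show "f \<in> fs.span ?U"
        by (subst poly_mapping_decomp[of tensor_basis f]) (auto intro!: fs.span_sum fs.span_scale intro: fs.span_base)
    qed
    show "fs.span ?U \<subseteq> supported tensor_basis"
      by (rule fs.span_minimal[OF _ subspace_supported]) (auto intro: unit_supported)
  qed
  moreover have "fs.span ?U = summand_span"
  proof
    show "fs.span ?U \<subseteq> summand_span" using sub by (rule fs.span_minimal[OF _ fs.subspace_span])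
    show "summand_span \<subseteq> fs.span ?U"
    proof (rule fs.independent_dim_spans[OF _ sub units(2)])
      show "fs.fdim summand_span" unfolding fs.fdim_def
        by (intro exI[of _ "summand_vec ` summand_basis"] conjI order_refl finite_imageI finite_Plus) simp_all
      show "fs.dim summand_span \<le> card ?U"
        unfolding fs.dim_span_eq_card_independent[OF ind] card_image[OF inj] card_image[OF units(1)] card by (rule order_refl)
    qed
  qed
  ultimately show "summand_span = supported tensor_basis" by simp
qed

text \<open>The direct sum is given new coordinates along \<open>summand_vec\<close>; equivariance
  on each summand says that its action becomes that of the tensor product.\<close>

lemma summands_model:
  fixes P :: "('k, 'p) D4_mod" and M0 :: "('k, 'm0) D4_mod" and M1 :: "('k, 'm1) D4_mod"
  assumes P: "model P {..<4} (P_op \<rho>) \<gamma>P" and M: "model M0 (UNIV \<times> {..<s}) (M_op 0 \<eta>) \<gamma>0"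
      "model M1 (UNIV \<times> {..<s}) (M_op 1 \<eta>) \<gamma>1"
  obtains \<theta> where "model (D4_copies n P \<oplus>\<^sub>D M0 \<oplus>\<^sub>D M1) tensor_basis \<tau> \<theta>"
proof -
  let ?R = "D4_copies n P \<oplus>\<^sub>D M0 \<oplus>\<^sub>D M1"
  have c: "coords P {..<4} \<gamma>P" "coords M0 (UNIV \<times> {..<s}) \<gamma>0" "coords M1 (UNIV \<times> {..<s}) \<gamma>1"
    using assms by (auto simp: model_def)
  have fin: "finite (UNIV \<times> {..<s} :: (bool \<times> nat) set)" by simp
  let ?\<theta> = "\<lambda>z. fs_extend summand_vec (fs_map Inl (\<Sum>k<n. fs_map (Pair k) (\<gamma>P (fst z k))) +
    fs_map Inr (fs_map Inl (\<gamma>0 (fst (snd z))) + fs_map Inr (\<gamma>1 (snd (snd z)))))"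
  have co: "coords ?R tensor_basis ?\<theta>"
    by (rule coords_change_basis[OF _ _ summand_vec_basis],
        rule coords_sum[OF coords_copies[OF c(1)] _ coords_sum[OF c(2) fin c(3) fin]]) simp_all
  have \<theta>: "?\<theta> z = (\<Sum>k<n. fs_extend (P_vec \<tau> (uvec k)) (\<gamma>P (fst z k))) +
    (fs_extend (chain_vec A (chain 0)) (\<gamma>0 (fst (snd z))) + fs_extend (chain_vec A (chain 1)) (\<gamma>1 (snd (snd z))))" for z
    by (simp add: fs_extend_linear fs_extend_fs_extend del: P_vec.simps)
  have "?\<theta> (act ?R g z) = \<tau> g (?\<theta> z)"
    if z: "z \<in> carrier ?R" for z g
  proof -
    have z1: "fst z \<in> {..<n} \<rightarrow>\<^sub>E carrier P" and m: "fst (snd z) \<in> carrier M0" "snd (snd z) \<in> carrier M1"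
      using z by (simp_all only: D4_sum_simps(1) D4_copies_simps(1) mem_Times_iff)
    have zc: "fst z k \<in> carrier P" if "k < n" for k using PiE_mem[OF z1] \<open>k < n\<close> by blast
    have "(\<Sum>k<n. fs_extend (P_vec \<tau> (uvec k)) (\<gamma>P (fst (act ?R g z) k))) =
        (\<Sum>k<n. \<tau> g (fs_extend (P_vec \<tau> (uvec k)) (\<gamma>P (fst z k))))"
    proof (rule sum.cong)
      fix k assume "k \<in> {..<n}"
      then have k: "k < n" by simp
      have "fst (act ?R g z) k = act P g (fst z k)" using k by simp
      then show "fs_extend (P_vec \<tau> (uvec k)) (\<gamma>P (fst (act ?R g z) k)) =
          \<tau> g (fs_extend (P_vec \<tau> (uvec k)) (\<gamma>P (fst z k)))"
        using P_equivariant[OF uvec_b model_supported[OF P zc[OF k]]] model_act[OF P zc[OF k]] by simp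
    qed (rule refl)
    moreover have "fs_extend (chain_vec A (chain 0)) (\<gamma>0 (fst (snd (act ?R g z)))) =
        \<tau> g (fs_extend (chain_vec A (chain 0)) (\<gamma>0 (fst (snd z))))"
      using chain_op[OF model_supported[OF M(1) m(1)]] model_act[OF M(1) m(1)] by simp
    moreover have "fs_extend (chain_vec A (chain 1)) (\<gamma>1 (snd (snd (act ?R g z)))) =
        \<tau> g (fs_extend (chain_vec A (chain 1)) (\<gamma>1 (snd (snd z))))"
      using chain_op[OF model_supported[OF M(2) m(2)]] model_act[OF M(2) m(2)] by simp
    ultimately show ?thesis unfolding \<theta> lin\<tau> fsp.linear_sum[OF linear_\<tau>] by (simp only:)
  qed
  then have "model ?R tensor_basis \<tau> ?\<theta>"
    using co by (auto simp: model_def)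
  then show ?thesis using that by blast
qed

end

theorem proposition2p32:
  fixes M :: "('k::alg_closed_field, 'm) D4_mod"
    and N :: "('k, 'n) D4_mod"
    and P :: "('k, 'p) D4_mod"
    and M0 :: "('k, 'm0) D4_mod"
    and M1 :: "('k, 'm1) D4_mod"
    and s t :: nat
    and r r' :: bit
    and \<eta> :: "'k proj_line"
  assumes "CHAR('k) \<noteq> 2"
    and "1 \<le> s" and "s \<le> t"
    and "is_M s r \<eta> M"
    and "is_M t r' \<eta> N"
    and "is_P (r + r') P"
    and "is_M s 0 \<eta> M0"
    and "is_M s 1 \<eta> M1"
  shows "M \<otimes>\<^sub>D N \<cong>\<^sub>D D4_copies (s * (t - 1)) P \<oplus>\<^sub>D M0 \<oplus>\<^sub>D M1"
proof -
  note two = two_neq_zero[OF assms(1)]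
  interpret T: normal_tensor r r' \<eta> s t by unfold_locales (fact assms)+
  have modules: "D4_module M" "D4_module N" "D4_module M0" "D4_module M1"
    using assms by (simp_all add: is_M_def has_type_def)
  obtain \<gamma>M where M: "model M (UNIV \<times> {..<s}) (M_op r \<eta>) \<gamma>M"
    using is_M_model[OF two assms(4)] by blast
  obtain \<gamma>N where N: "model N (UNIV \<times> {..<t}) (M_op r' \<eta>) \<gamma>N"
    using is_M_model[OF two assms(5)] by blast
  obtain \<gamma>0 where M0: "model M0 (UNIV \<times> {..<s}) (M_op 0 \<eta>) \<gamma>0"
    using is_M_model[OF two assms(7)] by blast
  obtain \<gamma>1 where M1: "model M1 (UNIV \<times> {..<s}) (M_op 1 \<eta>) \<gamma>1"
    using is_M_model[OF two assms(8)] by blast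
  obtain \<gamma>P where P: "D4_module P" "model P {..<4} (P_op T.\<rho>) \<gamma>P"
    using is_P_model[OF two assms(6)] unfolding T.\<rho>_def by blast
  obtain \<gamma> where "model (M \<otimes>\<^sub>D N) T.tensor_basis (tens_op (M_op r \<eta>) (M_op r' \<eta>)) \<gamma>"
    using tensor_model[OF modules(1,2) M N _ _ linear_M_op linear_M_op] by auto
  then have "model (M \<otimes>\<^sub>D N) T.tensor_basis T.\<tau> \<gamma>" unfolding T.\<tau>_def .
  moreover obtain \<theta> where "model (D4_copies (s * (t - 1)) P \<oplus>\<^sub>D M0 \<oplus>\<^sub>D M1) T.tensor_basis T.\<tau> \<theta>"
    using T.summands_model[OF P(2) M0 M1] .
  ultimately show ?thesis
    by (rule iso_of_models)
      (intro operations_closed_sum operations_closed_copies D4_module.operations_closed P(1) modules)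
qed

end
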